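(* Let $(N,\mathsf g,J,\xi)$, $\dim N=2n\ge6$, be a warped product Kähler manifold with base an $\alpha_0$-Sasakian manifold $Q_0$ ($\alpha_0>0$) and function $p(s)$. Then $(N,\mathsf g,J,D)$ is of quasi-constant holomorphic sectional curvatures if and only if the base manifold $Q_0$ is an $\alpha_0$-Sasakian space form.
   Context: **$\alpha_0$-Sasakian manifolds.** An almost contact Riemannian manifold $(Q_0,g_0,\varphi,\tilde\xi_0,\tilde\eta_0)$ satisfies $\tilde\eta_0(x)=g_0(\tilde\xi_0,x)$, $\tilde\xi_0$ unit, $\varphi\tilde\xi_0=0$, $\varphi^2x=-x+\tilde\eta_0(x)\tilde\xi_0$, $g_0(\varphi x,\varphi y)=g_0(x,y)-\tilde\eta_0(x)\tilde\eta_0(y)$. It is $\alpha_0$-Sasakian ($\alpha_0>0$ constant) if, for the Levi-Civita connection $\mathcal D^0$ of $g_0$, $\mathcal D^0_x\tilde\xi_0=\alpha_0\varphi x$ and $(\mathcal D^0_x\varphi)y=\alpha_0\{\tilde\eta_0(y)x-g_0(x,y)\tilde\xi_0\}$. It is an $\alpha_0$-Sasakian space form if moreover it has constant $\varphi$-holomorphic sectional curvatures: $K^0(x_0,\varphi x_0,\varphi x_0,x_0)=H_0=\mathrm{const}$ for all unit $x_0\perp\tilde\xi_0$ ($K^0$ the curvature tensor of $g_0$). **Warped product Kähler manifold.** Given an $\alpha_0$-Sasakian manifold $Q_0$ with $\dim Q_0=2n-1\ge5$ and a smooth function $p(s)$ on an open interval $I_0\ni0$ with $p>0$, $p'>0$,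 $p(0)=1$, $p'(0)=\alpha_0$ ($'=d/ds$), it is the manifold $N=Q_0\times I_0$ with $$\mathsf g=p^2\Big\{g_0+\Big(\frac{p'^2}{\alpha_0^2}-1\Big)\tilde\eta_0\otimes\tilde\eta_0\Big\}+ds\otimes ds,$$ $\xi=\frac{d}{ds}$, $\tilde\xi=\frac{\alpha_0}{pp'}\tilde\xi_0$, distribution $D=\{x_0:ds(x_0)=\tilde\eta_0(x_0)=0\}$, and complex structure $J|_D=\varphi$, $J\xi=\tilde\xi$, $J\tilde\xi=-\xi$. (This is a Kähler manifold, and $D^\perp=\mathrm{span}\{\xi,J\xi\}$.) **Quasi-constant holomorphic sectional curvatures.** A Kähler manifold $(N,\mathsf g,J,D)$ with a $J$-invariant distribution $D$ of real codimension $2$ is of quasi-constant holomorphic sectional curvatures if the sectional curvature of each holomorphic section $E(m)\subset T_mN$ depends only on the point $m$ and on the angle between $E(m)$ and $D^\perp(m)$.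
   Formalization: The base manifold Q_0 is assumed connected; without this the equivalence fails, e.g. for a disjoint union of two α_0-Sasakian space forms with different constants H_0. *)

theory Defs
  imports "HOL-Analysis.Analysis"
begin

text \<open>
  Tensor fields are given by their components: for every chart (named by an index \<open>i\<close>) a function
  of the coordinates \<open>x\<close> in the image of the chart, subject to the usual transformation law.  A tangent
  vector at the point with coordinates \<open>x\<close> is accordingly represented by its component vector,
  an element of the Euclidean model space.  Values outside the images of charts are irrelevant.
\<close>

section \<open>Smooth manifolds\<close>

text \<open>Only used for open sets \<open>S\<close> in finite dimension, where continuity of all iterated
  directional derivatives is continuity of the iterated Frechet derivatives.\<close>

primrec Ck_on :: "nat \<Rightarrow> ('a::euclidean_space \<Rightarrow> 'b::real_normed_vector) \<Rightarrow> 'a set \<Rightarrow> bool" where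
  "Ck_on 0 f S \<longleftrightarrow> continuous_on S f"
| "Ck_on (Suc k) f S \<longleftrightarrow>
     (\<forall>x\<in>S. f differentiable (at x)) \<and> (\<forall>v. Ck_on k (\<lambda>x. frechet_derivative f (at x) v) S)"

definition smooth_on :: "('a::euclidean_space \<Rightarrow> 'b::real_normed_vector) \<Rightarrow> 'a set \<Rightarrow> bool" where
  "smooth_on f S \<longleftrightarrow> (\<forall>k. Ck_on k f S)"

record ('a, 'i, 'e) manifold =
  mtop :: "'a topology"
  charts :: "'i set"
  cdom :: "'i \<Rightarrow> 'a set"
  coord :: "'i \<Rightarrow> 'a \<Rightarrow> 'e"

definition cimg :: "('a, 'i, 'e) manifold \<Rightarrow> 'i \<Rightarrow> 'e set" where
  "cimg M i = coord M i ` cdom M i"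

definition overlap :: "('a, 'i, 'e) manifold \<Rightarrow> 'i \<Rightarrow> 'i \<Rightarrow> 'e set" where
  "overlap M i j = coord M i ` (cdom M i \<inter> cdom M j)"

definition transition :: "('a, 'i, 'e) manifold \<Rightarrow> 'i \<Rightarrow> 'i \<Rightarrow> 'e \<Rightarrow> 'e" where
  "transition M i j x = coord M j (inv_into (cdom M i) (coord M i) x)"

definition jacobian ::
    "('a, 'i, 'e::euclidean_space) manifold \<Rightarrow> 'i \<Rightarrow> 'i \<Rightarrow> 'e \<Rightarrow> 'e \<Rightarrow> 'e" where
  "jacobian M i j x = frechet_derivative (transition M i j) (at x)"

definition smooth_manifold :: "('a, 'i, 'e::euclidean_space) manifold \<Rightarrow> bool" where
  "smooth_manifold M \<longleftrightarrow>
     Hausdorff_space (mtop M) \<and> second_countable (mtop M) \<and>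
     topspace (mtop M) = (\<Union>i\<in>charts M. cdom M i) \<and>
     (\<forall>i\<in>charts M. openin (mtop M) (cdom M i) \<and> open (cimg M i) \<and>
        homeomorphic_map (subtopology (mtop M) (cdom M i)) (top_of_set (cimg M i)) (coord M i)) \<and>
     (\<forall>i\<in>charts M. \<forall>j\<in>charts M. smooth_on (transition M i j) (overlap M i j))"

type_synonym ('i, 'e) vec_field = "'i \<Rightarrow> 'e \<Rightarrow> 'e"
type_synonym ('i, 'e) one_form = "'i \<Rightarrow> 'e \<Rightarrow> 'e \<Rightarrow> real"
type_synonym ('i, 'e) endo = "'i \<Rightarrow> 'e \<Rightarrow> 'e \<Rightarrow> 'e"
type_synonym ('i, 'e) metric = "'i \<Rightarrow> 'e \<Rightarrow> 'e \<Rightarrow> 'e \<Rightarrow> real"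
type_synonym ('i, 'e) distribution = "'i \<Rightarrow> 'e \<Rightarrow> 'e set"

definition vector_field ::
    "('a, 'i, 'e::euclidean_space) manifold \<Rightarrow> ('i, 'e) vec_field \<Rightarrow> bool" where
  "vector_field M X \<longleftrightarrow> (\<forall>i\<in>charts M. smooth_on (X i) (cimg M i) \<and>
     (\<forall>j\<in>charts M. \<forall>x\<in>overlap M i j. jacobian M i j x (X i x) = X j (transition M i j x)))"

definition endo_field ::
    "('a, 'i, 'e::euclidean_space) manifold \<Rightarrow> ('i, 'e) endo \<Rightarrow> bool" where
  "endo_field M F \<longleftrightarrow> (\<forall>i\<in>charts M.
     (\<forall>x\<in>cimg M i. linear (F i x)) \<and>
     (\<forall>v. smooth_on (\<lambda>x. F i x v) (cimg M i)) \<and>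
     (\<forall>j\<in>charts M. \<forall>x\<in>overlap M i j. \<forall>v.
        jacobian M i j x (F i x v) = F j (transition M i j x) (jacobian M i j x v)))"

definition riemannian_metric ::
    "('a, 'i, 'e::euclidean_space) manifold \<Rightarrow> ('i, 'e) metric \<Rightarrow> bool" where
  "riemannian_metric M g \<longleftrightarrow> (\<forall>i\<in>charts M.
     (\<forall>x\<in>cimg M i. bilinear (g i x) \<and> (\<forall>u v. g i x u v = g i x v u) \<and>
        (\<forall>u. u \<noteq> 0 \<longrightarrow> g i x u u > 0)) \<and>
     (\<forall>u v. smooth_on (\<lambda>x. g i x u v) (cimg M i)) \<and>
     (\<forall>j\<in>charts M. \<forall>x\<in>overlap M i j. \<forall>u v.
        g i x u v = g j (transition M i j x) (jacobian M i j x u) (jacobian M i j x v)))"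

definition riemannian_manifold ::
    "('a, 'i, 'e::euclidean_space) manifold \<Rightarrow> ('i, 'e) metric \<Rightarrow> bool" where
  "riemannian_manifold M g \<longleftrightarrow> smooth_manifold M \<and> riemannian_metric M g"


section \<open>Levi-Civita connection and curvature in a chart\<close>

text \<open>In this section \<open>G = g i\<close> is the metric in the coordinates of a fixed chart.  The
  Levi-Civita connection is the unique torsion-free metric one, i.e. \<open>levi_civita G x u v\<close> is
  \<open>\<nabla>\<^sub>u V\<close> at \<open>x\<close> for the field \<open>V\<close> with constant components \<open>v\<close>.\<close>

definition levi_civita ::
    "('e::euclidean_space \<Rightarrow> 'e \<Rightarrow> 'e \<Rightarrow> real) \<Rightarrow> 'e \<Rightarrow> 'e \<Rightarrow> 'e \<Rightarrow> 'e" where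
  "levi_civita G x = (THE B. bilinear B \<and> (\<forall>u v. B u v = B v u) \<and>
     (\<forall>u v w. frechet_derivative (\<lambda>y. G y v w) (at x) u = G x (B u v) w + G x v (B u w)))"

definition cov_deriv ::
    "('e::euclidean_space \<Rightarrow> 'e \<Rightarrow> 'e \<Rightarrow> real) \<Rightarrow> ('e \<Rightarrow> 'e) \<Rightarrow> 'e \<Rightarrow> 'e \<Rightarrow> 'e" where
  "cov_deriv G Y x u = frechet_derivative Y (at x) u + levi_civita G x u (Y x)"

text \<open>\<open>(\<nabla>\<^sub>u F) v = \<nabla>\<^sub>u (F V) - F (\<nabla>\<^sub>u V)\<close>, where \<open>V\<close> has constant components \<open>v\<close>.\<close>

definition cov_deriv_endo ::
    "('e::euclidean_space \<Rightarrow> 'e \<Rightarrow> 'e \<Rightarrow> real) \<Rightarrow> ('e \<Rightarrow> 'e \<Rightarrow> 'e) \<Rightarrow> 'e \<Rightarrow> 'e \<Rightarrow> 'e \<Rightarrow> 'e" where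
  "cov_deriv_endo G F x u v =
     cov_deriv G (\<lambda>y. F y v) x u - F x (cov_deriv G (\<lambda>_. v) x u)"

text \<open>\<open>R(u,v)w = \<nabla>\<^sub>u \<nabla>\<^sub>v W - \<nabla>\<^sub>v \<nabla>\<^sub>u W - \<nabla>\<^bsub>[u,v]\<^esub> W\<close>, evaluated on fields with constant
  components, for which the bracket vanishes.\<close>

definition curvature ::
    "('e::euclidean_space \<Rightarrow> 'e \<Rightarrow> 'e \<Rightarrow> real) \<Rightarrow> 'e \<Rightarrow> 'e \<Rightarrow> 'e \<Rightarrow> 'e \<Rightarrow> 'e" where
  "curvature G x u v w =
     cov_deriv G (\<lambda>y. cov_deriv G (\<lambda>_. w) y v) x u - cov_deriv G (\<lambda>y. cov_deriv G (\<lambda>_. w) y u) x v"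

definition curvature4 ::
    "('e::euclidean_space \<Rightarrow> 'e \<Rightarrow> 'e \<Rightarrow> real) \<Rightarrow> 'e \<Rightarrow> 'e \<Rightarrow> 'e \<Rightarrow> 'e \<Rightarrow> 'e \<Rightarrow> real" where
  "curvature4 G x u v w z = G x (curvature G x u v w) z"

definition sectional_curvature ::
    "('e::euclidean_space \<Rightarrow> 'e \<Rightarrow> 'e \<Rightarrow> real) \<Rightarrow> 'e \<Rightarrow> 'e \<Rightarrow> 'e \<Rightarrow> real" where
  "sectional_curvature G x u v =
     curvature4 G x u v v u / (G x u u * G x v v - (G x u v)\<^sup>2)"

definition orth_complement ::
    "('e::euclidean_space \<Rightarrow> 'e \<Rightarrow> 'e \<Rightarrow> real) \<Rightarrow> 'e \<Rightarrow> 'e set \<Rightarrow> 'e set" where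
  "orth_complement G x W = {v. \<forall>w\<in>W. G x v w = 0}"

definition vec_angle ::
    "('e::euclidean_space \<Rightarrow> 'e \<Rightarrow> 'e \<Rightarrow> real) \<Rightarrow> 'e \<Rightarrow> 'e \<Rightarrow> 'e \<Rightarrow> real" where
  "vec_angle G x u v = arccos (G x u v / (sqrt (G x u u) * sqrt (G x v v)))"

text \<open>The smallest angle between nonzero vectors of two subspaces.  For two planes invariant
  under an orthogonal complex structure both principal angles coincide, so this is the angle between them.\<close>

definition subspace_angle ::
    "('e::euclidean_space \<Rightarrow> 'e \<Rightarrow> 'e \<Rightarrow> real) \<Rightarrow> 'e \<Rightarrow> 'e set \<Rightarrow> 'e set \<Rightarrow> real" where
  "subspace_angle G x E W = Inf {vec_angle G x u w | u w. u \<in> E - {0} \<and> w \<in> W - {0}}"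


section \<open>Sasakian manifolds\<close>

text \<open>The condition \<open>\<eta> = g(\<xi>, \<cdot>)\<close> makes \<open>\<eta>\<close> a smooth one-form.\<close>

definition almost_contact_riemannian ::
    "('a, 'i, 'e::euclidean_space) manifold \<Rightarrow> ('i, 'e) metric \<Rightarrow> ('i, 'e) endo \<Rightarrow>
     ('i, 'e) vec_field \<Rightarrow> ('i, 'e) one_form \<Rightarrow> bool" where
  "almost_contact_riemannian Q g \<phi> \<xi> \<eta> \<longleftrightarrow>
     riemannian_manifold Q g \<and> endo_field Q \<phi> \<and> vector_field Q \<xi> \<and>
     (\<forall>i\<in>charts Q. \<forall>x\<in>cimg Q i.
        (\<forall>u. \<eta> i x u = g i x (\<xi> i x) u) \<and>
        g i x (\<xi> i x) (\<xi> i x) = 1 \<and>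
        \<phi> i x (\<xi> i x) = 0 \<and>
        (\<forall>u. \<phi> i x (\<phi> i x u) = - u + \<eta> i x u *\<^sub>R \<xi> i x) \<and>
        (\<forall>u v. g i x (\<phi> i x u) (\<phi> i x v) = g i x u v - \<eta> i x u * \<eta> i x v))"

definition alpha_sasakian ::
    "real \<Rightarrow> ('a, 'i, 'e::euclidean_space) manifold \<Rightarrow> ('i, 'e) metric \<Rightarrow> ('i, 'e) endo \<Rightarrow>
     ('i, 'e) vec_field \<Rightarrow> ('i, 'e) one_form \<Rightarrow> bool" where
  "alpha_sasakian \<alpha> Q g \<phi> \<xi> \<eta> \<longleftrightarrow>
     \<alpha> > 0 \<and> almost_contact_riemannian Q g \<phi> \<xi> \<eta> \<and>
     (\<forall>i\<in>charts Q. \<forall>x\<in>cimg Q i.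
        (\<forall>u. cov_deriv (g i) (\<xi> i) x u = \<alpha> *\<^sub>R \<phi> i x u) \<and>
        (\<forall>u v. cov_deriv_endo (g i) (\<phi> i) x u v =
                 \<alpha> *\<^sub>R (\<eta> i x v *\<^sub>R u - g i x u v *\<^sub>R \<xi> i x)))"

definition alpha_sasakian_space_form ::
    "real \<Rightarrow> ('a, 'i, 'e::euclidean_space) manifold \<Rightarrow> ('i, 'e) metric \<Rightarrow> ('i, 'e) endo \<Rightarrow>
     ('i, 'e) vec_field \<Rightarrow> ('i, 'e) one_form \<Rightarrow> bool" where
  "alpha_sasakian_space_form \<alpha> Q g \<phi> \<xi> \<eta> \<longleftrightarrow>
     alpha_sasakian \<alpha> Q g \<phi> \<xi> \<eta> \<and>
     (\<exists>H. \<forall>i\<in>charts Q. \<forall>x\<in>cimg Q i. \<forall>u.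
        g i x u u = 1 \<and> g i x u (\<xi> i x) = 0 \<longrightarrow>
        curvature4 (g i) x u (\<phi> i x u) (\<phi> i x u) u = H)"


section \<open>Kaehler manifolds of quasi-constant holomorphic sectional curvatures\<close>

definition kaehler_manifold ::
    "('a, 'i, 'e::euclidean_space) manifold \<Rightarrow> ('i, 'e) metric \<Rightarrow> ('i, 'e) endo \<Rightarrow> bool" where
  "kaehler_manifold N g J \<longleftrightarrow>
     riemannian_manifold N g \<and> endo_field N J \<and>
     (\<forall>i\<in>charts N. \<forall>x\<in>cimg N i.
        (\<forall>u. J i x (J i x u) = - u) \<and>
        (\<forall>u v. g i x (J i x u) (J i x v) = g i x u v) \<and>
        (\<forall>u v. cov_deriv_endo (g i) (J i) x u v = 0))"

definition smooth_distribution ::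
    "('a, 'i, 'e::euclidean_space) manifold \<Rightarrow> nat \<Rightarrow> ('i, 'e) distribution \<Rightarrow> bool" where
  "smooth_distribution N k D \<longleftrightarrow> (\<forall>i\<in>charts N.
     (\<forall>x\<in>cimg N i. subspace (D i x) \<and> dim (D i x) = k) \<and>
     (\<forall>x\<in>cimg N i. \<exists>U. open U \<and> x \<in> U \<and> U \<subseteq> cimg N i \<and>
        (\<exists>F. finite F \<and> (\<forall>X\<in>F. smooth_on X U) \<and>
             (\<forall>y\<in>U. D i y = span ((\<lambda>X. X y) ` F)))) \<and>
     (\<forall>j\<in>charts N. \<forall>x\<in>overlap N i j. jacobian N i j x ` D i x = D j (transition N i j x)))"

definition quasi_constant_hsc ::
    "('a, 'i, 'e::euclidean_space) manifold \<Rightarrow> ('i, 'e) metric \<Rightarrow> ('i, 'e) endo \<Rightarrow>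
     ('i, 'e) distribution \<Rightarrow> bool" where
  "quasi_constant_hsc N g J D \<longleftrightarrow>
     kaehler_manifold N g J \<and>
     smooth_distribution N (DIM('e) - 2) D \<and>
     (\<forall>i\<in>charts N. \<forall>x\<in>cimg N i. J i x ` D i x \<subseteq> D i x) \<and>
     (\<exists>K :: 'a \<Rightarrow> real \<Rightarrow> real. \<forall>i\<in>charts N. \<forall>m\<in>cdom N i.
        let x = coord N i m in
        \<forall>E u v. subspace E \<and> dim E = 2 \<and> J i x ` E \<subseteq> E \<and> E = span {u, v} \<longrightarrow>
          sectional_curvature (g i) x u v =
            K m (subspace_angle (g i) x E (orth_complement (g i) x (D i x))))"


section \<open>Warped product Kaehler manifolds\<close>

definition warping_function :: "real \<Rightarrow> real set \<Rightarrow> (real \<Rightarrow> real) \<Rightarrow> bool" where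
  "warping_function \<alpha> I p \<longleftrightarrow>
     open I \<and> is_interval I \<and> 0 \<in> I \<and> smooth_on p I \<and>
     (\<forall>s\<in>I. p s > 0 \<and> deriv p s > 0) \<and> p 0 = 1 \<and> deriv p 0 = \<alpha>"

text \<open>The charts of \<open>Q \<times> I\<close> are the products of those of \<open>Q\<close> with the coordinate \<open>s\<close> of \<open>I\<close>.\<close>

definition warped_manifold ::
    "('a, 'i, 'e) manifold \<Rightarrow> real set \<Rightarrow> ('a \<times> real, 'i, 'e \<times> real) manifold" where
  "warped_manifold Q I =
     \<lparr>mtop = prod_topology (mtop Q) (top_of_set I),
      charts = charts Q,
      cdom = (\<lambda>i. cdom Q i \<times> I),
      coord = (\<lambda>i (q, s). (coord Q i q, s))\<rparr>"

definition warped_metric ::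
    "real \<Rightarrow> (real \<Rightarrow> real) \<Rightarrow> ('i, 'e) metric \<Rightarrow> ('i, 'e) one_form \<Rightarrow> ('i, 'e \<times> real) metric" where
  "warped_metric \<alpha> p g \<eta> = (\<lambda>i (x, s) (u, a) (v, b).
     (p s)\<^sup>2 * (g i x u v + ((deriv p s)\<^sup>2 / \<alpha>\<^sup>2 - 1) * (\<eta> i x u * \<eta> i x v)) + a * b)"

definition warped_xi :: "('i, 'e::euclidean_space \<times> real) vec_field" where
  "warped_xi = (\<lambda>i (x, s). (0, 1))"

definition warped_xi_tilde ::
    "real \<Rightarrow> (real \<Rightarrow> real) \<Rightarrow> ('i, 'e::euclidean_space) vec_field \<Rightarrow> ('i, 'e \<times> real) vec_field" where
  "warped_xi_tilde \<alpha> p \<xi>0 = (\<lambda>i (x, s). ((\<alpha> / (p s * deriv p s)) *\<^sub>R \<xi>0 i x, 0))"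

definition warped_D :: "('i, 'e) one_form \<Rightarrow> ('i, 'e \<times> real) distribution" where
  "warped_D \<eta> = (\<lambda>i (x, s). {(u, a). a = 0 \<and> \<eta> i x u = 0})"

text \<open>The linear extension of \<open>J|\<^sub>D = \<phi>\<close>, \<open>J \<xi> = \<xi>~\<close>, \<open>J \<xi>~ = - \<xi>\<close>: since \<open>\<phi> \<xi>0 = 0\<close>, the vector
  \<open>(u, a) = (u - \<eta>(u) \<xi>0, 0) + (p p' / \<alpha>) \<eta>(u) \<xi>~ + a \<xi>\<close> is sent to
  \<open>(\<phi> u, 0) - (p p' / \<alpha>) \<eta>(u) \<xi> + a \<xi>~\<close>.\<close>

definition warped_J ::
    "real \<Rightarrow> (real \<Rightarrow> real) \<Rightarrow> ('i, 'e::euclidean_space) endo \<Rightarrow> ('i, 'e) vec_field \<Rightarrow>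
     ('i, 'e) one_form \<Rightarrow> ('i, 'e \<times> real) endo" where
  "warped_J \<alpha> p \<phi> \<xi>0 \<eta> = (\<lambda>i (x, s) (u, a).
     (\<phi> i x u, 0) - (p s * deriv p s / \<alpha> * \<eta> i x u) *\<^sub>R warped_xi i (x, s)
       + a *\<^sub>R warped_xi_tilde \<alpha> p \<xi>0 i (x, s))"

lemma warped_J_characterization:
  assumes "alpha_sasakian \<alpha> Q g \<phi> \<xi>0 \<eta>" "warping_function \<alpha> I p"
    and "i \<in> charts Q" "x \<in> cimg Q i" "s \<in> I"
  shows "linear (warped_J \<alpha> p \<phi> \<xi>0 \<eta> i (x, s))"
    and "(u, a) \<in> warped_D \<eta> i (x, s) \<Longrightarrow> warped_J \<alpha> p \<phi> \<xi>0 \<eta> i (x, s) (u, a) = (\<phi> i x u, 0)"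
    and "warped_J \<alpha> p \<phi> \<xi>0 \<eta> i (x, s) (warped_xi i (x, s)) = warped_xi_tilde \<alpha> p \<xi>0 i (x, s)"
    and "warped_J \<alpha> p \<phi> \<xi>0 \<eta> i (x, s) (warped_xi_tilde \<alpha> p \<xi>0 i (x, s)) = - warped_xi i (x, s)"
proof -
  have ac: "almost_contact_riemannian Q g \<phi> \<xi>0 \<eta>" and \<alpha>: "\<alpha> > 0"
    using assms(1) by (auto simp: alpha_sasakian_def)
  have \<phi>: "linear (\<phi> i x)" "\<phi> i x (\<xi>0 i x) = 0"
    and \<eta>: "\<And>v. \<eta> i x v = g i x (\<xi>0 i x) v" and unit: "g i x (\<xi>0 i x) (\<xi>0 i x) = 1"
    and g: "bilinear (g i x)"
    using ac assms(3,4)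
    by (auto simp: almost_contact_riemannian_def endo_field_def riemannian_manifold_def
        riemannian_metric_def)
  have lin: "linear (\<eta> i x)"
  proof -
    have "\<eta> i x = g i x (\<xi>0 i x)" using \<eta> by blast
    then show ?thesis using g by (simp add: bilinear_def)
  qed
  have p: "p s > 0" "deriv p s > 0"
    using assms(2,5) by (auto simp: warping_function_def)
  note [simp] = linear_add[OF \<phi>(1)] linear_cmul[OF \<phi>(1)] linear_0[OF \<phi>(1)]
    linear_add[OF lin] linear_cmul[OF lin] linear_0[OF lin]
  show "linear (warped_J \<alpha> p \<phi> \<xi>0 \<eta> i (x, s))"
    by (rule linearI)
      (auto simp: warped_J_def warped_xi_def warped_xi_tilde_def algebra_simps add_divide_distrib)
  show "warped_J \<alpha> p \<phi> \<xi>0 \<eta> i (x, s) (u, a) = (\<phi> i x u, 0)" if "(u, a) \<in> warped_D \<eta> i (x, s)"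
    using that by (auto simp: warped_D_def warped_J_def zero_prod_def)
  show "warped_J \<alpha> p \<phi> \<xi>0 \<eta> i (x, s) (warped_xi i (x, s)) = warped_xi_tilde \<alpha> p \<xi>0 i (x, s)"
    by (auto simp: warped_J_def warped_xi_def warped_xi_tilde_def)
  have "\<eta> i x (\<xi>0 i x) = 1"
    using \<eta> unit by simp
  then show "warped_J \<alpha> p \<phi> \<xi>0 \<eta> i (x, s) (warped_xi_tilde \<alpha> p \<xi>0 i (x, s)) = - warped_xi i (x, s)"
    using p \<alpha> \<phi>(2) by (auto simp: warped_J_def warped_xi_def warped_xi_tilde_def)
qed

end

theory Submission
  imports Defs
begin

text \<open>
  In a product chart the Levi-Civita connection of the warped metric is that of \<open>g\<close> plus an explicit
  tensor built from \<open>g, \<phi>, \<xi>, \<eta>\<close> and \<open>p\<close>.  Its curvature on a holomorphic plane spanned by a unit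
  vector \<open>U = (u, a)\<close>, \<open>\<eta> u = 0\<close>, and \<open>J U\<close> depends only on \<open>s\<close>, \<open>a\<close>, \<open>g(u, u)\<close> and the
  \<open>\<phi>\<close>-holomorphic curvature of \<open>u\<close>, and \<open>\<bar>a\<bar>\<close> is the cosine of the angle between the plane and
  the orthogonal complement of \<open>D\<close>.  So a space form \<open>Q\<close> gives quasi-constant curvatures.  Conversely,
  the planes in \<open>D\<close> at \<open>s = 0\<close> show that the \<open>\<phi>\<close>-holomorphic curvature is a function \<open>k\<close> on
  \<open>Q\<close>.  Polarizing once gives \<open>R(X, \<phi> Y, \<phi> Y, Y)\<close> in terms of \<open>k\<close>; its covariant derivative and
  the second Bianchi identity yield \<open>dk = 0\<close> (Schur), as \<open>Y\<close> can be chosen orthogonal to \<open>\<xi>\<close>, \<open>X\<close>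
  and \<open>\<phi> X\<close> in dimension at least 4.
\<close>

section \<open>Calculus of smooth maps\<close>

text \<open>Curvature is defined by coordinate derivatives of \<open>levi_civita\<close>, which is
  only a definite description. Every curvature identity therefore comes down to commuting second
  partial derivatives of component functions, and smoothness of the Christoffel map has to come from
  smooth dependence of the solution of an invertible linear system on its coefficients. For the
  warped metric the connection is written down and then verified; uniqueness identifies it. Two
  obstacles shape Schur's argument. The function k is given only through the curvature identity, so
  its differentiability must be recovered by evaluating that identity on a smooth horizontal field.
  And the field that is parallel at a point to first order does not stay horizontal when its value
  there is horizontal, since \<xi> is not parallel. So the polarized identity is extended to
  arbitrary vectors before it is differentiated.\<close>

abbreviation dd :: "('a::real_normed_vector \<Rightarrow> 'b::real_normed_vector) \<Rightarrow> 'a \<Rightarrow> 'a \<Rightarrow> 'b" where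
  "dd f x u \<equiv> frechet_derivative f (at x) u"

lemma dd_eq: "(f has_derivative f') (at x) \<Longrightarrow> dd f x u = f' u"
  using frechet_derivative_at by metis

text \<open>A derivative at a point of an open set only sees values in that set, so the induction
  passes from f to g one order at a time.\<close>

lemma Ck_on_cong:
  assumes "open S" "\<And>x. x \<in> S \<Longrightarrow> f x = g x"
  shows "Ck_on k f S \<longleftrightarrow> Ck_on k g S"
proof -
  have imp: "Ck_on k g S" if "Ck_on k f S" "\<And>x. x \<in> S \<Longrightarrow> f x = g x" for f g
    using that
  proof (induction k arbitrary: f g)
    case 0
    then show ?case by (simp cong: continuous_on_cong)
  next
    case (Suc k)
    have d: "(g has_derivative frechet_derivative f (at x)) (at x)" if "x \<in> S" for x
      using Suc.prems that assms(1) has_derivative_transform_within_open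
      by (fastforce simp: frechet_derivative_works)
    then have "frechet_derivative g (at x) = frechet_derivative f (at x)" if "x \<in> S" for x
      using that frechet_derivative_at by metis
    with Suc d show ?case
      by (auto simp: differentiable_def intro: Suc.IH intro!: exI)
  qed
  from imp[of f g] imp[of g f] assms(2) show ?thesis by auto
qed

text \<open>The form in which the recursion is used: an explicit derivative \<open>f'\<close>
  replaces \<open>frechet_derivative\<close>, so each closure property below is a derivative rule
  followed by the induction hypothesis.\<close>

lemma Ck_on_SucI:
  assumes "open S" "\<And>x. x \<in> S \<Longrightarrow> (f has_derivative f' x) (at x)"
    and "\<And>v. Ck_on k (\<lambda>x. f' x v) S"
  shows "Ck_on (Suc k) f S"
proof -
  have "Ck_on k (\<lambda>x. dd f x v) S" for v
    using assms(3)[of v] Ck_on_cong[OF assms(1), of "\<lambda>x. dd f x v" "\<lambda>x. f' x v" k] dd_eq[OF assms(2)]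
    by blast
  then show ?thesis using assms(2) by (auto simp: differentiable_def)
qed

lemma Ck_on_Suc_has_derivative:
  "Ck_on (Suc k) f S \<Longrightarrow> x \<in> S \<Longrightarrow> (f has_derivative frechet_derivative f (at x)) (at x)"
  by (simp add: frechet_derivative_works)

lemma Ck_on_Suc_imp: "Ck_on (Suc k) f S \<Longrightarrow> Ck_on k f S"
proof (induction k arbitrary: f)
  case 0
  then show ?case
    using differentiable_imp_continuous_on[of f S] by (simp add: differentiable_on_def differentiable_at_withinI)
next
  case (Suc k)
  then show ?case by simp
qed

lemma Ck_on_const: "Ck_on k (\<lambda>x. c) S"
  by (induction k arbitrary: c) auto

lemma Ck_on_add:
  assumes "open S" shows "Ck_on k f S \<Longrightarrow> Ck_on k g S \<Longrightarrow> Ck_on k (\<lambda>x. f x + g x) S"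
proof (induction k arbitrary: f g)
  case 0
  then show ?case by (simp add: continuous_on_add)
next
  case (Suc k)
  show ?case
    by (rule Ck_on_SucI[OF assms has_derivative_add[OF Ck_on_Suc_has_derivative[OF Suc.prems(1)]
          Ck_on_Suc_has_derivative[OF Suc.prems(2)]] Suc.IH]) (use Suc.prems in auto)
qed

lemma Ck_on_sum:
  assumes "open S" "\<And>a. a \<in> A \<Longrightarrow> Ck_on k (f a) S"
  shows "Ck_on k (\<lambda>x. \<Sum>a\<in>A. f a x) S"
  using assms(2) by (induction A rule: infinite_finite_induct) (auto intro!: Ck_on_const Ck_on_add[OF assms(1)])

lemma Ck_on_linear:
  assumes "open S" "bounded_linear l" shows "Ck_on k f S \<Longrightarrow> Ck_on k (\<lambda>x. l (f x)) S"
proof (induction k arbitrary: f)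
  case 0
  then show ?case by (simp add: bounded_linear.continuous_on[OF assms(2)])
next
  case (Suc k)
  show ?case
    by (rule Ck_on_SucI[OF assms(1) bounded_linear.has_derivative[OF assms(2)
          Ck_on_Suc_has_derivative[OF Suc.prems]] Suc.IH]) (use Suc.prems in auto)
qed

lemma Ck_on_bilinear:
  assumes "open S" "bounded_bilinear b"
  shows "Ck_on k f S \<Longrightarrow> Ck_on k g S \<Longrightarrow> Ck_on k (\<lambda>x. b (f x) (g x)) S"
proof (induction k arbitrary: f g)
  case 0
  then show ?case by (simp add: bounded_bilinear.continuous_on[OF assms(2)])
next
  case (Suc k)
  show ?case
    by (rule Ck_on_SucI[OF assms(1) bounded_bilinear.FDERIV[OF assms(2)
          Ck_on_Suc_has_derivative[OF Suc.prems(1)] Ck_on_Suc_has_derivative[OF Suc.prems(2)]]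
          Ck_on_add[OF assms(1) Suc.IH Suc.IH]])
      (use Suc.prems Ck_on_Suc_imp in auto)
qed

lemma Ck_on_compose_linear:
  assumes "open S" "open T" "bounded_linear l" "\<And>y. y \<in> T \<Longrightarrow> l y \<in> S"
  shows "Ck_on k f S \<Longrightarrow> Ck_on k (\<lambda>y. f (l y)) T"
proof (induction k arbitrary: f)
  case 0
  then show ?case
    using assms by (auto intro: continuous_on_compose2[of S f T l, OF _ linear_continuous_on])
next
  case (Suc k)
  have "((\<lambda>y. f (l y)) has_derivative (\<lambda>v. dd f (l y) (l v))) (at y)" if "y \<in> T" for y
    using has_derivative_compose[OF bounded_linear_imp_has_derivative[OF assms(3)]
        Ck_on_Suc_has_derivative[OF Suc.prems assms(4)[OF that]]] .
  then show ?case
    by (rule Ck_on_SucI[OF assms(2) _ Suc.IH]) (use Suc.prems in auto)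
qed

text \<open>The derivative of 1/f is - (1/f) f' (1/f). The induction hypothesis for 1/f itself and
  closure under products raise the order by one.\<close>

lemma Ck_on_inverse:
  fixes f :: "'a::euclidean_space \<Rightarrow> real"
  assumes "open S" "\<And>x. x \<in> S \<Longrightarrow> f x \<noteq> 0"
  shows "Ck_on k f S \<Longrightarrow> Ck_on k (\<lambda>x. inverse (f x)) S"
proof (induction k)
  case 0
  then show ?case using assms by (simp add: continuous_on_inverse)
next
  case (Suc k)
  note mult = Ck_on_bilinear[OF assms(1) bounded_bilinear_mult]
  note inv = Suc.IH[OF Ck_on_Suc_imp[OF Suc.prems]]
  have "Ck_on k (\<lambda>x. - 1 * (inverse (f x) * dd f x v * inverse (f x))) S" for v
    by (intro mult Ck_on_const inv) (use Suc.prems in auto)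
  then have "Ck_on k (\<lambda>x. - (inverse (f x) * dd f x v * inverse (f x))) S" for v
    by simp
  moreover have "((\<lambda>x. inverse (f x)) has_derivative
      (\<lambda>v. - (inverse (f x) * dd f x v * inverse (f x)))) (at x)" if "x \<in> S" for x
    using Deriv.has_derivative_inverse[OF assms(2)[OF that] Ck_on_Suc_has_derivative[OF Suc.prems that]] .
  ultimately show ?case by (rule Ck_on_SucI[OF assms(1), rotated])
qed

lemma smooth_on_cong:
  "open S \<Longrightarrow> (\<And>x. x \<in> S \<Longrightarrow> f x = g x) \<Longrightarrow> smooth_on f S \<longleftrightarrow> smooth_on g S"
  by (simp add: smooth_on_def Ck_on_cong[of S f g])

lemma smooth_on_has_derivative:
  "smooth_on f S \<Longrightarrow> x \<in> S \<Longrightarrow> (f has_derivative frechet_derivative f (at x)) (at x)"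
  using Ck_on_Suc_has_derivative unfolding smooth_on_def by blast

lemma smooth_on_imp_continuous_on: "smooth_on f S \<Longrightarrow> continuous_on S f"
  unfolding smooth_on_def using Ck_on.simps(1) by blast

lemma smooth_on_dd: "smooth_on f S \<Longrightarrow> smooth_on (\<lambda>x. dd f x v) S"
  unfolding smooth_on_def using Ck_on.simps(2) by blast

lemma smooth_on_const: "smooth_on (\<lambda>x. c) S"
  by (simp add: smooth_on_def Ck_on_const)

lemma smooth_on_add:
  "open S \<Longrightarrow> smooth_on f S \<Longrightarrow> smooth_on g S \<Longrightarrow> smooth_on (\<lambda>x. f x + g x) S"
  by (simp add: smooth_on_def Ck_on_add)

lemma smooth_on_sum:
  "open S \<Longrightarrow> (\<And>a. a \<in> A \<Longrightarrow> smooth_on (f a) S) \<Longrightarrow> smooth_on (\<lambda>x. \<Sum>a\<in>A. f a x) S"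
  by (simp add: smooth_on_def Ck_on_sum)

lemma smooth_on_linear:
  "open S \<Longrightarrow> bounded_linear l \<Longrightarrow> smooth_on f S \<Longrightarrow> smooth_on (\<lambda>x. l (f x)) S"
  by (simp add: smooth_on_def Ck_on_linear)

lemma smooth_on_minus: "open S \<Longrightarrow> smooth_on f S \<Longrightarrow> smooth_on (\<lambda>x. - f x) S"
  by (rule smooth_on_linear[OF _ bounded_linear_minus[OF bounded_linear_ident]])

lemma smooth_on_diff:
  "open S \<Longrightarrow> smooth_on f S \<Longrightarrow> smooth_on g S \<Longrightarrow> smooth_on (\<lambda>x. f x - g x) S"
  using smooth_on_add[OF _ _ smooth_on_minus, of S f g] by simp

lemma smooth_on_bilinear:
  "open S \<Longrightarrow> bounded_bilinear b \<Longrightarrow> smooth_on f S \<Longrightarrow> smooth_on g S \<Longrightarrow> smooth_on (\<lambda>x. b (f x) (g x)) S"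
  by (simp add: smooth_on_def Ck_on_bilinear)

lemmas smooth_on_mult = smooth_on_bilinear[OF _ bounded_bilinear_mult]
lemmas smooth_on_scaleR = smooth_on_bilinear[OF _ bounded_bilinear_scaleR]

lemma smooth_on_compose_linear:
  "open S \<Longrightarrow> open T \<Longrightarrow> bounded_linear l \<Longrightarrow> (\<And>y. y \<in> T \<Longrightarrow> l y \<in> S) \<Longrightarrow> smooth_on f S
    \<Longrightarrow> smooth_on (\<lambda>y. f (l y)) T"
  using Ck_on_compose_linear[of S T l] unfolding smooth_on_def by blast

lemma smooth_on_inverse:
  fixes f :: "'a::euclidean_space \<Rightarrow> real"
  shows "open S \<Longrightarrow> (\<And>x. x \<in> S \<Longrightarrow> f x \<noteq> 0) \<Longrightarrow> smooth_on f S \<Longrightarrow> smooth_on (\<lambda>x. inverse (f x)) S"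
  by (simp add: smooth_on_def Ck_on_inverse)

lemma smooth_on_ident: "open S \<Longrightarrow> smooth_on (\<lambda>x. x) S"
proof -
  assume "open S"
  have "Ck_on k (\<lambda>x. x) S" for k
  proof (cases k)
    case (Suc j)
    then show ?thesis using Ck_on_SucI[OF \<open>open S\<close> has_derivative_ident Ck_on_const] by auto
  qed auto
  then show ?thesis by (simp add: smooth_on_def)
qed

lemma smooth_on_Pair:
  assumes "open S" "smooth_on f S" "smooth_on g S"
  shows "smooth_on (\<lambda>x. (f x, g x)) S"
proof -
  have "bounded_linear (\<lambda>a::'b. (a, 0::'c))" "bounded_linear (\<lambda>b::'c. (0::'b, b))"
    by (auto intro!: bounded_linear_Pair bounded_linear_ident bounded_linear_zero)
  from smooth_on_add[OF assms(1) smooth_on_linear[OF assms(1) this(1) assms(2)]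
      smooth_on_linear[OF assms(1) this(2) assms(3)]]
  show ?thesis by simp
qed

section \<open>Smooth families of linear and bilinear maps\<close>

lemma linear_basis_expansion:
  "linear l \<Longrightarrow> l (w::'a::euclidean_space) = (\<Sum>b\<in>Basis. (w \<bullet> b) *\<^sub>R l b)"
  by (metis (no_types, lifting) euclidean_representation linear_sum linear_cmul sum.cong)

text \<open>Tensor components are known to be smooth only for fixed vector arguments. Expanding a
  variable argument over \<open>Basis\<close> reduces F x (w x) to finitely many products of such
  functions.\<close>

lemma Ck_on_linear_family:
  assumes "open S" "\<And>x. x \<in> S \<Longrightarrow> linear (F x)" "\<And>v. Ck_on k (\<lambda>x. F x v) S" "Ck_on k w S"
  shows "Ck_on k (\<lambda>x. F x (w x :: 'a::euclidean_space)) S"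
proof -
  have "Ck_on k (\<lambda>x. \<Sum>b\<in>Basis. (w x \<bullet> b) *\<^sub>R F x b) S"
    by (intro Ck_on_sum assms Ck_on_bilinear[OF _ bounded_bilinear_scaleR]
        Ck_on_linear[OF _ bounded_linear_inner_left])
  then show ?thesis
    by (rule Ck_on_cong[THEN iffD1, rotated -1]) (auto simp: assms(1) linear_basis_expansion[OF assms(2), symmetric])
qed

lemma smooth_on_linear_family:
  assumes "open S" "\<And>x. x \<in> S \<Longrightarrow> linear (F x)" "\<And>v. smooth_on (\<lambda>x. F x v) S" "smooth_on w S"
  shows "smooth_on (\<lambda>x. F x (w x :: 'a::euclidean_space)) S"
  unfolding smooth_on_def
proof
  show "Ck_on k (\<lambda>x. F x (w x)) S" for k
    by (rule Ck_on_linear_family[OF assms(1,2)]) (use assms(3,4) in \<open>simp_all add: smooth_on_def\<close>)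
qed

lemma smooth_on_bilinear_family:
  assumes "open S" "\<And>x. x \<in> S \<Longrightarrow> bilinear (F x)" "\<And>u v. smooth_on (\<lambda>x. F x u v) S"
    and "smooth_on w S" "smooth_on z S"
  shows "smooth_on (\<lambda>x. F x (w x :: 'a::euclidean_space) (z x :: 'b::euclidean_space)) S"
proof -
  have "smooth_on (\<lambda>x. F x (w x) v) S" for v
    by (rule smooth_on_linear_family[OF assms(1) _ assms(3,4)]) (use assms(2) in \<open>auto simp: bilinear_def\<close>)
  from smooth_on_linear_family[where F = "\<lambda>x. F x (w x)", OF assms(1) _ this assms(5)] show ?thesis
    using assms(2) by (simp add: bilinear_def)
qed

lemma has_derivative_linear_family:
  assumes "open S" "x \<in> S" "\<And>y. y \<in> S \<Longrightarrow> linear (F y)"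
    and "\<And>v. ((\<lambda>y. F y v) has_derivative F' v) (at x)" "(w has_derivative w') (at x)"
  shows "((\<lambda>y. F y (w y :: 'a::euclidean_space)) has_derivative (\<lambda>h. F' (w x) h + F x (w' h))) (at x)"
proof -
  \<comment> \<open>The hypothesis provides F' v for each v separately; expanding v over
    \<open>Basis\<close> and uniqueness of derivatives show that F' v h is linear in v.\<close>
  have eq: "F' v h = (\<Sum>b\<in>Basis. (v \<bullet> b) *\<^sub>R F' b h)" for v h
  proof -
    have "((\<lambda>y. \<Sum>b\<in>Basis. (v \<bullet> b) *\<^sub>R F y b) has_derivative (\<lambda>h. \<Sum>b\<in>Basis. (v \<bullet> b) *\<^sub>R F' b h)) (at x)"
      by (intro has_derivative_sum has_derivative_scaleR_right assms(4))
    then have "((\<lambda>y. F y v) has_derivative (\<lambda>h. \<Sum>b\<in>Basis. (v \<bullet> b) *\<^sub>R F' b h)) (at x)"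
      by (rule has_derivative_transform_within_open[OF _ assms(1,2)])
        (simp add: linear_basis_expansion[OF assms(3), symmetric])
    from has_derivative_unique[OF this assms(4)] show ?thesis by metis
  qed
  have "((\<lambda>y. \<Sum>b\<in>Basis. (w y \<bullet> b) *\<^sub>R F y b) has_derivative
      (\<lambda>h. \<Sum>b\<in>Basis. (w x \<bullet> b) *\<^sub>R F' b h + (w' h \<bullet> b) *\<^sub>R F x b)) (at x)"
    by (intro has_derivative_sum has_derivative_scaleR has_derivative_inner_left assms(4,5))
  then have "((\<lambda>y. F y (w y)) has_derivative
      (\<lambda>h. \<Sum>b\<in>Basis. (w x \<bullet> b) *\<^sub>R F' b h + (w' h \<bullet> b) *\<^sub>R F x b)) (at x)"
    by (rule has_derivative_transform_within_open[OF _ assms(1,2)])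
      (simp add: linear_basis_expansion[OF assms(3), symmetric])
  then show ?thesis
    by (simp add: sum.distrib eq[symmetric] linear_basis_expansion[OF assms(3)[OF assms(2)], symmetric])
qed

lemma has_derivative_bilinear_family:
  assumes "open S" "x \<in> S" "\<And>y. y \<in> S \<Longrightarrow> bilinear (F y)"
    and "\<And>u v. ((\<lambda>y. F y u v) has_derivative F' u v) (at x)"
    and "(w has_derivative w') (at x)" "(z has_derivative z') (at x)"
  shows "((\<lambda>y. F y (w y :: 'a::euclidean_space) (z y :: 'b::euclidean_space)) has_derivative
    (\<lambda>h. F' (w x) (z x) h + F x (w' h) (z x) + F x (w x) (z' h))) (at x)"
proof -
  have "((\<lambda>y. F y (w y) v) has_derivative (\<lambda>h. F' (w x) v h + F x (w' h) v)) (at x)" for v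
    by (rule has_derivative_linear_family[OF assms(1,2) _ assms(4,5)])
      (use assms(3) in \<open>auto simp: bilinear_def\<close>)
  from has_derivative_linear_family[where F = "\<lambda>y. F y (w y)", OF assms(1,2) _ this assms(6)] show ?thesis
    using assms(3) by (simp add: bilinear_def)
qed

lemma has_derivative_along_line:
  fixes f :: "'a::real_normed_vector \<Rightarrow> real"
  assumes "(f has_derivative f') (at (a + s *\<^sub>R u))"
  shows "((\<lambda>s. f (a + s *\<^sub>R u)) has_real_derivative f' u) (at s)"
proof -
  have "((\<lambda>s. a + s *\<^sub>R u) has_derivative (\<lambda>h. h *\<^sub>R u)) (at s)"
    by (auto intro!: derivative_eq_intros)
  from has_derivative_compose[OF this assms]
  have "((\<lambda>s. f (a + s *\<^sub>R u)) has_derivative (\<lambda>h. f' (h *\<^sub>R u))) (at s)" .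
  moreover have "f' (h *\<^sub>R u) = f' u * h" for h
    using linear_cmul[OF has_derivative_linear[OF assms]] by simp
  ultimately show ?thesis by (simp add: has_field_derivative_def)
qed

section \<open>Symmetry of second derivatives\<close>

text \<open>The mean value theorem is applied twice: to the difference of f along two parallel
  segments in direction u, then to the resulting first derivative in direction v. The left side is
  symmetric in u and v, which is the source of the symmetry of second derivatives.\<close>

lemma second_difference:
  fixes f :: "'a::euclidean_space \<Rightarrow> real"
  assumes "smooth_on f S" "ball x r \<subseteq> S" "t > 0" "t * (norm u + norm v) < r"
  shows "\<exists>y. dist x y \<le> t * (norm u + norm v) \<and>
    f (x + t *\<^sub>R u + t *\<^sub>R v) - f (x + t *\<^sub>R u) - f (x + t *\<^sub>R v) + f x = t\<^sup>2 * dd (\<lambda>y. dd f y u) y v"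
proof -
  have near: "dist x (x + a *\<^sub>R u + b *\<^sub>R v) \<le> t * (norm u + norm v)"
      "x + a *\<^sub>R u + b *\<^sub>R v \<in> S" if "0 \<le> a" "a \<le> t" "0 \<le> b" "b \<le> t" for a b
  proof -
    have "dist x (x + a *\<^sub>R u + b *\<^sub>R v) = norm (a *\<^sub>R u + b *\<^sub>R v)"
      by (metis add.assoc dist_norm norm_minus_commute add_diff_cancel_left')
    also have "\<dots> \<le> a * norm u + b * norm v"
      using norm_triangle_ineq[of "a *\<^sub>R u" "b *\<^sub>R v"] that by simp
    also have "\<dots> \<le> t * norm u + t * norm v"
      using that by (intro add_mono mult_right_mono) auto
    finally show "dist x (x + a *\<^sub>R u + b *\<^sub>R v) \<le> t * (norm u + norm v)"
      by (simp add: algebra_simps)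
    with assms(2,4) show "x + a *\<^sub>R u + b *\<^sub>R v \<in> S"
      by (auto simp: subset_iff)
  qed
  have "((\<lambda>s. f ((x + t *\<^sub>R v) + s *\<^sub>R u) - f (x + s *\<^sub>R u)) has_real_derivative
      dd f (x + t *\<^sub>R v + s *\<^sub>R u) u - dd f (x + s *\<^sub>R u) u) (at s)" if "0 \<le> s" "s \<le> t" for s
    using near(2)[of s t] near(2)[of s 0] that assms(3)
    by (intro DERIV_diff has_derivative_along_line smooth_on_has_derivative[OF assms(1)])
      (auto simp: algebra_simps)
  from MVT2[OF assms(3) this] obtain s where s: "0 < s" "s < t" and 1:
    "f (x + t *\<^sub>R v + t *\<^sub>R u) - f (x + t *\<^sub>R u) - (f (x + t *\<^sub>R v) - f x)
      = t * (dd f (x + t *\<^sub>R v + s *\<^sub>R u) u - dd f (x + s *\<^sub>R u) u)"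
    by auto
  have "((\<lambda>r. dd f ((x + s *\<^sub>R u) + r *\<^sub>R v) u) has_real_derivative
      dd (\<lambda>y. dd f y u) (x + s *\<^sub>R u + r *\<^sub>R v) v) (at r)" if "0 \<le> r" "r \<le> t" for r
    using near(2)[of s r] that s
    by (intro has_derivative_along_line[of "\<lambda>y. dd f y u"] smooth_on_has_derivative[OF smooth_on_dd[OF assms(1)]]) auto
  from MVT2[OF assms(3) this] obtain r where r: "0 < r" "r < t" and 2:
    "dd f (x + s *\<^sub>R u + t *\<^sub>R v) u - dd f (x + s *\<^sub>R u) u = t * dd (\<lambda>y. dd f y u) (x + s *\<^sub>R u + r *\<^sub>R v) v"
    by auto
  have "f (x + t *\<^sub>R u + t *\<^sub>R v) - f (x + t *\<^sub>R u) - f (x + t *\<^sub>R v) + f x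
      = t\<^sup>2 * dd (\<lambda>y. dd f y u) (x + s *\<^sub>R u + r *\<^sub>R v) v"
    using 1 2 by (simp add: add_ac power2_eq_square)
  with near(1)[of s r] s r show ?thesis by (intro exI[of _ "x + s *\<^sub>R u + r *\<^sub>R v"]) auto
qed

text \<open>Both orders of differentiation compute the same second difference. After division by t^2
  the intermediate points converge to x as t tends to 0, and the second derivatives are continuous
  there.\<close>

lemma dd_commute_real:
  fixes f :: "'a::euclidean_space \<Rightarrow> real"
  assumes "open S" "smooth_on f S" "x \<in> S"
  shows "dd (\<lambda>y. dd f y u) x v = dd (\<lambda>y. dd f y v) x u"
proof -
  obtain r where r: "r > 0" "ball x r \<subseteq> S"
    using assms(1,3) openE by blast
  \<comment> \<open>The summand 1 allows u = v = 0 and makes the bound t n * (norm u + norm v) < r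
    strict.\<close>
  define c where "c = r / (norm u + norm v + 1)"
  define t where "t n = c / real (Suc n)" for n
  have pos: "norm u + norm v + 1 > 0" by (smt (verit) norm_ge_zero)
  have c: "c > 0" using r pos by (simp add: c_def)
  have t: "t n > 0" for n using c by (simp add: t_def)
  have tc: "t n \<le> c" for n using c by (simp add: t_def field_simps)
  have small: "t n * (norm u + norm v) < r" "t n * (norm v + norm u) < r" for n
  proof -
    have "t n * (norm u + norm v) < t n * (norm u + norm v + 1)" using t[of n] by simp
    also have "\<dots> \<le> c * (norm u + norm v + 1)" using tc[of n] pos by (simp add: mult_right_mono)
    also have "\<dots> = r" using pos by (simp add: c_def)
    finally show "t n * (norm u + norm v) < r" "t n * (norm v + norm u) < r" by (simp_all add: add_ac)
  qed
  have "\<forall>n. \<exists>y z. dist x y \<le> t n * (norm u + norm v) \<and> dist x z \<le> t n * (norm u + norm v) \<and>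
      dd (\<lambda>y. dd f y u) y v = dd (\<lambda>y. dd f y v) z u"
  proof
    fix n
    from second_difference[OF assms(2) r(2) t small(1)] obtain y where
      y: "dist x y \<le> t n * (norm u + norm v)" and
      1: "f (x + t n *\<^sub>R u + t n *\<^sub>R v) - f (x + t n *\<^sub>R u) - f (x + t n *\<^sub>R v) + f x
         = (t n)\<^sup>2 * dd (\<lambda>y. dd f y u) y v" by blast
    from second_difference[OF assms(2) r(2) t small(2)] obtain z where
      z: "dist x z \<le> t n * (norm v + norm u)" and
      2: "f (x + t n *\<^sub>R v + t n *\<^sub>R u) - f (x + t n *\<^sub>R v) - f (x + t n *\<^sub>R u) + f x
         = (t n)\<^sup>2 * dd (\<lambda>y. dd f y v) z u" by blast
    have "(t n)\<^sup>2 * dd (\<lambda>y. dd f y u) y v = (t n)\<^sup>2 * dd (\<lambda>y. dd f y v) z u"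
      unfolding 1[symmetric] 2[symmetric] by (simp add: add.assoc add.commute[of "t n *\<^sub>R v"])
    then have "dd (\<lambda>y. dd f y u) y v = dd (\<lambda>y. dd f y v) z u" using t[of n] by simp
    with y z show "\<exists>y z. dist x y \<le> t n * (norm u + norm v) \<and> dist x z \<le> t n * (norm u + norm v) \<and>
      dd (\<lambda>y. dd f y u) y v = dd (\<lambda>y. dd f y v) z u" by (auto simp: add_ac)
  qed
  then obtain y z where yz: "\<And>n. dist x (y n) \<le> t n * (norm u + norm v)"
      "\<And>n. dist x (z n) \<le> t n * (norm u + norm v)"
      "\<And>n. dd (\<lambda>y. dd f y u) (y n) v = dd (\<lambda>y. dd f y v) (z n) u"
    by metis
  have "t \<longlonglongrightarrow> 0"
    unfolding t_def using LIMSEQ_Suc[OF lim_const_over_n[of c]] by simp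
  then have lim: "(\<lambda>n. t n * (norm u + norm v)) \<longlonglongrightarrow> 0"
    by (auto intro: tendsto_mult_left_zero)
  have y: "y \<longlonglongrightarrow> x" and z: "z \<longlonglongrightarrow> x"
    using yz(1,2) by (auto intro!: metric_tendsto_imp_tendsto[OF lim] always_eventually simp: dist_commute t
        order.strict_implies_order)
  have cont: "isCont (\<lambda>y. dd (\<lambda>y. dd f y a) y b) x" for a b
    using smooth_on_imp_continuous_on[OF smooth_on_dd[OF smooth_on_dd[OF assms(2)]]] assms(1,3)
    by (simp add: continuous_on_eq_continuous_at)
  have "(\<lambda>n. dd (\<lambda>y. dd f y u) (y n) v) \<longlonglongrightarrow> dd (\<lambda>y. dd f y u) x v"
    by (rule isCont_tendsto_compose[OF cont y])
  moreover have "(\<lambda>n. dd (\<lambda>y. dd f y u) (y n) v) \<longlonglongrightarrow> dd (\<lambda>y. dd f y v) x u"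
    using isCont_tendsto_compose[OF cont z] yz(3) by simp
  ultimately show ?thesis by (rule LIMSEQ_unique)
qed

lemma dd_linear:
  assumes "bounded_linear l" "f differentiable (at x)"
  shows "dd (\<lambda>y. l (f y)) x u = l (dd f x u)"
  using dd_eq[OF bounded_linear.has_derivative[OF assms(1) frechet_derivative_works[THEN iffD1, OF assms(2)]]]
  by simp

lemma dd_commute:
  fixes f :: "'a::euclidean_space \<Rightarrow> 'b::euclidean_space"
  assumes "open S" "smooth_on f S" "x \<in> S"
  shows "dd (\<lambda>y. dd f y u) x v = dd (\<lambda>y. dd f y v) x u"
proof (rule euclidean_eqI)
  fix b :: 'b assume "b \<in> Basis"
  have sm: "smooth_on (\<lambda>y. f y \<bullet> b) S"
    by (rule smooth_on_linear[OF assms(1) bounded_linear_inner_left assms(2)])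
  have "dd (\<lambda>y. dd f y u) x v \<bullet> b = dd (\<lambda>y. dd (\<lambda>y. f y \<bullet> b) y u) x v" for u v
  proof -
    have diff: "f differentiable (at y)" if "y \<in> S" for y
      using smooth_on_has_derivative[OF assms(2) that] differentiableI by blast
    have "dd (\<lambda>y. dd f y u) x v \<bullet> b = dd (\<lambda>y. dd f y u \<bullet> b) x v"
      using dd_linear[OF bounded_linear_inner_left]
        differentiableI[OF smooth_on_has_derivative[OF smooth_on_dd[OF assms(2)] assms(3)]] by metis
    also have "\<dots> = dd (\<lambda>y. dd (\<lambda>y. f y \<bullet> b) y u) x v"
    proof (rule fun_cong[OF frechet_derivative_transform_within_open[OF _ assms(1,3)]])
      show "(\<lambda>y. dd f y u \<bullet> b) differentiable at x"
        using smooth_on_has_derivative[OF smooth_on_linear[OF assms(1) bounded_linear_inner_left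
              smooth_on_dd[OF assms(2)]] assms(3)] differentiableI by blast
    qed (use dd_linear[OF bounded_linear_inner_left diff] in simp)
    finally show ?thesis .
  qed
  with dd_commute_real[OF assms(1) sm assms(3)]
  show "dd (\<lambda>y. dd f y u) x v \<bullet> b = dd (\<lambda>y. dd f y v) x u \<bullet> b" by simp
qed

section \<open>Smooth dependence of solutions of linear systems\<close>

text \<open>In finite dimension continuity at each vector controls the operator norm: \<delta> sums
  the deviations on the basis vectors.\<close>

lemma linear_family_norm_diff:
  fixes L :: "'a::euclidean_space \<Rightarrow> 'b::euclidean_space \<Rightarrow> 'b"
  assumes "x \<in> S" "\<And>y. y \<in> S \<Longrightarrow> linear (L y)" "\<And>v. isCont (\<lambda>y. L y v) x"
  obtains \<delta> where "(\<delta> \<longlongrightarrow> 0) (at x)" "\<And>y. \<delta> y \<ge> 0"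
    "\<And>y v. y \<in> S \<Longrightarrow> norm (L y v - L x v) \<le> \<delta> y * norm v"
proof -
  define \<delta> where "\<delta> y = (\<Sum>b\<in>Basis. norm (L y b - L x b))" for y
  have bound: "norm (L y v - L x v) \<le> \<delta> y * norm v" if "y \<in> S" for y v
  proof -
    have "L y v - L x v = (\<Sum>b\<in>Basis. (v \<bullet> b) *\<^sub>R (L y b - L x b))"
      by (simp add: linear_basis_expansion[OF assms(2)[OF that], of v]
          linear_basis_expansion[OF assms(2)[OF assms(1)], of v] sum_subtractf scaleR_diff_right)
    also have "norm \<dots> \<le> (\<Sum>b\<in>Basis. norm v * norm (L y b - L x b))"
      by (rule sum_norm_le) (simp add: Basis_le_norm mult_right_mono)
    finally show ?thesis by (simp add: \<delta>_def sum_distrib_left mult.commute)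
  qed
  have "(\<delta> \<longlongrightarrow> (\<Sum>b\<in>Basis. norm (L x b - L x b))) (at x)"
    unfolding \<delta>_def using assms(3)
    by (intro tendsto_sum tendsto_norm tendsto_diff tendsto_const) (simp add: isCont_def)
  then have "(\<delta> \<longlongrightarrow> 0) (at x)" by simp
  with bound that show ?thesis by (simp add: \<delta>_def sum_nonneg)
qed

text \<open>An injective L x is bounded below by some constant, and half of it survives any
  perturbation whose operator norm is less than the other half.\<close>

lemma linear_family_bounded_below:
  fixes L :: "'a::euclidean_space \<Rightarrow> 'b::euclidean_space \<Rightarrow> 'b"
  assumes "open S" "x \<in> S" "\<And>y. y \<in> S \<Longrightarrow> linear (L y)" "inj (L x)" "\<And>v. isCont (\<lambda>y. L y v) x"
  obtains B where "B > 0" "eventually (\<lambda>y. y \<in> S \<and> (\<forall>v. B * norm v \<le> norm (L y v))) (at x)"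
proof -
  obtain B where B: "B > 0" "\<And>v. B * norm v \<le> norm (L x v)"
    using linear_inj_bounded_below_pos[OF assms(3)[OF assms(2)] assms(4)] by auto
  obtain \<delta> where \<delta>: "(\<delta> \<longlongrightarrow> 0) (at x)" "\<And>y v. y \<in> S \<Longrightarrow> norm (L y v - L x v) \<le> \<delta> y * norm v"
    using linear_family_norm_diff[OF assms(2,3,5)] by metis
  have "eventually (\<lambda>y. \<delta> y < B/2) (at x)"
    using B(1) \<delta>(1) by (auto dest: order_tendstoD(2)[of _ _ _ "B/2"])
  moreover have "eventually (\<lambda>y. y \<in> S) (at x)"
    using assms(1,2) eventually_at_topological by blast
  ultimately have "eventually (\<lambda>y. y \<in> S \<and> (\<forall>v. B/2 * norm v \<le> norm (L y v))) (at x)"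
  proof eventually_elim
    case (elim y)
    have "B/2 * norm v \<le> norm (L y v)" for v
    proof -
      have "norm (L y v - L x v) \<le> B/2 * norm v"
        using \<delta>(2)[OF elim(2), of v] elim(1) mult_right_mono[of "\<delta> y" "B/2" "norm v"] by simp
      with B(2)[of v] norm_triangle_sub[of "L x v" "L y v"] show ?thesis
        by (simp add: norm_minus_commute)
    qed
    with elim show ?case by blast
  qed
  with B(1) that[of "B/2"] show ?thesis by simp
qed

text \<open>L y maps z y - z x to c y - L y (z x), which tends to 0; the uniform lower bound for L y
  transfers this to z.\<close>

lemma isCont_linear_solution:
  fixes L :: "'a::euclidean_space \<Rightarrow> 'b::euclidean_space \<Rightarrow> 'b"
  assumes "open S" "x \<in> S" "\<And>y. y \<in> S \<Longrightarrow> linear (L y)" "inj (L x)" "\<And>v. isCont (\<lambda>y. L y v) x"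
    and c: "isCont c x" and sol: "\<And>y. y \<in> S \<Longrightarrow> L y (z y) = c y"
  shows "isCont z x"
proof -
  obtain B where B: "B > 0" "eventually (\<lambda>y. y \<in> S \<and> (\<forall>v. B * norm v \<le> norm (L y v))) (at x)"
    using linear_family_bounded_below[OF assms(1-5)] .
  have "((\<lambda>y. c y - L y (z x)) \<longlongrightarrow> c x - L x (z x)) (at x)"
    using c assms(5)[of "z x"] by (intro tendsto_diff) (auto simp: isCont_def)
  then have "((\<lambda>y. norm (c y - L y (z x)) / B) \<longlongrightarrow> norm (0::'b) / B) (at x)"
    using sol[OF assms(2)] B(1) by (intro tendsto_intros) auto
  then have "((\<lambda>y. norm (c y - L y (z x)) / B) \<longlongrightarrow> 0) (at x)" by simp
  moreover have "eventually (\<lambda>y. norm (z y - z x) \<le> norm (c y - L y (z x)) / B) (at x)"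
    using B(2)
  proof eventually_elim
    case (elim y)
    then have "c y - L y (z x) = L y (z y - z x)"
      using linear_diff[OF assms(3)] sol by metis
    with elim have "B * norm (z y - z x) \<le> norm (c y - L y (z x))" by metis
    with B(1) show ?case by (simp add: field_simps)
  qed
  ultimately have "((\<lambda>y. z y - z x) \<longlongrightarrow> 0) (at x)" by (rule Lim_null_comparison[rotated])
  then show ?thesis by (simp add: isCont_def LIM_zero_iff)
qed

text \<open>Implicit differentiation of L y (z y) = c y dictates the derivative. As z is not known
  to be differentiable, the candidate is verified by estimating its remainder.\<close>

lemma has_derivative_linear_solution:
  fixes L :: "'a::euclidean_space \<Rightarrow> 'b::euclidean_space \<Rightarrow> 'b"
  assumes "open S" "x \<in> S" "\<And>y. y \<in> S \<Longrightarrow> linear (L y)" "inj (L x)"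
    and L': "\<And>v. ((\<lambda>y. L y v) has_derivative L' v) (at x)"
    and c': "(c has_derivative c') (at x)"
    and sol: "\<And>y. y \<in> S \<Longrightarrow> L y (z y) = c y"
  shows "\<exists>z'. (z has_derivative z') (at x) \<and> (\<forall>h. L x (z' h) = c' h - L' (z x) h)"
proof -
  have lin: "linear (L x)" using assms(2,3) by blast
  have contL: "isCont (\<lambda>y. L y b) x" for b using L' has_derivative_continuous by blast
  obtain B where B: "B > 0" "eventually (\<lambda>y. y \<in> S \<and> (\<forall>v. B * norm v \<le> norm (L y v))) (at x)"
    using linear_family_bounded_below[OF assms(1-4) contL] .
  obtain \<delta> where \<delta>: "(\<delta> \<longlongrightarrow> 0) (at x)" "\<And>y. \<delta> y \<ge> 0"
      "\<And>y v. y \<in> S \<Longrightarrow> norm (L y v - L x v) \<le> \<delta> y * norm v"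
    using linear_family_norm_diff[OF assms(2,3) contL] by blast
  obtain M where "linear M" "L x \<circ> M = id"
    using linear_surjective_right_inverse[OF lin linear_injective_imp_surjective[OF lin assms(4)]] by auto
  then have M: "linear M" "\<And>v. L x (M v) = v" by (auto simp: fun_eq_iff)
  define e where "e y = c y - L y (z x)" for y
  define e' where "e' h = c' h - L' (z x) h" for h
  have de: "(e has_derivative e') (at x)"
    unfolding e_def[abs_def] e'_def[abs_def] by (intro has_derivative_diff c' L')
  have e0: "e x = 0" using sol[OF assms(2)] by (simp add: e_def)
  \<comment> \<open>The solution of L x (z' h) = e' h, by a right inverse M of L x, which is an
    injective and hence surjective endomorphism.\<close>
  define z' where "z' h = M (e' h)" for h
  have linz: "bounded_linear z'"
    unfolding z'_def
    by (rule bounded_linear_compose[OF _ has_derivative_bounded_linear[OF de]])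
      (use M(1) linear_conv_bounded_linear in blast)
  obtain C where C: "\<And>h. norm (z' h) \<le> C * norm h"
    using bounded_linear.bounded[OF linz] by (auto simp: mult.commute)
  have "(z has_derivative z') (at x)"
    unfolding has_derivative_at_within
  proof (intro conjI linz)
    define q where "q y = (e y - e x - e' (y - x)) /\<^sub>R norm (y - x)" for y
    have q: "(q \<longlongrightarrow> 0) (at x)"
      using de unfolding has_derivative_at_within q_def by simp
    have bound: "norm ((z y - z x - z' (y - x)) /\<^sub>R norm (y - x)) \<le> (norm (q y) + \<delta> y * C) / B"
      if y: "y \<in> S" "\<And>v. B * norm v \<le> norm (L y v)" "y \<noteq> x" for y
    proof -
      have ly: "linear (L y)" using assms(3) that by blast
      \<comment> \<open>L y maps the remainder of z to the remainder of e minus the effect of L y -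
        L x on z'. The first is o(norm (y - x)), the second is at most \<delta> y times a multiple
        of norm (y - x).\<close>
      have "L y (z y - z x - z' (y - x)) = (e y - e' (y - x)) - (L y (z' (y - x)) - L x (z' (y - x)))"
        using sol[OF that(1)] M(2) by (simp add: linear_diff[OF ly] e_def z'_def)
      then have "B * norm (z y - z x - z' (y - x)) \<le> norm (e y - e' (y - x)) + norm (L y (z' (y - x)) - L x (z' (y - x)))"
        using y(2) norm_triangle_ineq4 by (metis order_trans)
      also have "norm (L y (z' (y - x)) - L x (z' (y - x))) \<le> \<delta> y * (C * norm (y - x))"
        using \<delta>(3)[OF y(1), of "z' (y - x)"] mult_left_mono[OF C \<delta>(2)] by (rule order_trans)
      finally have "B * norm (z y - z x - z' (y - x)) \<le> norm (e y - e' (y - x)) + \<delta> y * (C * norm (y - x))"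
        by simp
      then have "B * norm (z y - z x - z' (y - x)) / norm (y - x)
          \<le> (norm (e y - e' (y - x)) + \<delta> y * (C * norm (y - x))) / norm (y - x)"
        by (rule divide_right_mono) simp
      also have "\<dots> = norm (q y) + \<delta> y * C"
      proof -
        have "norm (e y - e' (y - x)) / norm (y - x) = norm (q y)"
          by (simp add: q_def e0 divide_inverse mult.commute)
        moreover have "\<delta> y * (C * norm (y - x)) / norm (y - x) = \<delta> y * C"
          using y(3) by simp
        ultimately show ?thesis by (simp add: add_divide_distrib)
      qed
      finally have "B * norm ((z y - z x - z' (y - x)) /\<^sub>R norm (y - x)) \<le> norm (q y) + \<delta> y * C"
        by (simp add: divide_inverse mult_ac)
      then show ?thesis
        using B(1) by (simp add: pos_le_divide_eq mult_ac)
    qed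
    have "((\<lambda>y. (norm (q y) + \<delta> y * C) / B) \<longlongrightarrow> (norm (0::'b) + 0 * C) / B) (at x)"
      using B(1) by (intro tendsto_intros q \<delta>(1)) simp
    then have lim: "((\<lambda>y. (norm (q y) + \<delta> y * C) / B) \<longlongrightarrow> 0) (at x)" by simp
    show "((\<lambda>y. (z y - z x - z' (y - x)) /\<^sub>R norm (y - x)) \<longlongrightarrow> 0) (at x)"
    proof (rule Lim_null_comparison[OF _ lim])
      show "eventually (\<lambda>y. norm ((z y - z x - z' (y - x)) /\<^sub>R norm (y - x)) \<le> (norm (q y) + \<delta> y * C) / B) (at x)"
        using B(2) eventually_neq_at_within[of x] by eventually_elim (rule bound, auto)
    qed
  qed
  moreover have "L x (z' h) = c' h - L' (z x) h" for h
    by (simp add: z'_def M(2) e'_def)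
  ultimately show ?thesis by blast
qed

lemma linear_dd_family:
  fixes L :: "'a::real_normed_vector \<Rightarrow> 'b::real_vector \<Rightarrow> 'c::real_normed_vector"
  assumes "open S" "x \<in> S" "\<And>y. y \<in> S \<Longrightarrow> linear (L y)" "\<And>v. (\<lambda>y. L y v) differentiable (at x)"
  shows "linear (\<lambda>w. dd (\<lambda>y. L y w) x h)"
proof (rule linearI)
  note L = frechet_derivative_works[THEN iffD1, OF assms(4)]
  fix v w :: 'b and r :: real
  have "((\<lambda>y. L y v + L y w) has_derivative (\<lambda>h. dd (\<lambda>y. L y v) x h + dd (\<lambda>y. L y w) x h)) (at x)"
    by (intro has_derivative_add L)
  then have "((\<lambda>y. L y (v + w)) has_derivative (\<lambda>h. dd (\<lambda>y. L y v) x h + dd (\<lambda>y. L y w) x h)) (at x)"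
    by (rule has_derivative_transform_within_open[OF _ assms(1,2)]) (simp add: assms(3) linear_add)
  from dd_eq[OF this] show "dd (\<lambda>y. L y (v + w)) x h = dd (\<lambda>y. L y v) x h + dd (\<lambda>y. L y w) x h" .
  have "((\<lambda>y. r *\<^sub>R L y v) has_derivative (\<lambda>h. r *\<^sub>R dd (\<lambda>y. L y v) x h)) (at x)"
    by (intro has_derivative_scaleR_right L)
  then have "((\<lambda>y. L y (r *\<^sub>R v)) has_derivative (\<lambda>h. r *\<^sub>R dd (\<lambda>y. L y v) x h)) (at x)"
    by (rule has_derivative_transform_within_open[OF _ assms(1,2)]) (simp add: assms(3) linear_cmul)
  from dd_eq[OF this] show "dd (\<lambda>y. L y (r *\<^sub>R v)) x h = r *\<^sub>R dd (\<lambda>y. L y v) x h" .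
qed

lemma smooth_on_differentiable: "smooth_on f S \<Longrightarrow> x \<in> S \<Longrightarrow> f differentiable (at x)"
  using smooth_on_has_derivative differentiableI by blast

text \<open>Bootstrapping: a directional derivative of z solves a system with the same L, whose
  right side, the derivative of c minus the derivative of L applied to z, is of class k once z is.
  The induction hypothesis, general in c and z, applies to that system.\<close>

lemma Ck_on_linear_solution:
  fixes L :: "'a::euclidean_space \<Rightarrow> 'b::euclidean_space \<Rightarrow> 'b"
  assumes "open S" "\<And>y. y \<in> S \<Longrightarrow> linear (L y)" "\<And>y. y \<in> S \<Longrightarrow> inj (L y)"
    and L: "\<And>v. smooth_on (\<lambda>y. L y v) S"
  shows "Ck_on k c S \<Longrightarrow> (\<And>y. y \<in> S \<Longrightarrow> L y (z y) = c y) \<Longrightarrow> Ck_on k z S"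
proof (induction k arbitrary: c z)
  case 0
  have "isCont z x" if "x \<in> S" for x
    by (rule isCont_linear_solution[where L = L and c = c, OF assms(1) that assms(2) assms(3)[OF that]])
      (use 0(2) 0(1) smooth_on_imp_continuous_on[OF L] assms(1) that in \<open>auto simp: continuous_on_eq_continuous_at\<close>)
  then show ?case by (simp add: continuous_at_imp_continuous_on)
next
  case (Suc k)
  have z: "Ck_on k z S" using Suc.IH[OF Ck_on_Suc_imp[OF Suc.prems(1)] Suc.prems(2)] .
  have step: "(z has_derivative frechet_derivative z (at x)) (at x) \<and>
      (\<forall>h. L x (dd z x h) = dd c x h + (- 1) *\<^sub>R dd (\<lambda>y. L y (z x)) x h)"
    if x: "x \<in> S" for x
  proof -
    obtain z' where z': "(z has_derivative z') (at x)" "\<And>h. L x (z' h) = dd c x h - dd (\<lambda>y. L y (z x)) x h"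
      using has_derivative_linear_solution[OF assms(1) x assms(2) assms(3)[OF x]
          smooth_on_has_derivative[OF L x] Ck_on_Suc_has_derivative[OF Suc.prems(1) x] Suc.prems(2)] by auto
    then have "z' = frechet_derivative z (at x)" by (simp add: frechet_derivative_at)
    with z' show ?thesis by simp
  qed
  have "Ck_on k (\<lambda>x. dd (\<lambda>y. L y (z x)) x h) S" for h
    by (rule Ck_on_linear_family[OF assms(1) linear_dd_family[OF assms(1) _ assms(2)] _ z])
      (use smooth_on_dd[OF L] smooth_on_differentiable[OF L] in \<open>auto simp: smooth_on_def\<close>)
  then have "Ck_on k (\<lambda>x. dd c x h + (- 1) *\<^sub>R dd (\<lambda>y. L y (z x)) x h) S" for h
    by (intro Ck_on_add assms(1) Ck_on_linear[OF _ bounded_linear_scaleR_right]) (use Suc.prems in auto)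
  then have "Ck_on k (\<lambda>x. dd z x h) S" for h
    by (rule Suc.IH) (use step in blast)
  then show ?case
    by (intro Ck_on_SucI[OF assms(1)]) (use step in blast)+
qed

lemma smooth_on_linear_solution:
  fixes L :: "'a::euclidean_space \<Rightarrow> 'b::euclidean_space \<Rightarrow> 'b"
  assumes "open S" "\<And>y. y \<in> S \<Longrightarrow> linear (L y)" "\<And>y. y \<in> S \<Longrightarrow> inj (L y)"
    and "\<And>v. smooth_on (\<lambda>y. L y v) S" "smooth_on c S" "\<And>y. y \<in> S \<Longrightarrow> L y (z y) = c y"
  shows "smooth_on z S"
  using Ck_on_linear_solution[OF assms(1-4) _ assms(6)] assms(5) unfolding smooth_on_def by blast

section \<open>Riemannian geometry in a chart\<close>

lemma has_derivative_cov_deriv: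
  "(Y has_derivative Y') (at x) \<Longrightarrow> cov_deriv G Y x u = Y' u + levi_civita G x u (Y x)"
  by (simp add: cov_deriv_def dd_eq)

locale metric_chart =
  fixes S :: "'e::euclidean_space set" and G :: "'e \<Rightarrow> 'e \<Rightarrow> 'e \<Rightarrow> real"
  assumes open_S: "open S"
    and G_bilinear: "x \<in> S \<Longrightarrow> bilinear (G x)"
    and G_sym: "x \<in> S \<Longrightarrow> G x u v = G x v u"
    and G_pos: "x \<in> S \<Longrightarrow> u \<noteq> 0 \<Longrightarrow> G x u u > 0"
    and G_smooth: "smooth_on (\<lambda>x. G x u v) S"
begin

lemmas G_lin =
  bilinear_ladd[OF G_bilinear] bilinear_radd[OF G_bilinear] bilinear_lmul[OF G_bilinear]
  bilinear_rmul[OF G_bilinear] bilinear_lneg[OF G_bilinear] bilinear_rneg[OF G_bilinear]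
  bilinear_lsub[OF G_bilinear] bilinear_rsub[OF G_bilinear] bilinear_lzero[OF G_bilinear]
  bilinear_rzero[OF G_bilinear]

lemma G_eq_0_iff: "x \<in> S \<Longrightarrow> G x u u = 0 \<longleftrightarrow> u = 0"
  using G_pos[of x u] by (cases "u = 0") (auto simp: G_lin)

lemma G_nonneg: "x \<in> S \<Longrightarrow> G x u u \<ge> 0"
  using G_pos[of x u] by (cases "u = 0") (auto simp: G_lin)

lemma G_nondegenerate:
  assumes "x \<in> S" "\<And>w. G x u w = G x v w" shows "u = v"
  using G_eq_0_iff[OF assms(1), of "u - v"] assms(2) by (simp add: G_lin assms(1))

text \<open>Lowering an index relative to the Euclidean inner product of the model space. It turns
  the requirement that G y z be a given functional into a linear system for z, so that the results
  on solutions of linear systems apply.\<close>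

definition flat :: "'e \<Rightarrow> 'e \<Rightarrow> 'e" where
  "flat y z = (\<Sum>b\<in>Basis. G y z b *\<^sub>R b)"

lemma flat_inner:
  assumes "y \<in> S" shows "flat y z \<bullet> w = G y z w"
proof -
  have "linear (G y z)" using G_bilinear[OF assms] by (simp add: bilinear_def)
  from linear_basis_expansion[OF this, of w] show ?thesis
    by (simp add: flat_def inner_sum_left inner_commute[of w] mult.commute)
qed

lemma flat_linear: "y \<in> S \<Longrightarrow> linear (flat y)"
  by (rule linearI; rule euclidean_eqI) (simp_all add: flat_inner inner_add_left G_lin)

lemma flat_inj: "y \<in> S \<Longrightarrow> inj (flat y)"
  by (rule injI) (metis G_nondegenerate flat_inner)

lemma flat_surj: "y \<in> S \<Longrightarrow> surj (flat y)"
  using linear_injective_imp_surjective flat_linear flat_inj by blast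

lemma flat_smooth: "smooth_on (\<lambda>y. flat y z) S"
  unfolding flat_def
  by (intro smooth_on_sum open_S smooth_on_linear[OF _ bounded_linear_scaleR_left] G_smooth)

lemma riesz:
  assumes "x \<in> S" "linear c" obtains z where "\<And>w. G x z w = c w"
proof -
  obtain z where "flat x z = (\<Sum>b\<in>Basis. c b *\<^sub>R b)"
    using flat_surj[OF assms(1)] by (metis surjD)
  then have "G x z w = c w" for w
    using linear_basis_expansion[OF assms(2), of w] flat_inner[OF assms(1), of z w]
    by (simp add: inner_sum_right inner_commute[of _ w] mult.commute)
  then show ?thesis using that by blast
qed

section \<open>Existence, uniqueness and smoothness of the Levi-Civita connection\<close>

abbreviation dG :: "'e \<Rightarrow> 'e \<Rightarrow> 'e \<Rightarrow> 'e \<Rightarrow> real" where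
  "dG x u v w \<equiv> dd (\<lambda>y. G y v w) x u"

lemma dG_has_derivative: "x \<in> S \<Longrightarrow> ((\<lambda>y. G y v w) has_derivative (\<lambda>u. dG x u v w)) (at x)"
  by (rule smooth_on_has_derivative[OF G_smooth])

lemma dG_linear:
  assumes "x \<in> S"
  shows "linear (\<lambda>u. dG x u v w)" "linear (\<lambda>v. dG x u v w)" "linear (\<lambda>w. dG x u v w)"
proof -
  show "linear (\<lambda>u. dG x u v w)" using has_derivative_linear[OF dG_has_derivative[OF assms]] .
  show "linear (\<lambda>v. dG x u v w)"
    by (rule linear_dd_family[OF open_S assms, of "\<lambda>y v. G y v w"])
      (use G_bilinear smooth_on_differentiable[OF G_smooth assms] in \<open>auto simp: bilinear_def\<close>)
  show "linear (\<lambda>w. dG x u v w)"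
    by (rule linear_dd_family[OF open_S assms, of "\<lambda>y. G y v"])
      (use G_bilinear smooth_on_differentiable[OF G_smooth assms] in \<open>auto simp: bilinear_def\<close>)
qed

lemma dG_sym:
  assumes "x \<in> S" shows "dG x u v w = dG x u w v"
  using dd_eq[OF has_derivative_transform_within_open[OF dG_has_derivative[OF assms] open_S assms G_sym]]
  by simp

text \<open>The Koszul formula for fields with constant components, whose brackets vanish.\<close>

definition koszul :: "'e \<Rightarrow> 'e \<Rightarrow> 'e \<Rightarrow> 'e \<Rightarrow> real" where
  "koszul x u v w = (dG x u v w + dG x v u w - dG x w u v) / 2"

lemma koszul_linear:
  assumes "x \<in> S"
  shows "linear (\<lambda>u. koszul x u v w)" "linear (\<lambda>v. koszul x u v w)" "linear (koszul x u v)"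
  using dG_linear[OF assms]
  by (auto simp: linear_iff koszul_def field_simps)

definition connection :: "'e \<Rightarrow> ('e \<Rightarrow> 'e \<Rightarrow> 'e) \<Rightarrow> bool" where
  "connection x B \<longleftrightarrow> bilinear B \<and> (\<forall>u v. B u v = B v u) \<and>
     (\<forall>u v w. dG x u v w = G x (B u v) w + G x v (B u w))"

text \<open>Three instances of metric compatibility, combined by the symmetry of B, leave a single
  connection term. This is the uniqueness half.\<close>

lemma connection_koszul:
  assumes "x \<in> S" "connection x B" shows "G x (B u v) w = koszul x u v w"
proof -
  have c: "dG x u v w = G x (B u v) w + G x v (B u w)" for u v w
    using assms(2) by (auto simp: connection_def)
  have s: "B v u = B u v" "B w u = B u w" "B w v = B v w"
    using assms(2) by (auto simp: connection_def)
  have "G x (B u w) v = G x v (B u w)" by (rule G_sym[OF assms(1)])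
  then show ?thesis
    unfolding koszul_def c s by simp
qed

lemma levi_civitaI:
  assumes "x \<in> S" "connection x B" shows "levi_civita G x = B"
  unfolding levi_civita_def
proof (rule the_equality)
  show "bilinear B \<and> (\<forall>u v. B u v = B v u) \<and> (\<forall>u v w. dG x u v w = G x (B u v) w + G x v (B u w))"
    using assms(2) by (simp add: connection_def)
next
  fix B' assume "bilinear B' \<and> (\<forall>u v. B' u v = B' v u) \<and> (\<forall>u v w. dG x u v w = G x (B' u v) w + G x v (B' u w))"
  then have "connection x B'" by (simp add: connection_def)
  with connection_koszul[OF assms(1)] assms(2) have "G x (B' u v) w = G x (B u v) w" for u v w
    by simp
  then show "B' = B" using G_nondegenerate[OF assms(1)] by blast
qed

text \<open>The Koszul expression is a linear functional of its last argument and has a Riesz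
  representative. Without existence the definite description \<open>levi_civita\<close> would carry
  no information.\<close>

lemma connection_exists:
  assumes "x \<in> S" shows "\<exists>B. connection x B"
proof -
  have "\<forall>u v. \<exists>z. \<forall>w. G x z w = koszul x u v w"
    using riesz[OF assms koszul_linear(3)[OF assms]] by metis
  then obtain B where B: "\<And>u v w. G x (B u v) w = koszul x u v w" by metis
  have "bilinear B"
    unfolding bilinear_def
    by (intro conjI allI linearI; rule G_nondegenerate[OF assms])
      (simp_all add: G_lin B assms linear_add[OF koszul_linear(1)] linear_add[OF koszul_linear(2)]
        linear_cmul[OF koszul_linear(1)] linear_cmul[OF koszul_linear(2)])
  moreover have "B u v = B v u" for u v
    by (rule G_nondegenerate[OF assms]) (metis (no_types, lifting) B add.commute dG_sym[OF assms] koszul_def)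
  moreover have "dG x u v w = G x (B u v) w + G x v (B u w)" for u v w
    using B[of u v w] B[of u w v] G_sym[OF assms, of v "B u w"] dG_sym[OF assms, where u = u and v = v and w = w]
    by (simp add: koszul_def field_simps)
  ultimately show ?thesis by (auto simp: connection_def)
qed

abbreviation \<Gamma> :: "'e \<Rightarrow> 'e \<Rightarrow> 'e \<Rightarrow> 'e" where "\<Gamma> \<equiv> levi_civita G"

lemma connection_\<Gamma>: "x \<in> S \<Longrightarrow> connection x (\<Gamma> x)"
  using connection_exists levi_civitaI by metis

lemma \<Gamma>_bilinear: "x \<in> S \<Longrightarrow> bilinear (\<Gamma> x)"
  using connection_\<Gamma> by (simp add: connection_def)

lemma \<Gamma>_sym: "x \<in> S \<Longrightarrow> \<Gamma> x u v = \<Gamma> x v u"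
  using connection_\<Gamma> unfolding connection_def by blast

lemma \<Gamma>_metric: "x \<in> S \<Longrightarrow> dG x u v w = G x (\<Gamma> x u v) w + G x v (\<Gamma> x u w)"
  using connection_\<Gamma> unfolding connection_def by blast

lemmas \<Gamma>_lin =
  bilinear_ladd[OF \<Gamma>_bilinear] bilinear_radd[OF \<Gamma>_bilinear] bilinear_lmul[OF \<Gamma>_bilinear]
  bilinear_rmul[OF \<Gamma>_bilinear] bilinear_lneg[OF \<Gamma>_bilinear] bilinear_rneg[OF \<Gamma>_bilinear]
  bilinear_lsub[OF \<Gamma>_bilinear] bilinear_rsub[OF \<Gamma>_bilinear] bilinear_lzero[OF \<Gamma>_bilinear]
  bilinear_rzero[OF \<Gamma>_bilinear]

text \<open>\<Gamma> solves a linear system with operator \<open>flat y\<close> and a right side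
  made of Koszul expressions, both smooth in y.\<close>

lemma \<Gamma>_smooth: "smooth_on (\<lambda>y. \<Gamma> y u v) S"
proof -
  have "smooth_on (\<lambda>y. koszul y u v b) S" for b
    unfolding koszul_def divide_inverse
    by (intro smooth_on_mult smooth_on_const smooth_on_diff smooth_on_add open_S smooth_on_dd G_smooth)
  then have "smooth_on (\<lambda>y. \<Sum>b\<in>Basis. koszul y u v b *\<^sub>R b) S"
    by (intro smooth_on_sum open_S smooth_on_linear[OF _ bounded_linear_scaleR_left])
  note c = this
  have "flat y (\<Gamma> y u v) = (\<Sum>b\<in>Basis. koszul y u v b *\<^sub>R b)" if "y \<in> S" for y
    by (simp add: flat_def connection_koszul[OF that connection_\<Gamma>[OF that]])
  with smooth_on_linear_solution[where L = flat and z = "\<lambda>y. \<Gamma> y u v",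
      OF open_S flat_linear flat_inj flat_smooth c]
  show ?thesis by blast
qed

lemma has_derivative_G:
  assumes "x \<in> S" "(Y has_derivative Y') (at x)" "(Z has_derivative Z') (at x)"
  shows "((\<lambda>y. G y (Y y) (Z y)) has_derivative
    (\<lambda>u. G x (cov_deriv G Y x u) (Z x) + G x (Y x) (cov_deriv G Z x u))) (at x)"
proof -
  have "((\<lambda>y. G y (Y y) (Z y)) has_derivative
    (\<lambda>u. dG x u (Y x) (Z x) + G x (Y' u) (Z x) + G x (Y x) (Z' u))) (at x)"
    by (rule has_derivative_bilinear_family[OF open_S assms(1) G_bilinear dG_has_derivative[OF assms(1)] assms(2,3)])
  then show ?thesis
    by (simp add: \<Gamma>_metric[OF assms(1)] has_derivative_cov_deriv[OF assms(2)] has_derivative_cov_deriv[OF assms(3)]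
        G_lin assms(1) algebra_simps)
qed

text \<open>An affine field agreeing to first order at x with parallel transport of X. Its covariant
  derivative is controlled at x only, which is enough to read off the covariant derivative of a
  tensor at x.\<close>

definition parallel_ext :: "'e \<Rightarrow> 'e \<Rightarrow> 'e \<Rightarrow> 'e" where
  "parallel_ext x X y = X - \<Gamma> x (y - x) X"

lemma parallel_ext:
  assumes "x \<in> S"
  shows "parallel_ext x X x = X" "cov_deriv G (parallel_ext x X) x u = 0"
    and "(parallel_ext x X has_derivative (\<lambda>u. - \<Gamma> x u X)) (at x)"
proof -
  show at: "parallel_ext x X x = X" by (simp add: parallel_ext_def \<Gamma>_lin assms)
  have bl: "bounded_linear (\<lambda>u. \<Gamma> x u X)"
    using \<Gamma>_bilinear[OF assms] by (simp add: bilinear_def linear_conv_bounded_linear)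
  have "((\<lambda>y. X - \<Gamma> x (y - x) X) has_derivative (\<lambda>u. 0 - \<Gamma> x (u - 0) X)) (at x)"
    by (intro has_derivative_diff has_derivative_const bounded_linear.has_derivative[OF bl] has_derivative_ident)
  then show d: "(parallel_ext x X has_derivative (\<lambda>u. - \<Gamma> x u X)) (at x)"
    by (simp add: parallel_ext_def[abs_def])
  show "cov_deriv G (parallel_ext x X) x u = 0"
    by (simp add: has_derivative_cov_deriv[OF d] at)
qed

subsection \<open>Curvature\<close>

abbreviation d\<Gamma> :: "'e \<Rightarrow> 'e \<Rightarrow> 'e \<Rightarrow> 'e \<Rightarrow> 'e" where
  "d\<Gamma> x u v w \<equiv> dd (\<lambda>y. \<Gamma> y v w) x u"

abbreviation R :: "'e \<Rightarrow> 'e \<Rightarrow> 'e \<Rightarrow> 'e \<Rightarrow> 'e" where "R \<equiv> curvature G"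

lemma d\<Gamma>_has_derivative: "x \<in> S \<Longrightarrow> ((\<lambda>y. \<Gamma> y v w) has_derivative (\<lambda>u. d\<Gamma> x u v w)) (at x)"
  by (rule smooth_on_has_derivative[OF \<Gamma>_smooth])

lemma d\<Gamma>_linear:
  assumes "x \<in> S"
  shows "linear (\<lambda>u. d\<Gamma> x u v w)" "linear (\<lambda>v. d\<Gamma> x u v w)" "linear (\<lambda>w. d\<Gamma> x u v w)"
proof -
  show "linear (\<lambda>u. d\<Gamma> x u v w)" using has_derivative_linear[OF d\<Gamma>_has_derivative[OF assms]] .
  show "linear (\<lambda>v. d\<Gamma> x u v w)"
    by (rule linear_dd_family[OF open_S assms, of "\<lambda>y v. \<Gamma> y v w"])
      (use \<Gamma>_bilinear smooth_on_differentiable[OF \<Gamma>_smooth assms] in \<open>auto simp: bilinear_def\<close>)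
  show "linear (\<lambda>w. d\<Gamma> x u v w)"
    by (rule linear_dd_family[OF open_S assms, of "\<lambda>y. \<Gamma> y v"])
      (use \<Gamma>_bilinear smooth_on_differentiable[OF \<Gamma>_smooth assms] in \<open>auto simp: bilinear_def\<close>)
qed

lemmas d\<Gamma>_lin =
  linear_add[OF d\<Gamma>_linear(1)] linear_add[OF d\<Gamma>_linear(2)] linear_add[OF d\<Gamma>_linear(3)]
  linear_diff[OF d\<Gamma>_linear(1)] linear_diff[OF d\<Gamma>_linear(2)] linear_diff[OF d\<Gamma>_linear(3)]
  linear_cmul[OF d\<Gamma>_linear(1)] linear_cmul[OF d\<Gamma>_linear(2)] linear_cmul[OF d\<Gamma>_linear(3)]
  linear_neg[OF d\<Gamma>_linear(1)] linear_neg[OF d\<Gamma>_linear(2)] linear_neg[OF d\<Gamma>_linear(3)]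

lemma d\<Gamma>_sym:
  assumes "x \<in> S" shows "d\<Gamma> x u v w = d\<Gamma> x u w v"
  using dd_eq[OF has_derivative_transform_within_open[OF d\<Gamma>_has_derivative[OF assms] open_S assms \<Gamma>_sym]]
  by simp

lemma R_eq: "R x u v w = d\<Gamma> x u v w + \<Gamma> x u (\<Gamma> x v w) - (d\<Gamma> x v u w + \<Gamma> x v (\<Gamma> x u w))"
  by (simp add: curvature_def cov_deriv_def)

lemma R_linear:
  assumes "x \<in> S"
  shows "linear (\<lambda>u. R x u v w)" "linear (\<lambda>v. R x u v w)" "linear (\<lambda>w. R x u v w)"
  by (rule linearI; simp add: R_eq d\<Gamma>_lin \<Gamma>_lin assms algebra_simps)+

lemmas R_lin =
  linear_add[OF R_linear(1)] linear_add[OF R_linear(2)] linear_add[OF R_linear(3)]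
  linear_diff[OF R_linear(1)] linear_diff[OF R_linear(2)] linear_diff[OF R_linear(3)]
  linear_cmul[OF R_linear(1)] linear_cmul[OF R_linear(2)] linear_cmul[OF R_linear(3)]
  linear_neg[OF R_linear(1)] linear_neg[OF R_linear(2)] linear_neg[OF R_linear(3)]
  linear_0[OF R_linear(1)] linear_0[OF R_linear(2)] linear_0[OF R_linear(3)]

lemma R_smooth: "smooth_on (\<lambda>y. R y u v w) S"
proof -
  have "smooth_on (\<lambda>y. \<Gamma> y a (\<Gamma> y b c)) S" for a b c
    by (rule smooth_on_linear_family[OF open_S _ \<Gamma>_smooth \<Gamma>_smooth])
      (use \<Gamma>_bilinear in \<open>auto simp: bilinear_def\<close>)
  then show ?thesis
    unfolding R_eq by (intro smooth_on_diff smooth_on_add open_S smooth_on_dd \<Gamma>_smooth)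
qed

lemma R_antisym: "R x u v w = - R x v u w"
  by (simp add: R_eq)

lemma first_bianchi: "x \<in> S \<Longrightarrow> R x u v w + R x v w u + R x w u v = 0"
proof -
  assume x: "x \<in> S"
  have "d\<Gamma> x u w v = d\<Gamma> x u v w" "d\<Gamma> x v w u = d\<Gamma> x v u w" "d\<Gamma> x w v u = d\<Gamma> x w u v"
    by (rule d\<Gamma>_sym[OF x])+
  moreover have "\<Gamma> x w v = \<Gamma> x v w" "\<Gamma> x w u = \<Gamma> x u w" "\<Gamma> x v u = \<Gamma> x u v"
    by (rule \<Gamma>_sym[OF x])+
  ultimately show ?thesis by (simp add: R_eq)
qed

text \<open>By metric compatibility the claim says that the second derivatives of
  \<open>y \<mapsto> G y w z\<close> in the directions \<open>u\<close> and \<open>v\<close> commute.\<close>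

lemma R_skew:
  assumes x: "x \<in> S" shows "G x (R x u v w) z = - G x (R x u v z) w"
proof -
  have dd2: "dd (\<lambda>y. dG y v w z) x u = G x (d\<Gamma> x u v w + \<Gamma> x u (\<Gamma> x v w)) z + G x (\<Gamma> x v w) (\<Gamma> x u z)
      + G x (\<Gamma> x u w) (\<Gamma> x v z) + G x w (d\<Gamma> x u v z + \<Gamma> x u (\<Gamma> x v z))" for u v
  proof -
    have cov: "cov_deriv G (\<lambda>y. \<Gamma> y v a) x u = d\<Gamma> x u v a + \<Gamma> x u (\<Gamma> x v a)"
        "cov_deriv G (\<lambda>y. a) x u = \<Gamma> x u a" for a
      by (simp_all add: cov_deriv_def)
    have "((\<lambda>y. G y (\<Gamma> y v w) z + G y w (\<Gamma> y v z)) has_derivative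
        (\<lambda>u. G x (cov_deriv G (\<lambda>y. \<Gamma> y v w) x u) z + G x (\<Gamma> x v w) (cov_deriv G (\<lambda>y. z) x u) +
        (G x (cov_deriv G (\<lambda>y. w) x u) (\<Gamma> x v z) + G x w (cov_deriv G (\<lambda>y. \<Gamma> y v z) x u)))) (at x)"
      by (intro has_derivative_add has_derivative_G[OF x d\<Gamma>_has_derivative[OF x] has_derivative_const]
          has_derivative_G[OF x has_derivative_const d\<Gamma>_has_derivative[OF x]])
    then have "((\<lambda>y. dG y v w z) has_derivative
        (\<lambda>u. G x (cov_deriv G (\<lambda>y. \<Gamma> y v w) x u) z + G x (\<Gamma> x v w) (cov_deriv G (\<lambda>y. z) x u) +
        (G x (cov_deriv G (\<lambda>y. w) x u) (\<Gamma> x v z) + G x w (cov_deriv G (\<lambda>y. \<Gamma> y v z) x u)))) (at x)"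
      by (rule has_derivative_transform_within_open[OF _ open_S x]) (simp add: \<Gamma>_metric)
    from dd_eq[OF this] show ?thesis by (simp add: cov)
  qed
  have "dd (\<lambda>y. dG y v w z) x u = dd (\<lambda>y. dG y u w z) x v"
    by (rule dd_commute[OF open_S G_smooth x])
  then show ?thesis
    unfolding dd2 R_eq by (simp add: G_lin x G_sym[OF x, of w])
qed

text \<open>The octahedron argument: four first Bianchi identities, together with skewness in the
  first and in the last pair, leave the claim by linear arithmetic.\<close>

lemma R_pair_sym:
  assumes x: "x \<in> S" shows "G x (R x u v w) z = G x (R x w z u) v"
proof -
  have b: "G x (R x u v w) z + G x (R x v w u) z + G x (R x w u v) z = 0" for u v w z
    using first_bianchi[OF x, of u v w] by (metis G_lin(1) G_lin(9) x)
  have a: "G x (R x u v w) z = - G x (R x v u w) z" for u v w z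
    by (subst R_antisym) (simp add: G_lin x)
  show ?thesis
    using b[of u v w z] b[of v w z u] b[of w z u v] b[of z u v w]
      R_skew[OF x] a by (smt (verit))
qed

text \<open>The covariant derivative of the curvature tensor on constant components; z is the
  direction of differentiation.\<close>

definition nabla_R :: "'e \<Rightarrow> 'e \<Rightarrow> 'e \<Rightarrow> 'e \<Rightarrow> 'e \<Rightarrow> 'e" where
  "nabla_R x z u v w = dd (\<lambda>y. R y u v w) x z + \<Gamma> x z (R x u v w)
     - R x (\<Gamma> x z u) v w - R x u (\<Gamma> x z v) w - R x u v (\<Gamma> x z w)"

lemma dR:
  assumes x: "x \<in> S"
  shows "dd (\<lambda>y. R y u v w) x z = dd (\<lambda>y. d\<Gamma> y u v w) x z + d\<Gamma> x z u (\<Gamma> x v w) + \<Gamma> x u (d\<Gamma> x z v w)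
    - (dd (\<lambda>y. d\<Gamma> y v u w) x z + d\<Gamma> x z v (\<Gamma> x u w) + \<Gamma> x v (d\<Gamma> x z u w))"
proof -
  have 1: "((\<lambda>y. \<Gamma> y a (\<Gamma> y b c)) has_derivative (\<lambda>z. d\<Gamma> x z a (\<Gamma> x b c) + \<Gamma> x a (d\<Gamma> x z b c))) (at x)" for a b c
    by (rule has_derivative_linear_family[OF open_S x _ d\<Gamma>_has_derivative[OF x] d\<Gamma>_has_derivative[OF x]])
      (use \<Gamma>_bilinear in \<open>auto simp: bilinear_def\<close>)
  have 2: "((\<lambda>y. d\<Gamma> y a b c) has_derivative (\<lambda>z. dd (\<lambda>y. d\<Gamma> y a b c) x z)) (at x)" for a b c
    by (rule smooth_on_has_derivative[OF smooth_on_dd[OF \<Gamma>_smooth] x])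
  show ?thesis
    unfolding R_eq by (subst dd_eq[OF has_derivative_diff[OF has_derivative_add[OF 2 1] has_derivative_add[OF 2 1]]]) simp
qed

text \<open>The second derivatives of \<Gamma> cancel in pairs by \<open>dd_commute\<close>, the
  remaining terms by the symmetry of \<Gamma> in its two arguments.\<close>

lemma second_bianchi:
  assumes x: "x \<in> S" shows "nabla_R x z u v w + nabla_R x u v z w + nabla_R x v z u w = 0"
proof -
  have c: "dd (\<lambda>y. d\<Gamma> y a b w) x c = dd (\<lambda>y. d\<Gamma> y c b w) x a" for a b c
    by (rule dd_commute[OF open_S \<Gamma>_smooth x])
  show ?thesis
    unfolding nabla_R_def dR[OF x] c[where a = u and b = v and c = z] c[where a = v and b = z and c = u]
      c[where a = v and b = u and c = z]
    by (simp add: R_eq \<Gamma>_lin d\<Gamma>_lin x \<Gamma>_sym[OF x, of v u] \<Gamma>_sym[OF x, of u z] \<Gamma>_sym[OF x, of v z])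
qed

lemma has_derivative_R:
  assumes x: "x \<in> S" and a: "(a has_derivative a') (at x)" and b: "(b has_derivative b') (at x)"
    and c: "(c has_derivative c') (at x)" and d: "(d has_derivative d') (at x)"
  shows "((\<lambda>y. G y (R y (a y) (b y) (c y)) (d y)) has_derivative (\<lambda>z.
      G x (nabla_R x z (a x) (b x) (c x)) (d x)
      + G x (R x (cov_deriv G a x z) (b x) (c x)) (d x) + G x (R x (a x) (cov_deriv G b x z) (c x)) (d x)
      + G x (R x (a x) (b x) (cov_deriv G c x z)) (d x) + G x (R x (a x) (b x) (c x)) (cov_deriv G d x z))) (at x)"
proof -
  have dR: "((\<lambda>y. R y u v w) has_derivative (\<lambda>z. dd (\<lambda>y. R y u v w) x z)) (at x)" for u v w
    by (rule smooth_on_has_derivative[OF R_smooth x])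
  have 1: "((\<lambda>y. R y (a y) v w) has_derivative (\<lambda>z. dd (\<lambda>y. R y (a x) v w) x z + R x (a' z) v w)) (at x)" for v w
    by (rule has_derivative_linear_family[OF open_S x R_linear(1) dR a])
  have 2: "((\<lambda>y. R y (a y) (b y) w) has_derivative (\<lambda>z. (dd (\<lambda>y. R y (a x) (b x) w) x z + R x (a' z) (b x) w)
      + R x (a x) (b' z) w)) (at x)" for w
    by (rule has_derivative_linear_family[OF open_S x R_linear(2) 1 b])
  have 3: "((\<lambda>y. R y (a y) (b y) (c y)) has_derivative (\<lambda>z. ((dd (\<lambda>y. R y (a x) (b x) (c x)) x z + R x (a' z) (b x) (c x))
      + R x (a x) (b' z) (c x)) + R x (a x) (b x) (c' z))) (at x)"
    by (rule has_derivative_linear_family[OF open_S x R_linear(3) 2 c])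
  have "cov_deriv G (\<lambda>y. R y (a y) (b y) (c y)) x z = nabla_R x z (a x) (b x) (c x)
      + R x (cov_deriv G a x z) (b x) (c x) + R x (a x) (cov_deriv G b x z) (c x)
      + R x (a x) (b x) (cov_deriv G c x z)" for z
    unfolding has_derivative_cov_deriv[OF 3] has_derivative_cov_deriv[OF a] has_derivative_cov_deriv[OF b]
      has_derivative_cov_deriv[OF c]
    by (simp add: nabla_R_def R_lin x)
  with has_derivative_G[OF x 3 d] show ?thesis by (simp add: G_lin x)
qed

end

section \<open>Sasakian geometry in a chart\<close>

locale sasakian_chart = metric_chart S G for S :: "'e::euclidean_space set" and G +
  fixes \<phi> :: "'e \<Rightarrow> 'e \<Rightarrow> 'e" and \<xi> :: "'e \<Rightarrow> 'e" and \<eta> :: "'e \<Rightarrow> 'e \<Rightarrow> real" and \<alpha> :: real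
  assumes \<alpha>_pos: "\<alpha> > 0"
    and \<phi>_linear: "x \<in> S \<Longrightarrow> linear (\<phi> x)"
    and \<phi>_smooth: "smooth_on (\<lambda>x. \<phi> x v) S"
    and \<xi>_smooth: "smooth_on \<xi> S"
    and \<eta>_eq: "x \<in> S \<Longrightarrow> \<eta> x u = G x (\<xi> x) u"
    and \<xi>_unit: "x \<in> S \<Longrightarrow> G x (\<xi> x) (\<xi> x) = 1"
    and \<phi>_\<xi>: "x \<in> S \<Longrightarrow> \<phi> x (\<xi> x) = 0"
    and \<phi>_\<phi>: "x \<in> S \<Longrightarrow> \<phi> x (\<phi> x u) = - u + \<eta> x u *\<^sub>R \<xi> x"
    and G_\<phi>_\<phi>: "x \<in> S \<Longrightarrow> G x (\<phi> x u) (\<phi> x v) = G x u v - \<eta> x u * \<eta> x v"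
    and cov_\<xi>: "x \<in> S \<Longrightarrow> cov_deriv G \<xi> x u = \<alpha> *\<^sub>R \<phi> x u"
    and cov_\<phi>: "x \<in> S \<Longrightarrow> cov_deriv_endo G \<phi> x u v = \<alpha> *\<^sub>R (\<eta> x v *\<^sub>R u - G x u v *\<^sub>R \<xi> x)"
begin

lemmas \<phi>_lin = linear_add[OF \<phi>_linear] linear_diff[OF \<phi>_linear] linear_cmul[OF \<phi>_linear]
  linear_neg[OF \<phi>_linear] linear_0[OF \<phi>_linear]

lemma \<eta>_linear: "x \<in> S \<Longrightarrow> linear (\<eta> x)"
  by (rule linearI) (simp_all add: \<eta>_eq G_lin)

lemmas \<eta>_lin = linear_add[OF \<eta>_linear] linear_diff[OF \<eta>_linear] linear_cmul[OF \<eta>_linear]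
  linear_neg[OF \<eta>_linear] linear_0[OF \<eta>_linear]

lemma \<eta>_\<xi>: "x \<in> S \<Longrightarrow> \<eta> x (\<xi> x) = 1"
  by (simp add: \<eta>_eq \<xi>_unit)

lemma G_\<xi>: "x \<in> S \<Longrightarrow> G x (\<xi> x) u = \<eta> x u" "x \<in> S \<Longrightarrow> G x u (\<xi> x) = \<eta> x u"
  by (simp_all add: \<eta>_eq G_sym)

text \<open>Evaluating \<phi> \<phi> \<phi> u from the inside and from the outside gives results
  that differ by \<eta>(\<phi> u) \<xi>.\<close>

lemma \<eta>_\<phi>:
  assumes "x \<in> S" shows "\<eta> x (\<phi> x u) = 0"
proof -
  have "\<phi> x (\<phi> x (\<phi> x u)) = - \<phi> x u"
    by (simp add: \<phi>_\<phi>[OF assms, of u] \<phi>_lin \<phi>_\<xi> assms)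
  with \<phi>_\<phi>[OF assms, of "\<phi> x u"] have "\<eta> x (\<phi> x u) *\<^sub>R \<xi> x = 0" by simp
  moreover have "\<xi> x \<noteq> 0" using \<xi>_unit[OF assms] by (auto simp: G_lin assms)
  ultimately show ?thesis by simp
qed

text \<open>Compatibility of G with \<phi>, applied to u and \<phi> v; the \<eta>-terms vanish since
  \<eta> \<phi> = 0.\<close>

lemma G_\<phi>:
  assumes "x \<in> S" shows "G x (\<phi> x u) v = - G x u (\<phi> x v)"
proof -
  have "G x (\<phi> x u) (\<phi> x (\<phi> x v)) = G x u (\<phi> x v)"
    by (simp only: G_\<phi>_\<phi>[OF assms] \<eta>_\<phi>[OF assms])
  then show ?thesis
    by (simp add: \<phi>_\<phi>[OF assms, of v] G_lin G_\<xi> \<eta>_\<phi> assms)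
qed

lemma G_\<phi>_same: "x \<in> S \<Longrightarrow> G x (\<phi> x u) u = 0" "x \<in> S \<Longrightarrow> G x u (\<phi> x u) = 0"
  using G_\<phi>[of x u u] G_sym[of x u "\<phi> x u"] by auto

lemma \<xi>_has_derivative:
  assumes "x \<in> S" shows "(\<xi> has_derivative (\<lambda>u. \<alpha> *\<^sub>R \<phi> x u - \<Gamma> x u (\<xi> x))) (at x)"
  using smooth_on_has_derivative[OF \<xi>_smooth assms] cov_\<xi>[OF assms, symmetric]
  by (simp add: cov_deriv_def)

lemma has_derivative_\<phi>:
  assumes x: "x \<in> S" and Y: "(Y has_derivative Y') (at x)"
  shows "((\<lambda>y. \<phi> y (Y y)) has_derivative (\<lambda>u. \<alpha> *\<^sub>R (\<eta> x (Y x) *\<^sub>R u - G x u (Y x) *\<^sub>R \<xi> x)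
    + \<phi> x (cov_deriv G Y x u) - \<Gamma> x u (\<phi> x (Y x)))) (at x)"
    and "cov_deriv G (\<lambda>y. \<phi> y (Y y)) x u = \<alpha> *\<^sub>R (\<eta> x (Y x) *\<^sub>R u - G x u (Y x) *\<^sub>R \<xi> x)
    + \<phi> x (cov_deriv G Y x u)"
proof -
  have "dd (\<lambda>y. \<phi> y v) x u = \<alpha> *\<^sub>R (\<eta> x v *\<^sub>R u - G x u v *\<^sub>R \<xi> x) + \<phi> x (\<Gamma> x u v) - \<Gamma> x u (\<phi> x v)" for u v
    using cov_\<phi>[OF x, of u v] by (simp add: cov_deriv_endo_def cov_deriv_def algebra_simps)
  with smooth_on_has_derivative[OF \<phi>_smooth x]
  have "((\<lambda>y. \<phi> y v) has_derivative
      (\<lambda>u. \<alpha> *\<^sub>R (\<eta> x v *\<^sub>R u - G x u v *\<^sub>R \<xi> x) + \<phi> x (\<Gamma> x u v) - \<Gamma> x u (\<phi> x v))) (at x)" for v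
    by (metis (no_types, lifting) has_derivative_eq_rhs ext)
  from has_derivative_linear_family[OF open_S x \<phi>_linear this Y]
  show *: "((\<lambda>y. \<phi> y (Y y)) has_derivative (\<lambda>u. \<alpha> *\<^sub>R (\<eta> x (Y x) *\<^sub>R u - G x u (Y x) *\<^sub>R \<xi> x)
    + \<phi> x (cov_deriv G Y x u) - \<Gamma> x u (\<phi> x (Y x)))) (at x)"
    by (simp add: has_derivative_cov_deriv[OF Y] \<phi>_lin x algebra_simps)
  show "cov_deriv G (\<lambda>y. \<phi> y (Y y)) x u = \<alpha> *\<^sub>R (\<eta> x (Y x) *\<^sub>R u - G x u (Y x) *\<^sub>R \<xi> x)
    + \<phi> x (cov_deriv G Y x u)"
    by (simp add: has_derivative_cov_deriv[OF *])
qed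

lemma has_derivative_\<eta>:
  assumes x: "x \<in> S" and Y: "(Y has_derivative Y') (at x)"
  shows "((\<lambda>y. \<eta> y (Y y)) has_derivative (\<lambda>u. \<alpha> * G x (\<phi> x u) (Y x) + \<eta> x (cov_deriv G Y x u))) (at x)"
proof -
  have "((\<lambda>y. G y (\<xi> y) (Y y)) has_derivative
      (\<lambda>u. G x (\<alpha> *\<^sub>R \<phi> x u) (Y x) + G x (\<xi> x) (cov_deriv G Y x u))) (at x)"
    using has_derivative_G[OF x \<xi>_has_derivative[OF x] Y] by (simp add: cov_\<xi>[OF x])
  then have "((\<lambda>y. G y (\<xi> y) (Y y)) has_derivative
      (\<lambda>u. \<alpha> * G x (\<phi> x u) (Y x) + \<eta> x (cov_deriv G Y x u))) (at x)"
    by (simp add: G_\<xi> G_lin x)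
  then show ?thesis
    by (rule has_derivative_transform_within_open[OF _ open_S x]) (simp add: G_\<xi>)
qed

lemma dd_\<phi>:
  "x \<in> S \<Longrightarrow> dd (\<lambda>y. \<phi> y v) x u = \<alpha> *\<^sub>R (\<eta> x v *\<^sub>R u - G x u v *\<^sub>R \<xi> x) + \<phi> x (\<Gamma> x u v) - \<Gamma> x u (\<phi> x v)"
  using dd_eq[OF has_derivative_\<phi>(1)[OF _ has_derivative_const]] by (simp add: cov_deriv_def)

lemma dd_\<xi>: "x \<in> S \<Longrightarrow> dd \<xi> x u = \<alpha> *\<^sub>R \<phi> x u - \<Gamma> x u (\<xi> x)"
  using dd_eq[OF \<xi>_has_derivative] .

lemma has_derivative_\<Gamma>:
  assumes x: "x \<in> S" and Y: "(Y has_derivative Y') (at x)"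
  shows "((\<lambda>y. \<Gamma> y v (Y y)) has_derivative (\<lambda>u. d\<Gamma> x u v (Y x) + \<Gamma> x v (Y' u))) (at x)"
  by (rule has_derivative_linear_family[OF open_S x _ d\<Gamma>_has_derivative[OF x] Y])
    (use \<Gamma>_bilinear in \<open>auto simp: bilinear_def\<close>)

section \<open>Curvature identities of the Sasakian structure\<close>

text \<open>The Ricci identity for \<xi>. Its first derivative is \<alpha> \<phi> minus a
  \<Gamma>-term, so equality of its mixed second derivatives expresses R(u, v) \<xi> through the
  covariant derivative of \<phi>. Each of the two structure equations contributes one factor
  \<alpha>.\<close>

lemma R_\<xi>:
  assumes x: "x \<in> S" shows "R x u v (\<xi> x) = \<alpha>\<^sup>2 *\<^sub>R (\<eta> x v *\<^sub>R u - \<eta> x u *\<^sub>R v)"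
proof -
  have "dd (\<lambda>y. dd \<xi> y v) x u = \<alpha> *\<^sub>R dd (\<lambda>y. \<phi> y v) x u
      - (d\<Gamma> x u v (\<xi> x) + \<Gamma> x v (\<alpha> *\<^sub>R \<phi> x u - \<Gamma> x u (\<xi> x)))" for u v
  proof (rule dd_eq)
    have "((\<lambda>y. \<alpha> *\<^sub>R \<phi> y v - \<Gamma> y v (\<xi> y)) has_derivative (\<lambda>u. \<alpha> *\<^sub>R dd (\<lambda>y. \<phi> y v) x u
      - (d\<Gamma> x u v (\<xi> x) + \<Gamma> x v (\<alpha> *\<^sub>R \<phi> x u - \<Gamma> x u (\<xi> x))))) (at x)"
      by (intro has_derivative_diff has_derivative_scaleR_right has_derivative_\<Gamma> x \<xi>_has_derivative
          smooth_on_has_derivative[OF \<phi>_smooth])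
    then show "((\<lambda>y. dd \<xi> y v) has_derivative (\<lambda>u. \<alpha> *\<^sub>R dd (\<lambda>y. \<phi> y v) x u
      - (d\<Gamma> x u v (\<xi> x) + \<Gamma> x v (\<alpha> *\<^sub>R \<phi> x u - \<Gamma> x u (\<xi> x))))) (at x)"
      by (rule has_derivative_transform_within_open[OF _ open_S x]) (simp add: dd_\<xi>)
  qed
  with dd_commute[OF open_S \<xi>_smooth x, of u v]
  show ?thesis
    by (simp add: R_eq dd_\<phi> x \<Gamma>_lin \<Gamma>_sym[OF x, of v u] G_sym[OF x, of v u] algebra_simps power2_eq_square)
qed

text \<open>The Ricci identity for \<phi>: the commutator of R(u, v) with \<phi> is the
  antisymmetrized second covariant derivative of \<phi>, which the structure equations make
  explicit.\<close>

lemma R_\<phi>: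
  assumes x: "x \<in> S"
  shows "R x u v (\<phi> x w) = \<phi> x (R x u v w) + \<alpha>\<^sup>2 *\<^sub>R (G x (\<phi> x u) w *\<^sub>R v - G x v w *\<^sub>R \<phi> x u
    - (G x (\<phi> x v) w *\<^sub>R u - G x u w *\<^sub>R \<phi> x v))"
proof -
  \<comment> \<open>The second derivative of the components of \<phi> w, expanded by the product
    rule. Only its symmetry in u and v is used afterwards.\<close>
  define D where "D u v = \<alpha> *\<^sub>R ((\<alpha> * G x (\<phi> x u) w + \<eta> x (\<Gamma> x u w)) *\<^sub>R v
      - (G x v w *\<^sub>R (\<alpha> *\<^sub>R \<phi> x u - \<Gamma> x u (\<xi> x)) + (G x (\<Gamma> x u v) w + G x v (\<Gamma> x u w)) *\<^sub>R \<xi> x))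
      + (\<alpha> *\<^sub>R (\<eta> x (\<Gamma> x v w) *\<^sub>R u - G x u (\<Gamma> x v w) *\<^sub>R \<xi> x)
        + \<phi> x (d\<Gamma> x u v w + \<Gamma> x u (\<Gamma> x v w)) - \<Gamma> x u (\<phi> x (\<Gamma> x v w)))
      - (d\<Gamma> x u v (\<phi> x w) + \<Gamma> x v (dd (\<lambda>y. \<phi> y w) x u))" for u v
  have "dd (\<lambda>y. dd (\<lambda>y. \<phi> y w) y v) x u = D u v" for u v
  proof (rule dd_eq)
    have \<eta>: "((\<lambda>y. \<eta> y w) has_derivative (\<lambda>u. \<alpha> * G x (\<phi> x u) w + \<eta> x (\<Gamma> x u w))) (at x)"
      using has_derivative_\<eta>[OF x has_derivative_const, of w] by (simp add: cov_deriv_def)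
    have g: "((\<lambda>y. G y v w) has_derivative (\<lambda>u. G x (\<Gamma> x u v) w + G x v (\<Gamma> x u w))) (at x)"
      using dG_has_derivative[OF x, of v w] by (simp add: \<Gamma>_metric[OF x])
    have \<phi>: "((\<lambda>y. \<phi> y (\<Gamma> y v w)) has_derivative
        (\<lambda>u. \<alpha> *\<^sub>R (\<eta> x (\<Gamma> x v w) *\<^sub>R u - G x u (\<Gamma> x v w) *\<^sub>R \<xi> x)
        + \<phi> x (d\<Gamma> x u v w + \<Gamma> x u (\<Gamma> x v w)) - \<Gamma> x u (\<phi> x (\<Gamma> x v w)))) (at x)"
      using has_derivative_\<phi>(1)[OF x d\<Gamma>_has_derivative[OF x]] by (simp add: cov_deriv_def)
    have "((\<lambda>y. \<alpha> *\<^sub>R (\<eta> y w *\<^sub>R v - G y v w *\<^sub>R \<xi> y) + \<phi> y (\<Gamma> y v w) - \<Gamma> y v (\<phi> y w)) has_derivative (\<lambda>u. D u v)) (at x)"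
      unfolding D_def
      by (intro has_derivative_diff has_derivative_add has_derivative_scaleR_right has_derivative_scaleR_left
          has_derivative_scaleR[OF g \<xi>_has_derivative[OF x]] has_derivative_\<Gamma>[OF x] \<eta> \<phi>
          smooth_on_has_derivative[OF \<phi>_smooth x])
    then show "((\<lambda>y. dd (\<lambda>y. \<phi> y w) y v) has_derivative (\<lambda>u. D u v)) (at x)"
      by (rule has_derivative_transform_within_open[OF _ open_S x]) (simp add: dd_\<phi>)
  qed
  with dd_commute[OF open_S \<phi>_smooth x] have "D u v = D v u" by metis
  then show ?thesis
    by (simp add: D_def R_eq dd_\<phi> x \<Gamma>_lin \<phi>_lin \<Gamma>_sym[OF x, of v u] G_sym[OF x, of v u] algebra_simps power2_eq_square)
qed

text \<open>By skewness of \<phi> the last condition reads G(\<phi> X, Y) = 0, so each of the three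
  conditions says that Y is Euclidean-orthogonal to one vector of the form
  \<open>flat\<close>.\<close>

lemma horizontal_exists:
  assumes "x \<in> S" "DIM('e) \<ge> 4"
  obtains Y where "Y \<noteq> 0" "\<eta> x Y = 0" "G x X Y = 0" "G x X (\<phi> x Y) = 0"
proof -
  let ?T = "{flat x (\<xi> x), flat x X, flat x (\<phi> x X)}"
  have "dim ?T < DIM('e)"
    using dim_le_card'[of ?T] card_insert_le_m1[of 3 "{flat x X, flat x (\<phi> x X)}" "flat x (\<xi> x)"]
      card_insert_le_m1[of 2 "{flat x (\<phi> x X)}" "flat x X"] assms(2) by auto
  from orthogonal_to_subspace_exists[OF this] obtain Y where Y: "Y \<noteq> 0" "\<And>y. y \<in> span ?T \<Longrightarrow> orthogonal Y y"
    by blast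
  then have "orthogonal Y (flat x (\<xi> x))" "orthogonal Y (flat x X)" "orthogonal Y (flat x (\<phi> x X))"
    by (simp_all add: span_base)
  then have "G x (\<xi> x) Y = 0" "G x X Y = 0" "G x (\<phi> x X) Y = 0"
    by (simp_all add: orthogonal_def inner_commute[of Y] flat_inner assms(1))
  with Y(1) that show ?thesis by (simp add: G_\<xi> G_\<phi> assms(1))
qed

section \<open>Polarization of the \<phi>-holomorphic curvature\<close>

text \<open>Pair symmetry and the two skew symmetries together reverse the order of the four
  arguments.\<close>

lemma R_skew_sym:
  assumes x: "x \<in> S"
  shows "G x (R x u (\<phi> x v) (\<phi> x w)) z = G x (R x z (\<phi> x w) (\<phi> x v)) u"
proof -
  have "G x (R x u (\<phi> x v) (\<phi> x w)) z = G x (R x (\<phi> x w) z u) (\<phi> x v)"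
    by (rule R_pair_sym[OF x])
  also have "\<dots> = G x (- R x z (\<phi> x w) u) (\<phi> x v)"
    by (subst R_antisym) simp
  also have "\<dots> = G x (R x z (\<phi> x w) (\<phi> x v)) u"
    using R_skew[OF x, of z "\<phi> x w" u "\<phi> x v"] by (simp add: G_lin x)
  finally show ?thesis .
qed

text \<open>Pair symmetry and skewness reduce the claim to moving \<phi> past R(\<phi> Y, Y) by
  \<open>R_\<phi>\<close>. The correction terms there cancel, since \<phi> \<phi> Y = - Y for
  horizontal Y and \<phi> Y is orthogonal to Y.\<close>

lemma R_\<phi>_exchange:
  assumes x: "x \<in> S" and Y: "\<eta> x Y = 0"
  shows "G x (R x Y (\<phi> x X) (\<phi> x Y)) Y = G x (R x X (\<phi> x Y) (\<phi> x Y)) Y"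
proof -
  have "G x (R x Y (\<phi> x X) (\<phi> x Y)) Y = G x (R x (\<phi> x Y) Y Y) (\<phi> x X)"
    by (rule R_pair_sym[OF x])
  also have "\<dots> = - G x (\<phi> x (R x (\<phi> x Y) Y Y)) X"
    by (simp add: G_\<phi> x)
  also have "\<dots> = - G x (R x (\<phi> x Y) Y (\<phi> x Y)) X"
    by (simp add: R_\<phi> \<phi>_\<phi> Y x G_lin G_\<phi>_same)
  also have "\<dots> = G x (R x (\<phi> x Y) Y X) (\<phi> x Y)"
    using R_skew[OF x, of "\<phi> x Y" Y "\<phi> x Y" X] by linarith
  also have "\<dots> = G x (R x X (\<phi> x Y) (\<phi> x Y)) Y"
    by (rule R_pair_sym[OF x])
  finally show ?thesis .
qed

text \<open>The odd part at 1 and at 2 gives a1 + a3 = 0 and 2 a1 + 8 a3 = 0.\<close>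

lemma quartic_linear_coeff:
  assumes "\<And>t::real. a0 + a1 * t + a2 * t^2 + a3 * t^3 + a4 * t^4 = (0::real)"
  shows "a1 = 0"
  using assms[of 1] assms[of "-1"] assms[of 2] assms[of "-2"] by simp

text \<open>The coefficient of t in the identity for Y + t X contains four curvature terms.
  \<open>R_skew_sym\<close> and \<open>R_\<phi>_exchange\<close> make them all equal, so this single
  coefficient determines the mixed curvature.\<close>

lemma hsc_polarized:
  assumes x: "x \<in> S" and k: "\<And>u. \<eta> x u = 0 \<Longrightarrow> G x (R x u (\<phi> x u) (\<phi> x u)) u = k * (G x u u)\<^sup>2"
    and X: "\<eta> x X = 0" and Y: "\<eta> x Y = 0"
  shows "G x (R x X (\<phi> x Y) (\<phi> x Y)) Y = k * (G x Y Y * G x X Y)"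
proof -
  let ?Q = "\<lambda>a b c d. G x (R x a (\<phi> x b) (\<phi> x c)) d"
  have "(?Q Y Y Y Y - k * (G x Y Y)\<^sup>2)
    + (?Q X Y Y Y + ?Q Y X Y Y + ?Q Y Y X Y + ?Q Y Y Y X - 4 * (k * (G x Y Y * G x X Y))) * t
    + (?Q X X Y Y + ?Q X Y X Y + ?Q X Y Y X + ?Q Y X X Y + ?Q Y X Y X + ?Q Y Y X X
       - k * (2 * (G x Y Y * G x X X) + 4 * (G x X Y)\<^sup>2)) * t^2
    + (?Q Y X X X + ?Q X Y X X + ?Q X X Y X + ?Q X X X Y - 4 * (k * (G x X X * G x X Y))) * t^3
    + (?Q X X X X - k * (G x X X)\<^sup>2) * t^4 = 0" for t
  proof -
    have "\<eta> x (Y + t *\<^sub>R X) = 0" using X Y by (simp add: \<eta>_lin x)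
    from k[OF this] show ?thesis
      by (simp add: \<phi>_lin R_lin G_lin x G_sym[OF x, of Y X] algebra_simps power2_eq_square power3_eq_cube power4_eq_xxxx)
  qed
  then have "?Q X Y Y Y + ?Q Y X Y Y + ?Q Y Y X Y + ?Q Y Y Y X - 4 * (k * (G x Y Y * G x X Y)) = 0"
    by (rule quartic_linear_coeff)
  moreover have "?Q Y Y Y X = ?Q X Y Y Y" "?Q Y Y X Y = ?Q Y X Y Y"
    by (rule R_skew_sym[OF x])+
  ultimately show ?thesis using R_\<phi>_exchange[OF x Y, of X] by simp
qed

text \<open>Horizontality is removed so that the identity can be differentiated along parallel
  extensions. On the right \<phi> X and \<phi> Y stand for the horizontal parts, as \<phi> kills
  \<xi>; the term with \<eta> is the contribution of \<xi>, evaluated by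
  \<open>R_\<xi>\<close>.\<close>

lemma hsc_polarized_all:
  assumes x: "x \<in> S" and k: "\<And>u. \<eta> x u = 0 \<Longrightarrow> G x (R x u (\<phi> x u) (\<phi> x u)) u = k * (G x u u)\<^sup>2"
  shows "G x (R x X (\<phi> x Y) (\<phi> x Y)) Y =
    (k * G x (\<phi> x X) (\<phi> x Y) + \<alpha>\<^sup>2 * (\<eta> x X * \<eta> x Y)) * G x (\<phi> x Y) (\<phi> x Y)"
proof -
  define X0 where "X0 = X - \<eta> x X *\<^sub>R \<xi> x"
  define Y0 where "Y0 = Y - \<eta> x Y *\<^sub>R \<xi> x"
  have h: "\<eta> x X0 = 0" "\<eta> x Y0 = 0" by (simp_all add: X0_def Y0_def \<eta>_lin \<eta>_\<xi> x)
  have \<phi>Y0: "\<phi> x Y0 = \<phi> x Y" and \<phi>X0: "\<phi> x X0 = \<phi> x X" by (simp_all add: X0_def Y0_def \<phi>_lin \<phi>_\<xi> x)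
  have X: "X = X0 + \<eta> x X *\<^sub>R \<xi> x" and Y: "Y = Y0 + \<eta> x Y *\<^sub>R \<xi> x" by (simp_all add: X0_def Y0_def)
  have "G x (R x X0 (\<phi> x Y) (\<phi> x Y)) Y0 = k * (G x (\<phi> x Y) (\<phi> x Y) * G x (\<phi> x X) (\<phi> x Y))"
    using hsc_polarized[OF x k h] G_\<phi>_\<phi>[OF x, of Y0 Y0] G_\<phi>_\<phi>[OF x, of X0 Y0] h by (simp add: \<phi>Y0 \<phi>X0)
  moreover have "G x (R x X0 (\<phi> x Y) (\<phi> x Y)) (\<xi> x) = 0"
    using R_skew[OF x, of X0 "\<phi> x Y" "\<phi> x Y" "\<xi> x"] h by (simp add: R_\<xi> \<eta>_\<phi> x G_lin)
  moreover have "G x (R x (\<xi> x) (\<phi> x Y) (\<phi> x Y)) Y = \<alpha>\<^sup>2 * (\<eta> x Y * G x (\<phi> x Y) (\<phi> x Y))"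
    using R_pair_sym[OF x, of "\<xi> x" "\<phi> x Y" "\<phi> x Y" Y] by (simp add: R_\<xi> \<eta>_\<phi> x G_lin)
  moreover have "G x (R x X (\<phi> x Y) (\<phi> x Y)) Y = G x (R x X0 (\<phi> x Y) (\<phi> x Y)) Y0
      + \<eta> x Y * G x (R x X0 (\<phi> x Y) (\<phi> x Y)) (\<xi> x) + \<eta> x X * G x (R x (\<xi> x) (\<phi> x Y) (\<phi> x Y)) Y"
  proof -
    have "R x X (\<phi> x Y) (\<phi> x Y) = R x X0 (\<phi> x Y) (\<phi> x Y) + \<eta> x X *\<^sub>R R x (\<xi> x) (\<phi> x Y) (\<phi> x Y)"
      by (subst X) (simp add: R_lin x)
    moreover have "G x Z Y = G x Z Y0 + \<eta> x Y * G x Z (\<xi> x)" for Z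
      by (subst Y) (simp add: G_lin x)
    ultimately show ?thesis by (simp add: G_lin x algebra_simps)
  qed
  ultimately show ?thesis by (simp add: algebra_simps)
qed

text \<open>Both sides are homogeneous of degree 4 in u.\<close>

lemma hsc_scale:
  assumes x: "x \<in> S" and k: "\<And>u. \<eta> x u = 0 \<Longrightarrow> G x u u = 1 \<Longrightarrow> G x (R x u (\<phi> x u) (\<phi> x u)) u = k"
    and u: "\<eta> x u = 0"
  shows "G x (R x u (\<phi> x u) (\<phi> x u)) u = k * (G x u u)\<^sup>2"
proof (cases "u = 0")
  case True
  then show ?thesis by (simp add: G_lin x)
next
  case False
  define r where "r = sqrt (G x u u)"
  have r: "r > 0" "G x u u = r\<^sup>2" using G_pos[OF x False] by (simp_all add: r_def)
  define v where "v = inverse r *\<^sub>R u"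
  have u_eq: "u = r *\<^sub>R v" using r(1) by (simp add: v_def)
  have "\<eta> x v = 0" "G x v v = 1"
    using u r by (simp_all add: v_def \<eta>_lin G_lin x power2_eq_square field_simps)
  then have "G x (R x v (\<phi> x v) (\<phi> x v)) v = k" by (rule k)
  then show ?thesis
    unfolding r(2) by (subst (1 2 3 4) u_eq) (simp add: \<phi>_lin R_lin G_lin x power2_eq_square)
qed

section \<open>Covariant derivative of the curvature and Schur's lemma\<close>

text \<open>Along parallel extensions the derivative of the curvature at x is \<open>nabla_R\<close>
  alone, so the skewness of R at nearby points can be differentiated.\<close>

lemma nabla_R_skew:
  assumes x: "x \<in> S" shows "G x (nabla_R x z u v w) a = - G x (nabla_R x z u v a) w"
proof -
  note p = parallel_ext[OF x]
  have "((\<lambda>y. G y (R y (parallel_ext x u y) (parallel_ext x v y) (parallel_ext x w y)) (parallel_ext x a y))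
      has_derivative (\<lambda>z. G x (nabla_R x z u v w) a)) (at x)" for w a
    using has_derivative_R[OF x p(3) p(3) p(3) p(3), of u v w a] by (simp add: p(1,2) R_lin G_lin x)
  note d = this
  have "((\<lambda>y. G y (R y (parallel_ext x u y) (parallel_ext x v y) (parallel_ext x w y)) (parallel_ext x a y))
      has_derivative (\<lambda>z. - G x (nabla_R x z u v a) w)) (at x)"
    by (rule has_derivative_transform_within_open[OF has_derivative_minus[OF d] open_S x])
      (simp add: R_skew[symmetric])
  from has_derivative_unique[OF d this] show ?thesis by metis
qed

lemma nabla_R_antisym:
  assumes x: "x \<in> S" shows "nabla_R x z u v w = - nabla_R x z v u w"
proof -
  have d: "((\<lambda>y. R y a b w) has_derivative (\<lambda>z. dd (\<lambda>y. R y a b w) x z)) (at x)" for a b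
    by (rule smooth_on_has_derivative[OF R_smooth x])
  have "((\<lambda>y. - R y v u w) has_derivative (\<lambda>z. - dd (\<lambda>y. R y v u w) x z)) (at x)"
    by (intro has_derivative_minus d)
  then have "dd (\<lambda>y. R y u v w) x z = - dd (\<lambda>y. R y v u w) x z"
    using dd_eq[OF has_derivative_transform_within_open[OF _ open_S x]] R_antisym by (metis (no_types, lifting) ext dd_eq)
  then show ?thesis
    unfolding nabla_R_def
    using R_antisym[of x u v w] R_antisym[of x "\<Gamma> x z u" v w] R_antisym[of x u "\<Gamma> x z v" w]
      R_antisym[of x u v "\<Gamma> x z w"]
    by (simp add: \<Gamma>_lin x)
qed

text \<open>The derivative of \<open>hsc_polarized_all\<close> along parallel extensions. In the
  term with \<eta> x X, the summand with k arises because \<phi> X has derivative \<alpha> \<eta>(X)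
  Z modulo \<xi>; the summand with \<open>\<alpha>\<^sup>2\<close> arises because \<eta>(Y), though
  0 at x, has derivative \<alpha> G(\<phi> Z, Y).\<close>

lemma nabla_R_hsc:
  assumes x: "x \<in> S" and k: "\<And>y u. y \<in> S \<Longrightarrow> \<eta> y u = 0 \<Longrightarrow> G y (R y u (\<phi> y u) (\<phi> y u)) u = k y * (G y u u)\<^sup>2"
    and k': "(k has_derivative k') (at x)" and Y: "\<eta> x Y = 0"
  shows "G x (nabla_R x Z X (\<phi> x Y) (\<phi> x Y)) Y
    = (k' Z * G x X Y + \<alpha> * \<eta> x X * (k x - \<alpha>\<^sup>2) * G x Z (\<phi> x Y)) * G x Y Y"
proof -
  let ?X = "parallel_ext x X" and ?Y = "parallel_ext x Y"
  note p = parallel_ext[OF x]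
  let ?\<phi>X = "\<lambda>y. \<phi> y (?X y)" and ?\<phi>Y = "\<lambda>y. \<phi> y (?Y y)"
  note dX = has_derivative_\<phi>(1)[OF x p(3), of X] and dY = has_derivative_\<phi>(1)[OF x p(3), of Y]
  have cX: "cov_deriv G ?\<phi>X x Z = \<alpha> *\<^sub>R (\<eta> x X *\<^sub>R Z - G x Z X *\<^sub>R \<xi> x)" for Z
    by (simp add: has_derivative_\<phi>(2)[OF x p(3)] p(1,2) \<phi>_lin x)
  have cY: "cov_deriv G ?\<phi>Y x Z = - ((\<alpha> * G x Z Y) *\<^sub>R \<xi> x)" for Z
    by (simp add: has_derivative_\<phi>(2)[OF x p(3)] p(1,2) \<phi>_lin x Y)
  \<comment> \<open>\<phi> Y varies at x only in the direction \<xi>, and putting \<xi> in place of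
    either \<phi> Y makes the curvature term vanish. So the left side differentiates to
    \<open>nabla_R\<close> alone.\<close>
  have z1: "G x (R x X (\<xi> x) (\<phi> x Y)) Y = 0"
    using R_pair_sym[OF x, of X "\<xi> x" "\<phi> x Y" Y] R_skew[OF x, of "\<phi> x Y" Y X "\<xi> x"]
    by (simp add: R_\<xi> \<eta>_\<phi> x Y G_lin)
  have z2: "G x (R x X (\<phi> x Y) (\<xi> x)) Y = 0"
    by (simp add: R_\<xi> \<eta>_\<phi> x G_lin G_\<phi>_same)
  have "((\<lambda>y. G y (R y (?X y) (?\<phi>Y y) (?\<phi>Y y)) (?Y y)) has_derivative
      (\<lambda>Z. G x (nabla_R x Z X (\<phi> x Y) (\<phi> x Y)) Y)) (at x)"
    using has_derivative_R[OF x p(3) dY dY p(3), of X Y] z1 z2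
    by (simp add: p(1,2) cY R_lin G_lin x)
  moreover have "((\<lambda>y. G y (R y (?X y) (?\<phi>Y y) (?\<phi>Y y)) (?Y y)) has_derivative
      (\<lambda>Z. (k' Z * G x X Y + \<alpha> * \<eta> x X * (k x - \<alpha>\<^sup>2) * G x Z (\<phi> x Y)) * G x Y Y)) (at x)"
  proof -
    have "((\<lambda>y. (k y * G y (?\<phi>X y) (?\<phi>Y y) + \<alpha>\<^sup>2 * (\<eta> y (?X y) * \<eta> y (?Y y))) * G y (?\<phi>Y y) (?\<phi>Y y)) has_derivative
      (\<lambda>Z. (k x * G x (?\<phi>X x) (?\<phi>Y x) + \<alpha>\<^sup>2 * (\<eta> x (?X x) * \<eta> x (?Y x))) *
          (G x (cov_deriv G ?\<phi>Y x Z) (?\<phi>Y x) + G x (?\<phi>Y x) (cov_deriv G ?\<phi>Y x Z))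
        + ((k x * (G x (cov_deriv G ?\<phi>X x Z) (?\<phi>Y x) + G x (?\<phi>X x) (cov_deriv G ?\<phi>Y x Z)) + k' Z * G x (?\<phi>X x) (?\<phi>Y x))
          + \<alpha>\<^sup>2 * (\<eta> x (?X x) * (\<alpha> * G x (\<phi> x Z) (?Y x) + \<eta> x (cov_deriv G ?Y x Z))
            + (\<alpha> * G x (\<phi> x Z) (?X x) + \<eta> x (cov_deriv G ?X x Z)) * \<eta> x (?Y x)))
          * G x (?\<phi>Y x) (?\<phi>Y x))) (at x)" (is "(?f has_derivative ?f') (at x)")
      by (intro has_derivative_mult has_derivative_add has_derivative_mult_right k' has_derivative_G[OF x dX dY]
          has_derivative_G[OF x dY dY] has_derivative_\<eta>[OF x p(3)])
    moreover have "?f' = (\<lambda>Z. (k' Z * G x X Y + \<alpha> * \<eta> x X * (k x - \<alpha>\<^sup>2) * G x Z (\<phi> x Y)) * G x Y Y)"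
      by (rule ext) (simp add: p(1,2) cX cY Y \<eta>_lin x G_lin G_\<xi> \<eta>_\<phi> G_\<phi>_\<phi>,
          simp add: G_\<phi>[OF x, of _ Y] algebra_simps)
    ultimately have "(?f has_derivative
      (\<lambda>Z. (k' Z * G x X Y + \<alpha> * \<eta> x X * (k x - \<alpha>\<^sup>2) * G x Z (\<phi> x Y)) * G x Y Y)) (at x)" by simp
    then show ?thesis
      by (rule has_derivative_transform_within_open[OF _ open_S x])
        (rule hsc_polarized_all[OF _ k, symmetric])
  qed
  ultimately show ?thesis by (rule has_derivative_unique[THEN fun_cong])
qed

text \<open>Schur's argument: in the second Bianchi identity for \<open>X, Y, \<phi> Y\<close> only the derivative of
  \<open>k\<close> along \<open>X\<close> survives, as \<open>Y\<close> is orthogonal to \<open>\<xi>\<close>, \<open>X\<close> and \<open>\<phi> X\<close>.\<close>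

lemma schur:
  assumes x: "x \<in> S" and dim: "DIM('e) \<ge> 4"
    and k: "\<And>y u. y \<in> S \<Longrightarrow> \<eta> y u = 0 \<Longrightarrow> G y (R y u (\<phi> y u) (\<phi> y u)) u = k y * (G y u u)\<^sup>2"
    and k': "(k has_derivative k') (at x)"
  shows "k' X = 0"
proof -
  obtain Y where Y: "Y \<noteq> 0" "\<eta> x Y = 0" "G x X Y = 0" "G x X (\<phi> x Y) = 0"
    using horizontal_exists[OF x dim] .
  have n: "G x (nabla_R x Z X (\<phi> x Y) (\<phi> x Y)) Y
    = (k' Z * G x X Y + \<alpha> * \<eta> x X * (k x - \<alpha>\<^sup>2) * G x Z (\<phi> x Y)) * G x Y Y" if "\<eta> x Y = 0" for X Y Z
    by (rule nabla_R_hsc[OF x _ k' that]) (rule k)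
  have 1: "G x (nabla_R x X Y (\<phi> x Y) (\<phi> x Y)) Y = k' X * (G x Y Y * G x Y Y)"
    using n[OF Y(2), of X Y] Y by simp
  have 2: "G x (nabla_R x Y (\<phi> x Y) X (\<phi> x Y)) Y = 0"
    using n[OF Y(2), of Y X] nabla_R_antisym[OF x, of Y "\<phi> x Y" X "\<phi> x Y"] Y by (simp add: G_lin G_\<phi>_same x)
  \<comment> \<open>The third Bianchi term differentiates along \<phi> Y and has Y and \<phi> Y
    exchanged in the curvature slots, so the formula is used for \<phi> Y in place of Y. The vector
    \<phi> \<phi> Y = - Y enters twice and the signs cancel.\<close>
  have "G x (nabla_R x (\<phi> x Y) X (\<phi> x (\<phi> x Y)) (\<phi> x (\<phi> x Y))) (\<phi> x Y) = 0"
    using n[OF \<eta>_\<phi>[OF x], of "\<phi> x Y" X Y] Y by (simp add: G_\<phi>_same x)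
  moreover have "nabla_R x (\<phi> x Y) X (- Y) (- Y) = nabla_R x (\<phi> x Y) X Y Y"
  proof -
    have "dd (\<lambda>y. R y X (- Y) (- Y)) x (\<phi> x Y) = dd (\<lambda>y. R y X Y Y) x (\<phi> x Y)"
      by (rule dd_eq[OF has_derivative_transform_within_open[OF smooth_on_has_derivative[OF R_smooth x] open_S x]])
        (simp add: R_lin)
    then show ?thesis by (simp add: nabla_R_def R_lin \<Gamma>_lin x)
  qed
  ultimately have 3: "G x (nabla_R x (\<phi> x Y) X Y (\<phi> x Y)) Y = 0"
    using nabla_R_skew[OF x, of "\<phi> x Y" X Y "\<phi> x Y" Y] by (simp add: \<phi>_\<phi> x Y(2))
  have "G x (nabla_R x X Y (\<phi> x Y) (\<phi> x Y) + nabla_R x Y (\<phi> x Y) X (\<phi> x Y) + nabla_R x (\<phi> x Y) X Y (\<phi> x Y)) Y = 0"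
    by (simp add: second_bianchi x G_lin)
  then have "k' X * (G x Y Y * G x Y Y) = 0"
    by (simp add: G_lin x 1 2 3)
  with Y(1) show ?thesis by (simp add: G_eq_0_iff x)
qed

text \<open>No regularity of k is given. On a smooth field of horizontal vectors, nonzero near x,
  the identity presents k as a quotient of differentiable functions, and \<open>schur\<close> then
  shows that its derivative is 0.\<close>

lemma schur_has_derivative:
  assumes x: "x \<in> S" and dim: "DIM('e) \<ge> 4"
    and k: "\<And>y u. y \<in> S \<Longrightarrow> \<eta> y u = 0 \<Longrightarrow> G y (R y u (\<phi> y u) (\<phi> y u)) u = k y * (G y u u)\<^sup>2"
  shows "(k has_derivative (\<lambda>h. 0)) (at x)"
proof -
  obtain w where w: "w \<noteq> 0" "\<eta> x w = 0" using horizontal_exists[OF x dim] .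
  \<comment> \<open>By \<open>\<eta>_\<phi>\<close> this field is horizontal at every y, whereas the
    constant field w is known to be so only at x. At x it has the same length as w, hence is
    nonzero.\<close>
  let ?u = "\<lambda>y. \<phi> y w"
  define N where "N y = G y (?u y) (?u y)" for y
  define q where "q y = G y (R y (?u y) (\<phi> y (?u y)) (\<phi> y (?u y))) (?u y)" for y
  note du = has_derivative_\<phi>(1)[OF x has_derivative_const, of w]
  note d\<phi>u = has_derivative_\<phi>(1)[OF x du]
  obtain N' where N': "(N has_derivative N') (at x)"
    using has_derivative_G[OF x du du] unfolding N_def[abs_def] by blast
  obtain q' where q': "(q has_derivative q') (at x)"
    using has_derivative_R[OF x du d\<phi>u d\<phi>u du] unfolding q_def[abs_def] by blast
  have Nx: "N x \<noteq> 0" using w by (simp add: N_def G_\<phi>_\<phi> x G_eq_0_iff)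
  have "isCont N x" using N' has_derivative_continuous by blast
  then obtain U where U: "open U" "x \<in> U" "\<And>y. y \<in> U \<Longrightarrow> N y \<noteq> 0"
    using continuous_at_open[of x N] Nx open_delete[of UNIV 0] by (metis open_UNIV Diff_iff UNIV_I singletonI insertI1 singletonD)
  have N2: "(N x)\<^sup>2 \<noteq> 0" using Nx by simp
  have "(\<lambda>y. q y / (N y)\<^sup>2) differentiable (at x)"
    using q' N' N2 by (intro differentiable_divide differentiable_power) (auto simp: differentiable_def)
  then obtain k' where k': "((\<lambda>y. q y / (N y)\<^sup>2) has_derivative k') (at x)"
    by (auto simp: differentiable_def)
  have "(k has_derivative k') (at x)"
    by (rule has_derivative_transform_within_open[OF k' open_Int[OF open_S U(1)]])
      (use x U k[OF _ \<eta>_\<phi>] in \<open>auto simp: q_def N_def\<close>)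
  with schur[OF x dim k this] show ?thesis by (metis (no_types, lifting) ext)
qed

end

section \<open>Planes in a chart\<close>

context metric_chart
begin

text \<open>A change of basis of the plane multiplies numerator and denominator by the square of the
  same nonzero determinant.\<close>

lemma sectional_curvature_orthonormal:
  assumes x: "x \<in> S" and on: "G x U U = 1" "G x V V = 1" "G x U V = 0"
    and E: "span {u, v} = span {U, V}" "dim (span {u, v}) = 2"
  shows "sectional_curvature G x u v = curvature4 G x U V V U"
proof -
  have "u \<in> span {U, V}" "v \<in> span {U, V}" using E(1) span_base[of _ "{u, v}"] by auto
  then obtain a b c d where u: "u = a *\<^sub>R U + b *\<^sub>R V" and v: "v = c *\<^sub>R U + d *\<^sub>R V"
    unfolding span_insert[of U] span_singleton by (auto simp: algebra_simps)
  have VU: "G x V U = 0" using on(3) G_sym[OF x] by simp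
  have indep: "u \<notin> span {v}" "v \<notin> span {u}"
  proof -
    have "dim (span {w}) \<le> 1" for w :: 'e using dim_le_card'[of "{w}"] by simp
    moreover have "span {u, v} = span {v}" if "u \<in> span {v}" using that by (rule span_redundant)
    moreover have "span {u, v} = span {u}" if "v \<in> span {u}"
      using span_redundant[OF that] by (simp add: insert_commute)
    ultimately show "u \<notin> span {v}" "v \<notin> span {u}" using E(2) by (metis one_le_numeral numeral_le_one_iff semiring_norm(69))+
  qed
  have det: "a * d - b * c \<noteq> 0"
  proof
    assume 0: "a * d - b * c = 0"
    have "d *\<^sub>R u - b *\<^sub>R v = (a * d - b * c) *\<^sub>R U" "a *\<^sub>R v - c *\<^sub>R u = (a * d - b * c) *\<^sub>R V"
      by (simp_all add: u v algebra_simps)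
    then have eq: "d *\<^sub>R u = b *\<^sub>R v" "a *\<^sub>R v = c *\<^sub>R u" using 0 by simp_all
    have "d = 0"
    proof (rule ccontr)
      assume "d \<noteq> 0"
      then have "u = (b / d) *\<^sub>R v" using eq(1) by (metis divide_inverse_commute scaleR_scaleR scaleR_one left_inverse)
      with indep(1) show False by (metis singletonI span_base span_scale)
    qed
    moreover have "a = 0"
    proof (rule ccontr)
      assume "a \<noteq> 0"
      then have "v = (c / a) *\<^sub>R u" using eq(2) by (metis divide_inverse_commute scaleR_scaleR scaleR_one left_inverse)
      with indep(2) show False by (metis singletonI span_base span_scale)
    qed
    ultimately have "u = 0 \<or> v = 0" using 0 u v by auto
    with indep show False by (auto simp: span_zero)
  qed
  have RUU: "R x w w z = 0" for w z by (simp add: R_eq)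
  have VV: "G x (R x u' v' w) w = 0" for u' v' w using R_skew[OF x, of u' v' w w] by simp
  have skew: "G x (R x U V U) V = - G x (R x U V V) U" by (rule R_skew[OF x])
  have VUeq: "R x V U w = - R x U V w" for w by (rule R_antisym)
  have "R x u v w = (a * d - b * c) *\<^sub>R R x U V w" for w
    by (simp add: u v R_lin x RUU VUeq algebra_simps)
  then have "curvature4 G x u v v u = (a * d - b * c) * G x (R x U V v) u"
    by (simp add: curvature4_def G_lin x)
  also have "G x (R x U V v) u = (a * d - b * c) * G x (R x U V V) U"
    by (simp add: u v R_lin G_lin x VV skew algebra_simps)
  finally have num: "curvature4 G x u v v u = (a * d - b * c)\<^sup>2 * curvature4 G x U V V U"
    by (simp add: curvature4_def power2_eq_square)
  have den: "G x u u * G x v v - (G x u v)\<^sup>2 = (a * d - b * c)\<^sup>2"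
    by (simp add: u v G_lin x on VU power2_eq_square algebra_simps)
  show ?thesis
    unfolding sectional_curvature_def num den using det by simp
qed

end

section \<open>The warped product in a chart\<close>

lemma has_derivative_comp_fst:
  "(f has_derivative f') (at x) \<Longrightarrow> ((\<lambda>y. f (fst y)) has_derivative (\<lambda>U. f' (fst U))) (at (x, s))"
  using has_derivative_compose[OF has_derivative_fst[OF has_derivative_ident], of f f' "(x, s)" UNIV] by simp

lemma has_derivative_comp_snd:
  "(f has_real_derivative d) (at s) \<Longrightarrow> ((\<lambda>y. f (snd y)) has_derivative (\<lambda>U. d * snd U)) (at (x, s))"
  using has_derivative_compose[OF has_derivative_snd[OF has_derivative_ident], of f "\<lambda>h. d * h" "(x, s)" UNIV]
  by (simp add: has_field_derivative_def)

lemma smooth_on_deriv: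
  assumes "open I" "smooth_on f I"
  shows "smooth_on (deriv f) I" "s \<in> I \<Longrightarrow> (f has_real_derivative deriv f s) (at s)"
proof -
  have d: "(f has_real_derivative deriv f s) (at s)" if "s \<in> I" for s
    using smooth_on_differentiable[OF assms(2) that] by (simp add: DERIV_deriv_iff_real_differentiable)
  then show "s \<in> I \<Longrightarrow> (f has_real_derivative deriv f s) (at s)" .
  have "deriv f s = dd f s 1" if "s \<in> I" for s
    using dd_eq[OF d[OF that, unfolded has_field_derivative_def], of 1] by simp
  then show "smooth_on (deriv f) I"
    using smooth_on_dd[OF assms(2), of 1] smooth_on_cong[OF assms(1), of "deriv f"] by simp
qed

locale warped_chart = sasakian_chart S G \<phi> \<xi> \<eta> \<alpha>
  for S :: "'e::euclidean_space set" and G \<phi> \<xi> \<eta> \<alpha> +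
  fixes I :: "real set" and p :: "real \<Rightarrow> real"
  assumes warping: "warping_function \<alpha> I p"
begin

lemma open_I: "open I" and p_smooth: "smooth_on p I"
  and p_pos: "s \<in> I \<Longrightarrow> p s > 0" and dp_pos: "s \<in> I \<Longrightarrow> deriv p s > 0"
  using warping by (auto simp: warping_function_def)

lemma nonzero: "s \<in> I \<Longrightarrow> p s \<noteq> 0" "s \<in> I \<Longrightarrow> deriv p s \<noteq> 0" "\<alpha> \<noteq> 0"
  using p_pos[of s] dp_pos[of s] \<alpha>_pos by auto

lemma open_SI: "open (S \<times> I)" by (simp add: open_Times open_S open_I)

lemma smooth_on_fst: "smooth_on f S \<Longrightarrow> smooth_on (\<lambda>y. f (fst y)) (S \<times> I)"
  by (rule smooth_on_compose_linear[OF open_S open_SI bounded_linear_fst]) auto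

lemma smooth_on_snd: "smooth_on f I \<Longrightarrow> smooth_on (\<lambda>y. f (snd y)) (S \<times> I)"
  by (rule smooth_on_compose_linear[OF open_I open_SI bounded_linear_snd]) auto

lemma dp_smooth: "smooth_on (deriv p) I" and ddp_smooth: "smooth_on (deriv (deriv p)) I"
  using smooth_on_deriv[OF open_I] p_smooth by blast+

lemma p_deriv: "s \<in> I \<Longrightarrow> (p has_real_derivative deriv p s) (at s)"
  and dp_deriv: "s \<in> I \<Longrightarrow> (deriv p has_real_derivative deriv (deriv p) s) (at s)"
  using smooth_on_deriv(2)[OF open_I] p_smooth dp_smooth by blast+

text \<open>With \<open>f = p'\<^sup>2 / \<alpha>\<^sup>2 - 1\<close> the metric is \<open>h (g + f \<eta> \<otimes> \<eta>) + ds \<otimes> ds\<close>; \<open>h1\<close> and \<open>k1\<close> are the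
  derivatives of \<open>h\<close> and \<open>h f\<close>, \<open>m\<close> is the length of \<open>\<xi>\<close>, and \<open>lam\<close>, \<open>lam + mu\<close> are the
  logarithmic derivatives of \<open>p\<close> and \<open>m\<close>.\<close>

definition h where "h s = (p s)\<^sup>2"
definition f where "f s = (deriv p s)\<^sup>2 / \<alpha>\<^sup>2 - 1"
definition h1 where "h1 s = 2 * (p s * deriv p s)"
definition f1 where "f1 s = 2 * deriv p s * deriv (deriv p) s / \<alpha>\<^sup>2"
definition k1 where "k1 s = h1 s * f s + h s * f1 s"
definition m where "m s = p s * deriv p s / \<alpha>"
definition lam where "lam s = deriv p s / p s"
definition mu where "mu s = deriv (deriv p) s / deriv p s"

lemma h_pos: "s \<in> I \<Longrightarrow> h s > 0" and m_pos: "s \<in> I \<Longrightarrow> m s > 0"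
  using p_pos[of s] dp_pos[of s] \<alpha>_pos by (auto simp: h_def m_def)

lemma h_deriv: "s \<in> I \<Longrightarrow> (h has_real_derivative h1 s) (at s)"
  unfolding h_def[abs_def] h1_def by (rule derivative_eq_intros p_deriv refl | assumption | simp)+

lemma f_deriv: "s \<in> I \<Longrightarrow> (f has_real_derivative f1 s) (at s)"
  unfolding f_def[abs_def] f1_def
  by (rule derivative_eq_intros dp_deriv refl | assumption | simp add: nonzero power2_eq_square power4_eq_xxxx)+

lemma m_deriv: "s \<in> I \<Longrightarrow> (m has_real_derivative m s * (lam s + mu s)) (at s)"
  unfolding m_def[abs_def] lam_def mu_def
  by (rule derivative_eq_intros p_deriv dp_deriv refl | assumption)+
    (simp_all add: nonzero field_simps power2_eq_square)

lemma h_smooth: "smooth_on h I" and f_smooth: "smooth_on f I" and m_smooth: "smooth_on m I"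
  and h1_smooth: "smooth_on h1 I" and k1_smooth: "smooth_on k1 I"
proof -
  note smooth = smooth_on_mult smooth_on_const smooth_on_diff smooth_on_add open_I p_smooth dp_smooth ddp_smooth
  show 1: "smooth_on h I" "smooth_on f I" "smooth_on m I" "smooth_on h1 I"
    unfolding h_def[abs_def] f_def[abs_def] m_def[abs_def] h1_def[abs_def] divide_inverse power2_eq_square
    by (intro smooth)+
  have "smooth_on f1 I"
    unfolding f1_def[abs_def] divide_inverse power2_eq_square by (intro smooth)
  with 1 show "smooth_on k1 I"
    unfolding k1_def[abs_def] by (intro smooth)
qed

definition W :: "'e \<times> real \<Rightarrow> 'e \<times> real \<Rightarrow> 'e \<times> real \<Rightarrow> real" where
  "W y U V = h (snd y) * (G (fst y) (fst U) (fst V) + f (snd y) * (\<eta> (fst y) (fst U) * \<eta> (fst y) (fst V)))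
    + snd U * snd V"

lemma \<eta>_smooth: "smooth_on (\<lambda>x. \<eta> x v) S"
proof -
  have "smooth_on (\<lambda>x. G x (\<xi> x) v) S"
    by (rule smooth_on_bilinear_family[OF open_S G_bilinear G_smooth \<xi>_smooth smooth_on_const])
  then show ?thesis using smooth_on_cong[OF open_S, of "\<lambda>x. \<eta> x v"] \<eta>_eq by simp
qed

lemma W_pair: "W (x, s) (u, a) (v, b) = h s * (G x u v + f s * (\<eta> x u * \<eta> x v)) + a * b"
  by (simp add: W_def)

lemma hf: "s \<in> I \<Longrightarrow> h s * (1 + f s) = (m s)\<^sup>2"
  by (simp add: h_def f_def m_def power_mult_distrib power_divide)

text \<open>The orthogonal splitting into the parts along D, along \<xi> and along d/ds; positive
  definiteness of W is read off from it.\<close>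

lemma W_same:
  assumes "x \<in> S" "s \<in> I"
  shows "W (x, s) (u, a) (u, a) = h s * G x (\<phi> x u) (\<phi> x u) + (m s * \<eta> x u)\<^sup>2 + a\<^sup>2"
proof -
  have "W (x, s) (u, a) (u, a) = h s * (G x u u - \<eta> x u * \<eta> x u) + h s * (1 + f s) * (\<eta> x u)\<^sup>2 + a\<^sup>2"
    by (simp add: W_pair power2_eq_square algebra_simps)
  then show ?thesis by (simp only: hf[OF assms(2)] G_\<phi>_\<phi>[OF assms(1)] power_mult_distrib)
qed

lemma \<phi>_eq_0: "x \<in> S \<Longrightarrow> \<phi> x u = 0 \<Longrightarrow> u = \<eta> x u *\<^sub>R \<xi> x"
  using \<phi>_\<phi>[of x u] by (simp add: \<phi>_lin)

sublocale W: metric_chart "S \<times> I" W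
proof
  show "open (S \<times> I)" by (rule open_SI)
  fix y assume "y \<in> S \<times> I"
  then obtain x s where y: "y = (x, s)" "x \<in> S" "s \<in> I" by auto
  show "bilinear (W y)"
    unfolding bilinear_def
    by (intro conjI allI linearI) (auto simp: W_def y G_lin \<eta>_lin algebra_simps)
  show "W y U V = W y V U" for U V
    by (simp add: W_def y G_sym[of x "fst U"] mult.commute)
  show "W y U U > 0" if "U \<noteq> 0" for U
  proof -
    obtain u a where U: "U = (u, a)" by fastforce
    have nn: "h s * G x (\<phi> x u) (\<phi> x u) \<ge> 0"
      using h_pos[OF y(3)] G_nonneg[OF y(2)] by simp
    have "h s * G x (\<phi> x u) (\<phi> x u) + (m s * \<eta> x u)\<^sup>2 + a\<^sup>2 \<noteq> 0"
    proof
      assume 0: "h s * G x (\<phi> x u) (\<phi> x u) + (m s * \<eta> x u)\<^sup>2 + a\<^sup>2 = 0"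
      then have "h s * G x (\<phi> x u) (\<phi> x u) = 0" "(m s * \<eta> x u)\<^sup>2 = 0" "a\<^sup>2 = 0"
        using nn by (smt (verit) zero_le_power2)+
      then have "\<phi> x u = 0" "\<eta> x u = 0" "a = 0"
        using h_pos[OF y(3)] m_pos[OF y(3)] by (auto simp: G_eq_0_iff y(2))
      then have "U = 0" using \<phi>_eq_0[OF y(2), of u] U by (simp add: zero_prod_def)
      with that show False by simp
    qed
    moreover have "h s * G x (\<phi> x u) (\<phi> x u) + (m s * \<eta> x u)\<^sup>2 + a\<^sup>2 \<ge> 0"
      using nn by simp
    ultimately show ?thesis
      unfolding y(1) U W_same[OF y(2,3)] by simp
  qed
next
  fix U V
  show "smooth_on (\<lambda>y. W y U V) (S \<times> I)"
    unfolding W_def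
    by (intro smooth_on_mult smooth_on_add open_SI smooth_on_const smooth_on_fst[OF G_smooth]
        smooth_on_fst[OF \<eta>_smooth] smooth_on_snd[OF h_smooth] smooth_on_snd[OF f_smooth])
qed

section \<open>The Levi-Civita connection of the warped metric\<close>

text \<open>The solution of the Koszul equations for W. The term with \<alpha> f is due to the
  derivative of \<eta>, \<open>lam\<close> and \<open>mu\<close> are the logarithmic derivatives of
  p and p', and the last component is minus half the s-derivative of the metric on the slice s =
  const.\<close>

definition conn :: "'e \<times> real \<Rightarrow> 'e \<times> real \<Rightarrow> 'e \<times> real \<Rightarrow> 'e \<times> real" where
  "conn y U V = (\<Gamma> (fst y) (fst U) (fst V)
      + (\<alpha> * f (snd y)) *\<^sub>R (\<eta> (fst y) (fst V) *\<^sub>R \<phi> (fst y) (fst U) + \<eta> (fst y) (fst U) *\<^sub>R \<phi> (fst y) (fst V))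
      + lam (snd y) *\<^sub>R (snd U *\<^sub>R fst V + snd V *\<^sub>R fst U)
      + mu (snd y) *\<^sub>R ((snd U * \<eta> (fst y) (fst V) + snd V * \<eta> (fst y) (fst U)) *\<^sub>R \<xi> (fst y)),
    - (h1 (snd y) * G (fst y) (fst U) (fst V) + k1 (snd y) * (\<eta> (fst y) (fst U) * \<eta> (fst y) (fst V))) / 2)"

lemma conn_pair: "conn (x, s) (u, a) (v, b) = (\<Gamma> x u v
      + (\<alpha> * f s) *\<^sub>R (\<eta> x v *\<^sub>R \<phi> x u + \<eta> x u *\<^sub>R \<phi> x v)
      + lam s *\<^sub>R (a *\<^sub>R v + b *\<^sub>R u) + mu s *\<^sub>R ((a * \<eta> x v + b * \<eta> x u) *\<^sub>R \<xi> x),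
    - (h1 s * G x u v + k1 s * (\<eta> x u * \<eta> x v)) / 2)"
  by (simp add: conn_def)

lemma \<eta>_has_derivative:
  "x \<in> S \<Longrightarrow> ((\<lambda>y. \<eta> y v) has_derivative (\<lambda>u. \<alpha> * G x (\<phi> x u) v + \<eta> x (\<Gamma> x u v))) (at x)"
  using has_derivative_\<eta>[OF _ has_derivative_const] by (simp add: cov_deriv_def)

lemma G_has_derivative:
  "x \<in> S \<Longrightarrow> ((\<lambda>y. G y v w) has_derivative (\<lambda>u. G x (\<Gamma> x u v) w + G x v (\<Gamma> x u w))) (at x)"
  using dG_has_derivative[of x v w] by (simp add: \<Gamma>_metric)

lemma \<phi>_has_derivative:
  "x \<in> S \<Longrightarrow> ((\<lambda>y. \<phi> y v) has_derivative
    (\<lambda>u. \<alpha> *\<^sub>R (\<eta> x v *\<^sub>R u - G x u v *\<^sub>R \<xi> x) + \<phi> x (\<Gamma> x u v) - \<Gamma> x u (\<phi> x v))) (at x)"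
  using has_derivative_\<phi>(1)[OF _ has_derivative_const] by (simp add: cov_deriv_def)

lemma lam_h: "s \<in> I \<Longrightarrow> h s * lam s = h1 s / 2"
  by (simp add: h_def lam_def h1_def power2_eq_square nonzero)

lemma lam_mu_m: "s \<in> I \<Longrightarrow> (m s)\<^sup>2 * (lam s + mu s) = (h1 s + k1 s) / 2"
  by (simp add: h_def lam_def h1_def k1_def mu_def m_def f_def f1_def power2_eq_square nonzero field_simps)

text \<open>Symmetry and metric compatibility determine the connection, so checking both for
  \<open>conn\<close> takes the place of solving the Koszul equations.\<close>

lemma connection_conn:
  assumes "x \<in> S" "s \<in> I" shows "W.connection (x, s) (conn (x, s))"
  unfolding W.connection_def
proof (intro conjI allI)
  show "bilinear (conn (x, s))"
    unfolding bilinear_def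
    by (intro conjI allI linearI)
      (auto simp: conn_def assms G_lin \<eta>_lin \<Gamma>_lin \<phi>_lin algebra_simps add_divide_distrib diff_divide_distrib)
  show "conn (x, s) U V = conn (x, s) V U" for U V
    by (simp add: conn_def \<Gamma>_sym[OF assms(1), of "fst U"] G_sym[OF assms(1), of "fst U"] algebra_simps)
  fix U V Z :: "'e \<times> real"
  obtain u a v b w c where [simp]: "U = (u, a)" "V = (v, b)" "Z = (w, c)" by (metis prod.exhaust)
  note x = assms(1) and s = assms(2)
  note has_derivative_add[OF has_derivative_mult[OF has_derivative_comp_snd[OF h_deriv[OF s]]
        has_derivative_add[OF has_derivative_comp_fst[OF G_has_derivative[OF x, of v w]]
          has_derivative_mult[OF has_derivative_comp_snd[OF f_deriv[OF s]]
            has_derivative_mult[OF has_derivative_comp_fst[OF \<eta>_has_derivative[OF x, of v]]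
              has_derivative_comp_fst[OF \<eta>_has_derivative[OF x, of w]]]]]]
        has_derivative_const[of "b * c"]]
  from dd_eq[OF this, of U]
  have "W.dG (x, s) U V Z = h s * ((G x (\<Gamma> x u v) w + G x v (\<Gamma> x u w)) +
        (f s * (\<eta> x v * (\<alpha> * G x (\<phi> x u) w + \<eta> x (\<Gamma> x u w)) + (\<alpha> * G x (\<phi> x u) v + \<eta> x (\<Gamma> x u v)) * \<eta> x w)
          + (f1 s * a) * (\<eta> x v * \<eta> x w)))
      + (h1 s * a) * (G x v w + f s * (\<eta> x v * \<eta> x w))"
    by (simp add: W_def)
  also have "\<dots> = h s * (G x (\<Gamma> x u v) w + G x v (\<Gamma> x u w))
    + h s * f s * (\<eta> x v * (\<alpha> * G x (\<phi> x u) w + \<eta> x (\<Gamma> x u w)) + (\<alpha> * G x (\<phi> x u) v + \<eta> x (\<Gamma> x u v)) * \<eta> x w)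
    + a * (h1 s * G x v w + k1 s * (\<eta> x v * \<eta> x w))"
    by (simp add: k1_def algebra_simps)
  also have "\<dots> = W (x, s) (conn (x, s) U V) Z + W (x, s) V (conn (x, s) U Z)"
  proof -
    have 1: "G x (\<phi> x v) w + G x v (\<phi> x w) = 0" using G_\<phi>[OF assms(1)] by simp
    have 2: "G x v (\<phi> x u) = G x (\<phi> x u) v" "G x v u = G x u v" using G_sym[OF assms(1)] by blast+
    \<comment> \<open>\<open>h1\<close> and \<open>k1\<close> are eliminated in favour of h, f,
      \<open>lam\<close> and \<open>mu\<close>, after which both sides agree as polynomials.\<close>
    have 3: "h1 s = 2 * (h s * lam s)" using lam_h[OF assms(2)] by simp
    have 4: "k1 s = 2 * (h s * (1 + f s) * (lam s + mu s)) - 2 * (h s * lam s)"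
      using lam_mu_m[OF assms(2)] lam_h[OF assms(2)] hf[OF assms(2)] by simp
    have 5: "G x v (\<phi> x w) = - G x (\<phi> x v) w" using 1 by simp
    show ?thesis
      by (simp add: conn_pair W_pair 3 4 add_divide_distrib diff_divide_distrib assms G_lin \<eta>_lin \<eta>_\<phi> G_\<xi> \<eta>_\<xi> 2 5 algebra_simps)
  qed
  finally show "W.dG (x, s) U V Z = W (x, s) (conn (x, s) U V) Z + W (x, s) V (conn (x, s) U Z)" .
qed

lemma W_\<Gamma>: "x \<in> S \<Longrightarrow> s \<in> I \<Longrightarrow> W.\<Gamma> (x, s) = conn (x, s)"
  by (rule W.levi_civitaI[OF _ connection_conn]) auto

section \<open>The complex structure and its parallelism\<close>

text \<open>The same map as \<open>warped_J\<close>: since m = p p' / \<alpha>, the field \<xi> / m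
  is the unit field in the direction of \<xi>. In this form m is the only function of s to be
  differentiated.\<close>

definition J :: "'e \<times> real \<Rightarrow> 'e \<times> real \<Rightarrow> 'e \<times> real" where
  "J y U = (\<phi> (fst y) (fst U) + (snd U * inverse (m (snd y))) *\<^sub>R \<xi> (fst y), - (m (snd y) * \<eta> (fst y) (fst U)))"

lemma J_pair: "J (x, s) (u, a) = (\<phi> x u + (a * inverse (m s)) *\<^sub>R \<xi> x, - (m s * \<eta> x u))"
  by (simp add: J_def)

lemma m_nonzero: "s \<in> I \<Longrightarrow> m s \<noteq> 0"
  using m_pos[of s] by simp

lemma J_linear:
  assumes "x \<in> S" shows "linear (J (x, s))"
  by (rule linearI) (auto simp: J_def \<phi>_lin \<eta>_lin assms algebra_simps)

lemma J_smooth: "smooth_on (\<lambda>y. J y U) (S \<times> I)"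
proof -
  have "smooth_on (\<lambda>s. inverse (m s)) I"
    by (rule smooth_on_inverse[OF open_I m_nonzero m_smooth])
  then show ?thesis
    unfolding J_def
    by (intro smooth_on_Pair smooth_on_add smooth_on_minus smooth_on_mult smooth_on_scaleR open_SI
        smooth_on_const smooth_on_fst[OF \<phi>_smooth] smooth_on_fst[OF \<xi>_smooth] smooth_on_fst[OF \<eta>_smooth]
        smooth_on_snd[OF m_smooth] smooth_on_snd[where f = "\<lambda>s. inverse (m s)"])
qed

lemma J_J:
  assumes "x \<in> S" "s \<in> I" shows "J (x, s) (J (x, s) U) = - U"
  by (cases U) (simp add: J_pair \<phi>_lin \<eta>_lin \<phi>_\<phi> \<phi>_\<xi> \<eta>_\<phi> \<eta>_\<xi> assms m_nonzero)

text \<open>J exchanges the parts along \<xi> and d/ds, and h (1 + f) = m^2 makes this exchange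
  isometric.\<close>

lemma W_J_J:
  assumes "x \<in> S" "s \<in> I" shows "W (x, s) (J (x, s) U) (J (x, s) V) = W (x, s) U V"
proof -
  obtain u a v b where [simp]: "U = (u, a)" "V = (v, b)" by fastforce
  have "W (x, s) (J (x, s) U) (J (x, s) V) = h s * (G x u v - \<eta> x u * \<eta> x v)
      + h s * (1 + f s) * (a * inverse (m s) * (b * inverse (m s))) + m s * \<eta> x u * (m s * \<eta> x v)"
    by (simp add: J_pair W_pair G_lin \<eta>_lin G_\<phi>_\<phi> G_\<xi> \<eta>_\<phi> \<eta>_\<xi> assms algebra_simps)
  also have "\<dots> = W (x, s) U V"
  proof -
    have "m s * \<eta> x u * (m s * \<eta> x v) = h s * (1 + f s) * (\<eta> x u * \<eta> x v)"
      by (simp add: hf[OF assms(2)] power2_eq_square mult_ac)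
    moreover have "h s * (1 + f s) * (a * inverse (m s) * (b * inverse (m s))) = a * b"
      using m_nonzero[OF assms(2)] by (simp add: hf[OF assms(2)] power2_eq_square field_simps)
    ultimately show ?thesis by (simp add: W_pair algebra_simps)
  qed
  finally show ?thesis .
qed

text \<open>m \<open>lam\<close> = p'^2 / \<alpha>, which is \<alpha> (1 + f) by the choice of f.
  This relation ties the derivative of p to the structure constant of the base and is how the shape
  of the warped metric makes J parallel.\<close>

lemma alpha_f: "s \<in> I \<Longrightarrow> m s * lam s = \<alpha> + \<alpha> * f s"
  and h1_m: "s \<in> I \<Longrightarrow> h1 s = 2 * (\<alpha> * m s)"
  by (simp_all add: m_def lam_def h1_def f_def nonzero power2_eq_square field_simps)

lemma J_parallel:
  assumes x: "x \<in> S" and s: "s \<in> I" shows "cov_deriv_endo W J (x, s) U V = 0"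
proof -
  obtain u a v b where [simp]: "U = (u, a)" "V = (v, b)" by fastforce
  \<comment> \<open>m s and its inverse become symbols M and n subject to M n = 1, so that the final
    identities are polynomial.\<close>
  define n where "n = inverse (m s)"
  define M where "M = m s"
  have minv: "((\<lambda>s. inverse (m s)) has_real_derivative - (n * (lam s + mu s))) (at s)"
    using DERIV_inverse'[OF m_deriv[OF s] m_nonzero[OF s]] m_nonzero[OF s] by (simp add: n_def mult.assoc[symmetric] mult.commute)
  have eq: "(\<lambda>y. J y V) = (\<lambda>y. (\<phi> (fst y) v + (b * inverse (m (snd y))) *\<^sub>R \<xi> (fst y), - (m (snd y) * \<eta> (fst y) v)))"
    by (simp add: J_def fun_eq_iff)
  note has_derivative_Pair[OF
      has_derivative_add[OF has_derivative_comp_fst[OF \<phi>_has_derivative[OF x, of v]]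
        has_derivative_scaleR[OF has_derivative_mult_right[OF has_derivative_comp_snd[OF minv], of b]
          has_derivative_comp_fst[OF \<xi>_has_derivative[OF x]]]]
      has_derivative_minus[OF has_derivative_mult[OF has_derivative_comp_snd[OF m_deriv[OF s]]
          has_derivative_comp_fst[OF \<eta>_has_derivative[OF x, of v]]]]]
  from dd_eq[OF this, of U]
  have dJ: "dd (\<lambda>y. J y V) (x, s) U =
    (\<alpha> *\<^sub>R (\<eta> x v *\<^sub>R u - G x u v *\<^sub>R \<xi> x) + \<phi> x (\<Gamma> x u v) - \<Gamma> x u (\<phi> x v)
      + ((b * n) *\<^sub>R (\<alpha> *\<^sub>R \<phi> x u - \<Gamma> x u (\<xi> x)) - (b * (n * (lam s + mu s) * a)) *\<^sub>R \<xi> x),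
     - (M * (\<alpha> * G x (\<phi> x u) v + \<eta> x (\<Gamma> x u v)) + M * (lam s + mu s) * a * \<eta> x v))"
    unfolding eq by (simp add: n_def M_def)
  have Mn: "M * n = 1" using m_nonzero[OF s] by (simp add: M_def n_def)
  have n: "inverse M = n" and M: "m s = M" by (simp_all add: n_def M_def)
  have lam: "lam s = \<alpha> * n * (1 + f s)"
    using alpha_f[OF s] m_nonzero[OF s] by (simp add: n_def field_simps)
  have h1: "h1 s = 2 * (\<alpha> * M)" using h1_m[OF s] by (simp add: M_def)
  have k1: "k1 s = 2 * (M * M * (lam s + mu s)) - 2 * (\<alpha> * M)"
    using lam_mu_m[OF s] h1 by (simp add: M_def power2_eq_square)
  have *: "cov_deriv_endo W J (x, s) U V = dd (\<lambda>y. J y V) (x, s) U + conn (x, s) U (J (x, s) V) - J (x, s) (conn (x, s) U V)"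
    by (simp add: cov_deriv_endo_def cov_deriv_def W_\<Gamma> x s)
  \<comment> \<open>Testing against an arbitrary w turns the vector identity into one between real
    numbers, where \<open>algebra\<close> applies.\<close>
  have "fst (cov_deriv_endo W J (x, s) U V) = 0"
  proof (rule vector_eq_ldot[THEN iffD1], rule allI)
    fix w
    show "w \<bullet> fst (cov_deriv_endo W J (x, s) U V) = w \<bullet> 0"
      unfolding * dJ
      using Mn
      by (simp add: J_pair conn_pair x \<Gamma>_lin \<phi>_lin \<eta>_lin G_lin \<eta>_\<phi> \<eta>_\<xi> \<phi>_\<xi> \<phi>_\<phi>
          n M inner_simps G_\<xi> h1 k1 lam) algebra
  qed
  moreover have "snd (cov_deriv_endo W J (x, s) U V) = 0"
    unfolding * dJ
    using Mn G_\<phi>[OF x, of u v]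
    by (simp add: J_pair conn_pair x \<Gamma>_lin \<phi>_lin \<eta>_lin G_lin \<eta>_\<phi> \<eta>_\<xi> \<phi>_\<xi> \<phi>_\<phi>
        n M inner_simps G_\<xi> h1 k1 lam) algebra
  ultimately show ?thesis by (simp add: prod_eq_iff)
qed

text \<open>The curvature on \<open>U = (u, a)\<close> and \<open>J U\<close> for \<open>\<eta> u = 0\<close>, where \<open>r\<close> is the curvature of \<open>g\<close> on
  \<open>u\<close>, \<open>\<phi> u\<close> and \<open>\<rho> = g(u, u)\<close>.  All that matters later is that it depends only on
  \<open>s, r, \<rho>, a\<close> and is affine in \<open>r\<close> with slope \<open>h s > 0\<close>.\<close>

definition hol_curv :: "real \<Rightarrow> real \<Rightarrow> real \<Rightarrow> real \<Rightarrow> real" where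
  "hol_curv s r \<rho> a = (let c = a * inverse (m s); F = \<alpha> * f s; \<beta> = F * c + a * lam s; \<gamma> = a * (lam s + mu s) * c in
    h s * (r + c\<^sup>2 * \<alpha>\<^sup>2 * \<rho> + \<rho> * (- 2 * a * \<alpha> * f1 s * c - 3 * F * \<alpha> * \<rho> + 2 * F * \<alpha> * c\<^sup>2 + mu s * a * c * \<alpha>
        - 2 * F * c * a * lam s - (h1 s * \<rho> + (h1 s + k1 s) * c\<^sup>2) / 2 * lam s + F * \<gamma> + F * c * \<beta>))
    + a * (- a * (deriv h1 s * \<rho> + (deriv h1 s + deriv k1 s) * c\<^sup>2) / 2 - 3 / 2 * k1 s * \<alpha> * \<rho> * c + F * c * h1 s * \<rho>
        + (h1 s * \<beta> * \<rho> + (h1 s + k1 s) * c * \<gamma>) / 2))"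

lemma hol_curv_linear: "hol_curv s r \<rho> a = h s * r + hol_curv s 0 \<rho> a"
  by (simp add: hol_curv_def Let_def algebra_simps)

section \<open>Curvature of the warped metric on holomorphic planes\<close>

lemma W_d\<Gamma>:
  assumes "x \<in> S" "s \<in> I" "((\<lambda>y. conn y V Z) has_derivative D) (at (x, s))"
  shows "W.d\<Gamma> (x, s) U V Z = D U"
proof -
  have "((\<lambda>y. W.\<Gamma> y V Z) has_derivative D) (at (x, s))"
    by (rule has_derivative_transform_within_open[OF assms(3) open_SI]) (use assms(1,2) W_\<Gamma> in auto)
  then show ?thesis by (rule dd_eq)
qed

lemma h1_deriv: "s \<in> I \<Longrightarrow> (h1 has_real_derivative deriv h1 s) (at s)"
  and k1_deriv: "s \<in> I \<Longrightarrow> (k1 has_real_derivative deriv k1 s) (at s)"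
  using smooth_on_deriv(2)[OF open_I] h1_smooth k1_smooth by blast+

lemma lam_mu_deriv:
  assumes "s \<in> I"
  shows "(lam has_real_derivative deriv lam s) (at s)" "(mu has_real_derivative deriv mu s) (at s)"
proof -
  have "smooth_on (\<lambda>s. deriv p s * inverse (p s)) I" "smooth_on (\<lambda>s. deriv (deriv p) s * inverse (deriv p s)) I"
    by (intro smooth_on_mult open_I dp_smooth ddp_smooth smooth_on_inverse p_smooth nonzero; assumption)+
  then have "smooth_on lam I" "smooth_on mu I" by (simp_all add: lam_def[abs_def] mu_def[abs_def] divide_inverse)
  then show "(lam has_real_derivative deriv lam s) (at s)" "(mu has_real_derivative deriv mu s) (at s)"
    using smooth_on_deriv(2)[OF open_I] assms by blast+
qed

text \<open>The mixed terms vanish, and a plane containing \<xi> has sectional curvature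
  \<open>\<alpha>\<^sup>2\<close>; both follow from \<open>R_\<xi>\<close>.\<close>

lemma R_\<xi>_horizontal:
  assumes x: "x \<in> S" and u: "\<eta> x u = 0"
  shows "G x (R x u (\<phi> x u + c *\<^sub>R \<xi> x) (\<phi> x u + c *\<^sub>R \<xi> x)) u
    = G x (R x u (\<phi> x u) (\<phi> x u)) u + c\<^sup>2 * \<alpha>\<^sup>2 * G x u u"
proof -
  have "G x (R x u (\<xi> x) (\<phi> x u)) u = 0"
    using R_pair_sym[OF x, of u "\<xi> x" "\<phi> x u" u] R_skew[OF x, of "\<phi> x u" u u "\<xi> x"]
    by (simp add: R_\<xi> \<eta>_\<phi> x u G_lin)
  then show ?thesis
    by (simp add: R_lin R_\<xi> G_lin x u \<eta>_lin \<eta>_\<phi> \<eta>_\<xi> G_\<phi>_same power2_eq_square)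
qed

text \<open>Direct expansion of the curvature of \<open>conn\<close>. The terms with \<Gamma> of the
  base either combine to the curvature of the base or cancel, and \<open>hol_curv\<close> records
  what remains.\<close>

lemma curvature_holomorphic:
  assumes x: "x \<in> S" and s: "s \<in> I" and u: "\<eta> x u = 0"
  shows "curvature4 W (x, s) (u, a) (J (x, s) (u, a)) (J (x, s) (u, a)) (u, a)
    = hol_curv s (G x (R x u (\<phi> x u) (\<phi> x u)) u) (G x u u) a"
proof -
  define c where "c = a * inverse (m s)"
  define v where "v = \<phi> x u + c *\<^sub>R \<xi> x"
  define F where "F = \<alpha> * f s"
  \<comment> \<open>There is no component along d/ds because \<eta> u = 0. So differentiation along
    J U leaves s fixed, and only the direction (u, a) moves it.\<close>
  have J: "J (x, s) (u, a) = (v, 0)" by (simp add: J_pair u v_def c_def)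
  have \<phi>u: "\<phi> x u = v - c *\<^sub>R \<xi> x" by (simp add: v_def)
  have \<phi>v: "\<phi> x v = - u" by (simp add: v_def \<phi>_lin x \<phi>_\<phi> \<phi>_\<xi> u)
  have \<eta>v: "\<eta> x v = c" by (simp add: v_def \<eta>_lin x \<eta>_\<phi> \<eta>_\<xi>)
  have Guv: "G x u v = 0" "G x v u = 0" by (simp_all add: v_def G_lin x G_\<phi>_same G_\<xi> u)
  have Gvv: "G x v v = G x u u + c\<^sup>2"
    by (simp add: v_def G_lin \<eta>_lin x G_\<phi>_\<phi> G_\<xi> \<eta>_\<phi> \<eta>_\<xi> u power2_eq_square)
  \<comment> \<open>The components are regrouped to match literally the nest of derivative rules
    composed below.\<close>
  have eq1: "(\<lambda>y. conn y (v, 0) (v, 0)) = (\<lambda>y. (\<Gamma> (fst y) v v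
      + (2 * \<alpha> * f (snd y)) *\<^sub>R (\<eta> (fst y) v *\<^sub>R \<phi> (fst y) v),
      (- (1/2)) * (h1 (snd y) * G (fst y) v v + k1 (snd y) * (\<eta> (fst y) v * \<eta> (fst y) v))))"
    by (simp add: conn_def fun_eq_iff scaleR_2[symmetric] mult.assoc, simp add: field_simps)
  note d\<eta> = has_derivative_comp_fst[OF \<eta>_has_derivative[OF x]]
  note d\<phi> = has_derivative_comp_fst[OF \<phi>_has_derivative[OF x]]
  note dg = has_derivative_comp_fst[OF G_has_derivative[OF x]]
  note df = has_derivative_mult_right[OF has_derivative_comp_snd[OF f_deriv[OF s]]]
  note dh = has_derivative_comp_snd[OF h1_deriv[OF s]]
  note dk = has_derivative_comp_snd[OF k1_deriv[OF s]]
  note has_derivative_Pair[OF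
      has_derivative_add[OF has_derivative_comp_fst[OF d\<Gamma>_has_derivative[OF x, of v v]]
        has_derivative_scaleR[OF df[of "2 * \<alpha>"] has_derivative_scaleR[OF d\<eta>[of v] d\<phi>[of v]]]]
      has_derivative_mult_right[OF has_derivative_add[OF has_derivative_mult[OF dh dg[of v v]]
        has_derivative_mult[OF dk has_derivative_mult[OF d\<eta>[of v] d\<eta>[of v]]]], of "- (1/2)"]]
  from W_d\<Gamma>[OF x s this[folded eq1], of "(u, a)"]
  have D1: "W.d\<Gamma> (x, s) (u, a) (v, 0) (v, 0) = (d\<Gamma> x u v v
     + ((2 * F) *\<^sub>R (c *\<^sub>R ((\<alpha> * c) *\<^sub>R u + \<phi> x (\<Gamma> x u v) + \<Gamma> x u u)
         - (\<alpha> * G x u u + \<eta> x (\<Gamma> x u v)) *\<^sub>R u) - (2 * \<alpha> * f1 s * a * c) *\<^sub>R u),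
     - (h1 s * (2 * G x (\<Gamma> x u v) v) + deriv h1 s * a * (G x u u + c\<^sup>2)
       + k1 s * (2 * c * (\<alpha> * G x u u + \<eta> x (\<Gamma> x u v))) + deriv k1 s * a * c\<^sup>2) / 2)"
    by (simp add: F_def \<phi>u \<phi>v \<eta>v Guv Gvv u x G_lin \<Gamma>_lin \<eta>_lin G_\<xi> \<eta>_\<xi> G_sym[OF x, of v "\<Gamma> x u v"] algebra_simps power2_eq_square)
  have eq2: "(\<lambda>y. conn y (u, a) (v, 0)) = (\<lambda>y. (\<Gamma> (fst y) u v
      + (\<alpha> * f (snd y)) *\<^sub>R (\<eta> (fst y) v *\<^sub>R \<phi> (fst y) u + \<eta> (fst y) u *\<^sub>R \<phi> (fst y) v)
      + lam (snd y) *\<^sub>R (a *\<^sub>R v) + mu (snd y) *\<^sub>R ((a * \<eta> (fst y) v) *\<^sub>R \<xi> (fst y)),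
      (- (1/2)) * (h1 (snd y) * G (fst y) u v + k1 (snd y) * (\<eta> (fst y) u * \<eta> (fst y) v))))"
    by (simp add: conn_def fun_eq_iff, simp add: field_simps)
  note has_derivative_Pair[OF
      has_derivative_add[OF has_derivative_add[OF has_derivative_add[OF has_derivative_comp_fst[OF d\<Gamma>_has_derivative[OF x, of u v]]
        has_derivative_scaleR[OF df[of "\<alpha>"] has_derivative_add[OF has_derivative_scaleR[OF d\<eta>[of v] d\<phi>[of u]]
          has_derivative_scaleR[OF d\<eta>[of u] d\<phi>[of v]]]]]
        has_derivative_scaleR[OF has_derivative_comp_snd[OF lam_mu_deriv(1)[OF s]] has_derivative_const[of "a *\<^sub>R v"]]]
        has_derivative_scaleR[OF has_derivative_comp_snd[OF lam_mu_deriv(2)[OF s]]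
          has_derivative_scaleR[OF has_derivative_mult_right[OF d\<eta>[of v], of a] has_derivative_comp_fst[OF \<xi>_has_derivative[OF x]]]]]
      has_derivative_mult_right[OF has_derivative_add[OF has_derivative_mult[OF dh dg[of u v]]
        has_derivative_mult[OF dk has_derivative_mult[OF d\<eta>[of u] d\<eta>[of v]]]], of "- (1/2)"]]
  from W_d\<Gamma>[OF x s this[folded eq2], of "(v, 0)"]
  have D2: "W.d\<Gamma> (x, s) (v, 0) (u, a) (v, 0) = (d\<Gamma> x v u v
     + F *\<^sub>R (c *\<^sub>R (\<phi> x (\<Gamma> x u v) - \<Gamma> x v (v - c *\<^sub>R \<xi> x)) + \<eta> x (\<Gamma> x v v) *\<^sub>R (v - c *\<^sub>R \<xi> x)
         - (\<eta> x (\<Gamma> x u v) - \<alpha> * G x u u) *\<^sub>R u)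
     + (mu s * a) *\<^sub>R (\<eta> x (\<Gamma> x v v) *\<^sub>R \<xi> x - c *\<^sub>R (\<alpha> *\<^sub>R u + \<Gamma> x v (\<xi> x))),
     - (h1 s * (G x (\<Gamma> x u v) v + G x u (\<Gamma> x v v)) + k1 s * (c * (\<eta> x (\<Gamma> x u v) - \<alpha> * G x u u))) / 2)"
    by (simp add: F_def \<phi>u \<phi>v \<eta>v Guv Gvv u x G_lin \<Gamma>_lin \<eta>_lin G_\<xi> \<eta>_\<xi> \<Gamma>_sym[OF x, of v u] algebra_simps power2_eq_square)
  have C: "conn (x, s) (v, 0) (v, 0) = (\<Gamma> x v v - (2 * F * c) *\<^sub>R u, - (h1 s * (G x u u + c\<^sup>2) + k1 s * c\<^sup>2) / 2)"
      "conn (x, s) (u, a) (v, 0) = (\<Gamma> x u v + (F * c) *\<^sub>R (v - c *\<^sub>R \<xi> x) + (lam s * a) *\<^sub>R v + (mu s * a * c) *\<^sub>R \<xi> x, 0)"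
    by (simp_all add: conn_pair F_def \<phi>u \<phi>v \<eta>v Guv Gvv u power2_eq_square mult.assoc scaleR_2[symmetric])
  \<comment> \<open>This removes \<phi> from products with u in favour of \<eta> and v, so that the
    \<Gamma>-terms become comparable.\<close>
  have G\<phi>: "G x (\<phi> x z) u = c * \<eta> x z - G x z v" for z
    using G_\<phi>[OF x, of z u] by (simp add: \<phi>u G_lin G_\<xi> x)
  have WU: "W (x, s) (w, b) (u, a) = h s * G x w u + b * a" for w b
    by (simp add: W_pair u)
  have Rv: "G x (R x u v v) u = G x (R x u (\<phi> x u) (\<phi> x u)) u + c\<^sup>2 * \<alpha>\<^sup>2 * G x u u"
    unfolding v_def by (rule R_\<xi>_horizontal[OF x u])
  have "curvature4 W (x, s) (u, a) (v, 0) (v, 0) (u, a) =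
    W (x, s) (W.d\<Gamma> (x, s) (u, a) (v, 0) (v, 0) + conn (x, s) (u, a) (conn (x, s) (v, 0) (v, 0))
     - (W.d\<Gamma> (x, s) (v, 0) (u, a) (v, 0) + conn (x, s) (v, 0) (conn (x, s) (u, a) (v, 0)))) (u, a)"
    by (simp add: curvature4_def W.R_eq W_\<Gamma> x s)
  \<comment> \<open>The first summand is exactly R(u, v) v of the base, paired with u;
    \<open>Rv\<close> then trades it for the \<phi>-holomorphic curvature of u.\<close>
  also have "\<dots> = h s * G x (d\<Gamma> x u v v + \<Gamma> x u (\<Gamma> x v v) - (d\<Gamma> x v u v + \<Gamma> x v (\<Gamma> x u v))) u
     + (hol_curv s (G x (R x u (\<phi> x u) (\<phi> x u)) u) (G x u u) a - h s * (G x (R x u (\<phi> x u) (\<phi> x u)) u + c\<^sup>2 * \<alpha>\<^sup>2 * G x u u))"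
    unfolding D1 D2 C hol_curv_def Let_def c_def[symmetric] F_def[symmetric]
    by (simp add: conn_pair F_def[symmetric] WU \<phi>v \<eta>v Guv Gvv u x G_lin \<Gamma>_lin \<eta>_lin \<phi>_lin G_\<xi> \<eta>_\<xi> \<phi>_\<xi> G\<phi> \<Gamma>_sym[OF x, of v u]
       G_sym[OF x, of v "\<Gamma> x u v"] G_sym[OF x, of u "\<Gamma> x v v"])
      (simp add: field_simps power2_eq_square)
  also have "\<dots> = hol_curv s (G x (R x u (\<phi> x u) (\<phi> x u)) u) (G x u u) a"
    using Rv by (simp add: R_eq)
  finally show ?thesis by (simp add: J)
qed

section \<open>Holomorphic planes and their angle with the complement of D\<close>

text \<open>An isometry with square - 1 is skew.\<close>

lemma W_J:
  assumes "x \<in> S" "s \<in> I" shows "W (x, s) U (J (x, s) U) = 0" "W (x, s) (J (x, s) U) U = 0"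
proof -
  have xs: "(x, s) \<in> S \<times> I" using assms by simp
  have "- W (x, s) (J (x, s) U) U = W (x, s) U (J (x, s) U)"
    using W_J_J[OF assms, of U "J (x, s) U"] by (simp add: J_J assms W.G_lin)
  then show "W (x, s) U (J (x, s) U) = 0" "W (x, s) (J (x, s) U) U = 0"
    using W.G_sym[OF xs, of U "J (x, s) U"] by auto
qed

lemma W_horizontal: "\<eta> x u = 0 \<Longrightarrow> W (x, s) (u, a) (u, a) = h s * G x u u + a\<^sup>2"
  by (simp add: W_pair power2_eq_square)

lemma dim_J_plane:
  assumes xs: "x \<in> S" "s \<in> I" and "U \<noteq> 0" shows "dim (span {U, J (x, s) U}) = 2"
proof -
  have W: "W (x, s) U U \<noteq> 0" using W.G_pos[of "(x, s)" U] assms by auto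
  have notin: "U \<notin> span {J (x, s) U}"
  proof
    assume "U \<in> span {J (x, s) U}"
    then obtain k where "U = k *\<^sub>R J (x, s) U" by (auto simp: span_singleton)
    then have "W (x, s) U U = W (x, s) U (k *\<^sub>R J (x, s) U)" by (rule arg_cong)
    with W show False by (simp add: W.G_lin W_J xs)
  qed
  moreover have "J (x, s) U \<noteq> 0"
    using J_J[OF xs, of U] linear_0[OF J_linear[OF xs(1)], of s] assms(3) by auto
  ultimately have "independent {U, J (x, s) U}" "U \<noteq> J (x, s) U"
    using span_base[of "J (x, s) U" "{J (x, s) U}"] by (auto simp: independent_insert)
  then show ?thesis by (simp add: dim_eq_card_independent)
qed

text \<open>A \<open>J\<close>-invariant plane meets the hyperplane \<open>\<eta> = 0\<close>, so it has a unit vector \<open>(u, a)\<close> with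
  \<open>\<eta> u = 0\<close>; then \<open>a\<close> is the cosine of its angle with the orthogonal complement of \<open>D\<close>.\<close>

lemma J_plane_unit:
  assumes xs: "x \<in> S" "s \<in> I" and E: "subspace E" "dim E = 2" "J (x, s) ` E \<subseteq> E"
  obtains u a where "\<eta> x u = 0" "a \<ge> 0" "W (x, s) (u, a) (u, a) = 1" "E = span {(u, a), J (x, s) (u, a)}"
proof -
  have y: "(x, s) \<in> S \<times> I" using xs by simp
  obtain X where X: "X \<in> E" "X \<noteq> 0"
    using E(2) dim_eq_0[of E] by auto
  have "\<exists>U\<in>E. U \<noteq> 0 \<and> \<eta> x (fst U) = 0"
  proof (cases "\<eta> x (fst X) = 0")
    case True
    then show ?thesis using X by blast
  next
    case False
    \<comment> \<open>The combination of X and J X that \<eta> annihilates. It is nonzero because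
      its product with J X is - \<eta>(X) W(X, X).\<close>
    let ?U = "\<eta> x (fst (J (x, s) X)) *\<^sub>R X - \<eta> x (fst X) *\<^sub>R J (x, s) X"
    have "J (x, s) X \<in> E" using E(3) X(1) by blast
    then have "?U \<in> E"
      using E(1) X(1) by (intro subspace_diff subspace_scale)
    moreover have "?U \<noteq> 0"
    proof
      assume "?U = 0"
      then have "W (x, s) ?U (J (x, s) X) = 0" by (simp only: W.G_lin(9)[OF y])
      then have "\<eta> x (fst X) * W (x, s) X X = 0"
        by (simp add: W.G_lin y W_J W_J_J xs)
      with False X(2) show False by (simp add: W.G_eq_0_iff xs)
    qed
    moreover have "\<eta> x (fst ?U) = 0" by (simp add: \<eta>_lin xs)
    ultimately show ?thesis by blast
  qed
  then obtain U where U: "U \<in> E" "U \<noteq> 0" "\<eta> x (fst U) = 0" by blast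
  \<comment> \<open>One factor normalizes the length and makes the component along d/ds nonnegative;
    the sign is taken as 1 when that component is 0, so \<sigma> never vanishes.\<close>
  define \<sigma> where "\<sigma> = (if snd U \<ge> 0 then 1 else -1::real) / sqrt (W (x, s) U U)"
  have W: "W (x, s) U U > 0" using W.G_pos[OF y U(2)] .
  have \<sigma>: "\<sigma> \<noteq> 0" "\<sigma> * \<sigma> * W (x, s) U U = 1" "\<sigma> * snd U \<ge> 0"
    using W by (auto simp: \<sigma>_def divide_simps)
  obtain u a where ua: "\<sigma> *\<^sub>R U = (u, a)" by fastforce
  have u: "u = \<sigma> *\<^sub>R fst U" and a: "a = \<sigma> * snd U" using ua by (metis fst_conv fst_scaleR, metis snd_conv snd_scaleR real_scaleR_def)
  have in_E: "(u, a) \<in> E" unfolding ua[symmetric] using E(1) U(1) by (rule subspace_scale)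
  have "W (x, s) (u, a) (u, a) = 1"
    unfolding ua[symmetric] using \<sigma>(2) by (simp add: W.G_lin xs mult.assoc)
  moreover have "(u, a) \<noteq> 0" unfolding ua[symmetric] using \<sigma>(1) U(2) by simp
  then have "dim (span {(u, a), J (x, s) (u, a)}) = 2" by (rule dim_J_plane[OF xs])
  then have "span {(u, a), J (x, s) (u, a)} = E"
    using E in_E by (intro subspace_dim_equal subspace_span span_minimal) auto
  moreover have "\<eta> x u = 0" "a \<ge> 0" using U(3) \<sigma>(3) by (simp_all add: u a \<eta>_lin xs)
  ultimately show ?thesis using that by blast
qed

lemma sectional_curvature_J_plane:
  assumes xs: "x \<in> S" "s \<in> I" and u: "\<eta> x u = 0" and unit: "W (x, s) (u, a) (u, a) = 1"
    and E: "span {u', v'} = span {(u, a), J (x, s) (u, a)}"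
  shows "sectional_curvature W (x, s) u' v' = hol_curv s (G x (R x u (\<phi> x u) (\<phi> x u)) u) (G x u u) a"
proof -
  have y: "(x, s) \<in> S \<times> I" using xs by simp
  have "(u, a) \<noteq> 0" using unit W.G_lin(9)[OF y, of 0] by auto
  then have "dim (span {u', v'}) = 2" unfolding E by (rule dim_J_plane[OF xs])
  then have "sectional_curvature W (x, s) u' v'
      = curvature4 W (x, s) (u, a) (J (x, s) (u, a)) (J (x, s) (u, a)) (u, a)"
    by (intro W.sectional_curvature_orthonormal y E) (simp_all add: W_J W_J_J xs unit)
  then show ?thesis by (simp add: curvature_holomorphic xs u)
qed

definition D :: "'e \<times> real \<Rightarrow> ('e \<times> real) set" where
  "D y = {U. snd U = 0 \<and> \<eta> (fst y) (fst U) = 0}"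

text \<open>Pairing a vector of the complement with its own projection to D yields h times the
  squared length of \<phi> v, which forces v to be a multiple of \<xi>.\<close>

lemma orth_complement_D:
  assumes "x \<in> S" "s \<in> I"
  shows "orth_complement W (x, s) (D (x, s)) = {(e *\<^sub>R \<xi> x, b) | e (b::real). True}"
proof (intro set_eqI iffI)
  fix V assume V: "V \<in> orth_complement W (x, s) (D (x, s))"
  obtain v b where [simp]: "V = (v, b)" by fastforce
  have "(v - \<eta> x v *\<^sub>R \<xi> x, 0) \<in> D (x, s)" by (simp add: D_def \<eta>_lin \<eta>_\<xi> assms)
  with V have "W (x, s) (v, b) (v - \<eta> x v *\<^sub>R \<xi> x, 0) = 0"
    by (auto simp: orth_complement_def)
  then have "h s * G x (\<phi> x v) (\<phi> x v) = 0"
    by (simp add: W_pair G_lin \<eta>_lin \<eta>_\<xi> G_\<xi> G_\<phi>_\<phi> assms)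
  then have "\<phi> x v = 0" using h_pos[OF assms(2)] by (simp add: G_eq_0_iff assms)
  from \<phi>_eq_0[OF assms(1) this] show "V \<in> {(e *\<^sub>R \<xi> x, b) | e (b::real). True}" by auto
next
  fix V assume "V \<in> {(e *\<^sub>R \<xi> x, b) | e (b::real). True}"
  then show "V \<in> orth_complement W (x, s) (D (x, s))"
    by (auto simp: orth_complement_def D_def W_pair G_lin \<eta>_lin G_\<xi> assms)
qed

lemma W_plane:
  assumes xs: "x \<in> S" "s \<in> I" and unit: "W (x, s) U U = 1"
  shows "W (x, s) (\<beta> *\<^sub>R U + \<gamma> *\<^sub>R J (x, s) U) (\<beta> *\<^sub>R U + \<gamma> *\<^sub>R J (x, s) U) = \<beta>\<^sup>2 + \<gamma>\<^sup>2"
  using unit by (simp add: W.G_lin xs W_J W_J_J power2_eq_square)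

text \<open>In the orthonormal frame \<xi> / m, d/ds of the complement of D the vector has
  coordinates m e and b. The projection of the plane to the complement sends U and J U to a times
  this frame in the opposite order, so it is a times an isometry.\<close>

lemma W_vertical:
  assumes xs: "x \<in> S" "s \<in> I" and u: "\<eta> x u = 0"
  shows "W (x, s) (\<beta> *\<^sub>R (u, a) + \<gamma> *\<^sub>R J (x, s) (u, a)) (e *\<^sub>R \<xi> x, b) = a * (\<gamma> * (m s * e) + \<beta> * b)"
    and "W (x, s) (e *\<^sub>R \<xi> x, b) (e *\<^sub>R \<xi> x, b) = (m s * e)\<^sup>2 + b\<^sup>2"
proof -
  have "W (x, s) (\<beta> *\<^sub>R (u, a) + \<gamma> *\<^sub>R J (x, s) (u, a)) (e *\<^sub>R \<xi> x, b)
      = h s * (1 + f s) * (\<gamma> * (a * inverse (m s)) * e) + \<beta> * a * b"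
    by (simp add: J_pair W_pair u \<eta>_lin G_lin G_\<xi> \<eta>_\<xi> \<eta>_\<phi> xs algebra_simps)
  also have "\<dots> = a * (\<gamma> * (m s * e) + \<beta> * b)"
    using m_nonzero[OF xs(2)] unfolding hf[OF xs(2)] by (simp add: power2_eq_square field_simps)
  finally show "W (x, s) (\<beta> *\<^sub>R (u, a) + \<gamma> *\<^sub>R J (x, s) (u, a)) (e *\<^sub>R \<xi> x, b) = a * (\<gamma> * (m s * e) + \<beta> * b)" .
  show "W (x, s) (e *\<^sub>R \<xi> x, b) (e *\<^sub>R \<xi> x, b) = (m s * e)\<^sup>2 + b\<^sup>2"
    by (simp add: W_same \<phi>_lin \<phi>_\<xi> \<eta>_lin \<eta>_\<xi> G_lin xs)
qed

text \<open>By the Cauchy-Schwarz inequality the cosine of every competing angle is at most a, and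
  the pair (u, a), d/ds attains this value.\<close>

lemma subspace_angle_J_plane:
  assumes xs: "x \<in> S" "s \<in> I" and u: "\<eta> x u = 0" and a: "a \<ge> 0" and unit: "W (x, s) (u, a) (u, a) = 1"
  shows "subspace_angle W (x, s) (span {(u, a), J (x, s) (u, a)}) (orth_complement W (x, s) (D (x, s))) = arccos a"
proof -
  let ?U = "(u, a)" and ?JU = "J (x, s) (u, a)"
  have "h s * G x u u \<ge> 0" using h_pos[OF xs(2)] G_nonneg[OF xs(1)] by simp
  then have "a\<^sup>2 \<le> 1" using unit by (simp add: W_horizontal u)
  then have a1: "a \<le> 1" using power2_le_imp_le[of a 1] by simp
  have mem: "?U \<in> span {?U, ?JU} - {0}" "(0, 1) \<in> orth_complement W (x, s) (D (x, s)) - {0}"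
  proof -
    show "?U \<in> span {?U, ?JU} - {0}"
      using unit W.G_lin(9)[of "(x, s)" 0] xs by (auto simp: span_base)
    have "(0::'e, 1::real) = (0 *\<^sub>R \<xi> x, 1)" by simp
    then show "(0, 1) \<in> orth_complement W (x, s) (D (x, s)) - {0}"
      unfolding orth_complement_D[OF xs] by (auto simp: zero_prod_def)
  qed
  have angle: "vec_angle W (x, s) ?U (0, 1) = arccos a"
    using unit by (simp add: vec_angle_def W_pair \<eta>_lin G_lin xs)
  have "arccos a \<le> vec_angle W (x, s) U' V"
    if U': "U' \<in> span {?U, ?JU} - {0}" and V: "V \<in> orth_complement W (x, s) (D (x, s)) - {0}" for U' V
  proof -
    obtain \<beta> \<gamma> where U'_eq: "U' = \<beta> *\<^sub>R ?U + \<gamma> *\<^sub>R ?JU"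
      using U' unfolding span_insert[of ?U] span_singleton
      by (auto simp: algebra_simps simp del: scaleR_Pair)
    obtain e b where V_eq: "V = (e *\<^sub>R \<xi> x, b)" using V orth_complement_D[OF xs] by auto
    \<comment> \<open>The squared lengths of U' and V, and the factor of a in their product.
      Lagrange's identity A B - X^2 = (\<gamma> b - \<beta> m e)^2 gives the Cauchy-Schwarz
      bound.\<close>
    define A B X where "A = \<beta>\<^sup>2 + \<gamma>\<^sup>2" and "B = (m s * e)\<^sup>2 + b\<^sup>2" and "X = \<gamma> * (m s * e) + \<beta> * b"
    have WU: "W (x, s) U' U' = A" and WV: "W (x, s) V V = B" and WUV: "W (x, s) U' V = a * X"
      unfolding U'_eq V_eq A_def B_def X_def
      by (rule W_plane[OF xs unit] W_vertical[OF xs u])+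
    have pos: "A > 0" "B > 0"
      using W.G_pos[of "(x, s)" U'] W.G_pos[of "(x, s)" V] U' V xs by (auto simp: WU WV)
    have "X\<^sup>2 \<le> A * B"
      using sum_squares_ge_zero[of "\<gamma> * b - \<beta> * (m s * e)" 0]
      by (simp add: A_def B_def X_def power2_eq_square algebra_simps)
    then have "\<bar>X\<bar> \<le> sqrt A * sqrt B"
      by (metis real_sqrt_abs real_sqrt_le_mono real_sqrt_mult)
    then have "\<bar>X / (sqrt A * sqrt B)\<bar> \<le> 1" using pos by (simp add: divide_le_eq_1)
    then have X: "- 1 \<le> X / (sqrt A * sqrt B)" "X / (sqrt A * sqrt B) \<le> 1" by linarith+
    have eq: "W (x, s) U' V / (sqrt (W (x, s) U' U') * sqrt (W (x, s) V V)) = a * (X / (sqrt A * sqrt B))"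
      by (simp add: WU WV WUV)
    have up: "a * (X / (sqrt A * sqrt B)) \<le> a" using X(2) a by (rule mult_left_le)
    \<comment> \<open>With a \<le> 1 this keeps the quotient in [-1, 1], where arccos is
      decreasing.\<close>
    have lo: "- a \<le> a * (X / (sqrt A * sqrt B))" using mult_left_mono[OF X(1) a] by simp
    then show ?thesis
      unfolding vec_angle_def eq using up lo a1 by (intro arccos_le_arccos) auto
  qed
  note min = this
  show ?thesis
    unfolding subspace_angle_def
  proof (rule cInf_eq_minimum)
    show "arccos a \<in> {vec_angle W (x, s) u w |u w. u \<in> span {?U, ?JU} - {0}
        \<and> w \<in> orth_complement W (x, s) (D (x, s)) - {0}}"
      unfolding mem_Collect_eq using mem angle[symmetric] by blast
  qed (use min in blast)
qed

end

section \<open>Products of manifolds with an interval\<close>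

lemma second_countable_prod_topology:
  assumes "second_countable X" "second_countable Y"
  shows "second_countable (prod_topology X Y)"
proof -
  obtain \<B> where B: "countable \<B>" "\<And>V. V \<in> \<B> \<Longrightarrow> openin X V"
      "\<And>U x. openin X U \<Longrightarrow> x \<in> U \<Longrightarrow> \<exists>V\<in>\<B>. x \<in> V \<and> V \<subseteq> U"
    using assms(1) unfolding second_countable_def by meson
  obtain \<C> where C: "countable \<C>" "\<And>V. V \<in> \<C> \<Longrightarrow> openin Y V"
      "\<And>U x. openin Y U \<Longrightarrow> x \<in> U \<Longrightarrow> \<exists>V\<in>\<C>. x \<in> V \<and> V \<subseteq> U"
    using assms(2) unfolding second_countable_def by meson
  show ?thesis
    unfolding second_countable_def
  proof (intro exI conjI ballI allI impI)
    show "countable ((\<lambda>(U, V). U \<times> V) ` (\<B> \<times> \<C>))" using B(1) C(1) by blast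
  next
    fix Z assume "Z \<in> (\<lambda>(U, V). U \<times> V) ` (\<B> \<times> \<C>)"
    then show "openin (prod_topology X Y) Z"
      using B(2) C(2) by (auto simp: openin_prod_Times_iff)
  next
    fix Z z assume "openin (prod_topology X Y) Z \<and> z \<in> Z"
    then obtain U V where UV: "openin X U" "openin Y V" "fst z \<in> U" "snd z \<in> V" "U \<times> V \<subseteq> Z"
      unfolding openin_prod_topology_alt by (metis prod.collapse)
    obtain U' where "U' \<in> \<B>" "fst z \<in> U'" "U' \<subseteq> U" using B(3) UV(1,3) by blast
    moreover obtain V' where "V' \<in> \<C>" "snd z \<in> V'" "V' \<subseteq> V" using C(3) UV(2,4) by blast
    ultimately show "\<exists>W\<in>(\<lambda>(U, V). U \<times> V) ` (\<B> \<times> \<C>). z \<in> W \<and> W \<subseteq> Z"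
      using UV(5) by (intro bexI[of _ "U' \<times> V'"]) (auto simp: mem_Times_iff)
  qed
qed

lemma second_countable_euclidean: "second_countable (euclidean :: 'a::second_countable_topology topology)"
  unfolding second_countable_def
proof -
  obtain \<B> :: "'a set set" where \<B>: "countable \<B>" "\<And>C. C \<in> \<B> \<Longrightarrow> open C"
      "\<And>S. open S \<Longrightarrow> \<exists>U. U \<subseteq> \<B> \<and> S = \<Union>U"
    using univ_second_countable by blast
  then have "\<exists>V\<in>\<B>. x \<in> V \<and> V \<subseteq> U" if "open U" "x \<in> U" for U x
    using \<B>(3)[OF that(1)] that(2) by blast
  with \<B>(1,2) show "\<exists>\<B>. countable \<B> \<and> (\<forall>V\<in>\<B>. openin euclidean V) \<and>
      (\<forall>U (x::'a). openin euclidean U \<and> x \<in> U \<longrightarrow> (\<exists>V\<in>\<B>. x \<in> V \<and> V \<subseteq> U))"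
    by (intro exI[of _ \<B>]) auto
qed

lemma homeomorphic_map_prod:
  assumes "homeomorphic_map X X' f" "homeomorphic_map Y Y' g"
  shows "homeomorphic_map (prod_topology X Y) (prod_topology X' Y') (\<lambda>(x, y). (f x, g y))"
proof -
  obtain f' g' where "homeomorphic_maps X X' f f'" "homeomorphic_maps Y Y' g g'"
    using assms unfolding homeomorphic_map_maps by blast
  then show ?thesis
    unfolding homeomorphic_map_maps using homeomorphic_maps_prod by blast
qed

locale manifold_interval =
  fixes Q :: "('a, 'i, 'e::euclidean_space) manifold" and I :: "real set"
  assumes Q: "smooth_manifold Q" and open_I': "open I"
begin

abbreviation "N \<equiv> warped_manifold Q I"

lemma charts_N: "charts N = charts Q" and cdom_N: "cdom N i = cdom Q i \<times> I"
  and coord_N: "coord N i = (\<lambda>(q, s). (coord Q i q, s))"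
  and mtop_N: "mtop N = prod_topology (mtop Q) (top_of_set I)"
  by (simp_all add: warped_manifold_def)

lemma cimg_N: "cimg N i = cimg Q i \<times> I"
  by (auto simp: cimg_def cdom_N coord_N image_iff)

lemma overlap_N: "overlap N i j = overlap Q i j \<times> I"
proof -
  have "cdom N i \<inter> cdom N j = (cdom Q i \<inter> cdom Q j) \<times> I" by (auto simp: cdom_N)
  then show ?thesis by (auto simp: overlap_def coord_N image_iff)
qed

context
  fixes i assumes i: "i \<in> charts Q"
begin

lemma chart: "openin (mtop Q) (cdom Q i)" "open (cimg Q i)"
    "homeomorphic_map (subtopology (mtop Q) (cdom Q i)) (top_of_set (cimg Q i)) (coord Q i)"
  using Q i by (auto simp: smooth_manifold_def)

lemma topspace_chart: "topspace (subtopology (mtop Q) (cdom Q i)) = cdom Q i"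
  using openin_subset[OF chart(1)] by auto

lemma coord_inj: "inj_on (coord Q i) (cdom Q i)"
  using chart(3) topspace_chart unfolding homeomorphic_map_def quotient_map_def by auto

lemma coord_inv: "x \<in> cimg Q i \<Longrightarrow> coord Q i (inv_into (cdom Q i) (coord Q i) x) = x"
    "x \<in> cimg Q i \<Longrightarrow> inv_into (cdom Q i) (coord Q i) x \<in> cdom Q i"
    "q \<in> cdom Q i \<Longrightarrow> inv_into (cdom Q i) (coord Q i) (coord Q i q) = q"
  unfolding cimg_def by (auto intro: f_inv_into_f inv_into_into inv_into_f_f coord_inj)

lemma openin_preimage:
  assumes "open B" shows "openin (mtop Q) {q \<in> cdom Q i. coord Q i q \<in> B}"
proof -
  have "continuous_map (subtopology (mtop Q) (cdom Q i)) euclidean (coord Q i)"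
    using homeomorphic_imp_continuous_map[OF chart(3)] continuous_map_in_subtopology by blast
  from openin_continuous_map_preimage[OF this, of B] assms
  have "openin (subtopology (mtop Q) (cdom Q i)) {q \<in> cdom Q i. coord Q i q \<in> B}"
    unfolding topspace_chart by simp
  then show ?thesis using openin_trans_full chart(1) by blast
qed

lemma coord_in_cimg: "q \<in> cdom Q i \<Longrightarrow> coord Q i q \<in> cimg Q i"
  by (simp add: cimg_def)

end

lemma overlap_subset: "overlap Q i j \<subseteq> cimg Q i"
  by (auto simp: overlap_def cimg_def)

lemma open_overlap:
  assumes "i \<in> charts Q" "j \<in> charts Q" shows "open (overlap Q i j)"
proof -
  have "openin (subtopology (mtop Q) (cdom Q i)) (cdom Q i \<inter> cdom Q j)"
    using chart(1)[OF assms(2)] openin_subtopology_Int2 by metis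
  then have "openin (top_of_set (cimg Q i)) (overlap Q i j)"
    using homeomorphic_imp_open_map[OF chart(3)[OF assms(1)]]
    by (auto simp: open_map_def overlap_def)
  then show ?thesis using chart(2)[OF assms(1)] openin_open_trans by blast
qed

lemma transition_in_cimg:
  assumes "i \<in> charts Q" "x \<in> overlap Q i j" shows "transition Q i j x \<in> cimg Q j"
  using assms(2) coord_inv(3)[OF assms(1)] by (auto simp: overlap_def transition_def cimg_def)

lemma transition_smooth:
  "i \<in> charts Q \<Longrightarrow> j \<in> charts Q \<Longrightarrow> smooth_on (transition Q i j) (overlap Q i j)"
  using Q by (auto simp: smooth_manifold_def)

lemma transition_N:
  assumes i: "i \<in> charts Q" and x: "x \<in> cimg Q i" "s \<in> I"
  shows "transition N i j (x, s) = (transition Q i j x, s)"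
proof -
  have "inj_on (coord N i) (cdom N i)"
    using coord_inj[OF i] by (auto simp: inj_on_def coord_N cdom_N)
  moreover have "(x, s) = coord N i (inv_into (cdom Q i) (coord Q i) x, s)"
    using coord_inv[OF i] x by (simp add: coord_N)
  moreover have "(inv_into (cdom Q i) (coord Q i) x, s) \<in> cdom N i"
    using coord_inv[OF i] x by (simp add: cdom_N)
  ultimately have "inv_into (cdom N i) (coord N i) (x, s) = (inv_into (cdom Q i) (coord Q i) x, s)"
    by (metis inv_into_f_f)
  then show ?thesis by (simp add: transition_def coord_N)
qed

lemma jacobian_has_derivative:
  assumes "i \<in> charts Q" "j \<in> charts Q" "x \<in> overlap Q i j"
  shows "(transition Q i j has_derivative jacobian Q i j x) (at x)"
  using smooth_on_has_derivative[OF transition_smooth[OF assms(1,2)] assms(3)] by (simp add: jacobian_def)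

lemma jacobian_linear:
  "i \<in> charts Q \<Longrightarrow> j \<in> charts Q \<Longrightarrow> x \<in> overlap Q i j \<Longrightarrow> linear (jacobian Q i j x)"
  using has_derivative_linear[OF jacobian_has_derivative] .

lemma jacobian_N:
  assumes "i \<in> charts Q" "j \<in> charts Q" "x \<in> overlap Q i j" "s \<in> I"
  shows "jacobian N i j (x, s) U = (jacobian Q i j x (fst U), snd U)"
proof -
  have "((\<lambda>y. (transition Q i j (fst y), snd y)) has_derivative (\<lambda>U. (jacobian Q i j x (fst U), snd U))) (at (x, s))"
    by (intro has_derivative_Pair has_derivative_comp_fst jacobian_has_derivative assms
        has_derivative_snd has_derivative_ident)
  then have "(transition N i j has_derivative (\<lambda>U. (jacobian Q i j x (fst U), snd U))) (at (x, s))"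
    by (rule has_derivative_transform_within_open[OF _ open_Times[OF open_overlap[OF assms(1,2)] open_I']])
      (use assms overlap_subset[of i j] in \<open>auto simp: transition_N subset_iff\<close>)
  from dd_eq[OF this, of U] show ?thesis by (simp add: jacobian_def)
qed

lemma smooth_manifold_N: "smooth_manifold N"
  unfolding smooth_manifold_def
proof (intro conjI ballI)
  have "Hausdorff_space (top_of_set I)"
    by (simp add: Hausdorff_space_subtopology)
  then show "Hausdorff_space (mtop N)"
    using Q by (simp add: mtop_N Hausdorff_space_prod_topology smooth_manifold_def)
  show "second_countable (mtop N)"
    unfolding mtop_N using Q
    by (intro second_countable_prod_topology second_countable_subtopology second_countable_euclidean)
      (simp add: smooth_manifold_def)
  show "topspace (mtop N) = (\<Union>i\<in>charts N. cdom N i)"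
    using Q by (auto simp: mtop_N charts_N cdom_N smooth_manifold_def)
next
  fix i assume "i \<in> charts N"
  then have i: "i \<in> charts Q" by (simp add: charts_N)
  show "openin (mtop N) (cdom N i)"
    using chart(1)[OF i] by (simp add: mtop_N cdom_N openin_prod_Times_iff)
  show "open (cimg N i)"
    using chart(2)[OF i] open_I' by (simp add: cimg_N open_Times)
  have "homeomorphic_map (top_of_set I) (top_of_set I) (\<lambda>s. s)"
    using homeomorphic_map_id[of "top_of_set I" "top_of_set I"] by (simp add: id_def)
  from homeomorphic_map_prod[OF chart(3)[OF i] this]
  show "homeomorphic_map (subtopology (mtop N) (cdom N i)) (top_of_set (cimg N i)) (coord N i)"
    by (simp add: mtop_N cdom_N coord_N cimg_N subtopology_Times subtopology_subtopology)
  fix j assume "j \<in> charts N"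
  then have j: "j \<in> charts Q" by (simp add: charts_N)
  have op: "open (overlap Q i j \<times> I)" by (intro open_Times open_overlap i j open_I')
  have "smooth_on (\<lambda>y. (transition Q i j (fst y), snd y)) (overlap Q i j \<times> I)"
    by (intro smooth_on_Pair op smooth_on_compose_linear[OF open_overlap[OF i j] op bounded_linear_fst]
        transition_smooth i j smooth_on_linear[OF op bounded_linear_snd smooth_on_ident]) auto
  then show "smooth_on (transition N i j) (overlap N i j)"
    unfolding overlap_N
    by (rule smooth_on_cong[OF op, THEN iffD1, rotated])
      (use i overlap_subset[of i j] in \<open>auto simp: transition_N subset_iff\<close>)
qed

text \<open>A vanishing derivative on coordinate balls makes H constant near every point, so each
  level set and its complement are open.\<close>

lemma locally_constant_imp_constant:
  assumes "connected_space (mtop Q)"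
    and "\<And>i x. i \<in> charts Q \<Longrightarrow> x \<in> cimg Q i \<Longrightarrow>
      ((\<lambda>x. H (inv_into (cdom Q i) (coord Q i) x)) has_derivative (\<lambda>h. 0)) (at x)"
  shows "\<exists>c::real. \<forall>q\<in>topspace (mtop Q). H q = c"
proof -
  have top: "topspace (mtop Q) = (\<Union>i\<in>charts Q. cdom Q i)"
    using Q by (simp add: smooth_manifold_def)
  have loc: "\<exists>U. openin (mtop Q) U \<and> q0 \<in> U \<and> (\<forall>q\<in>U. H q = H q0)" if q0: "q0 \<in> topspace (mtop Q)" for q0
  proof -
    obtain i where i: "i \<in> charts Q" "q0 \<in> cdom Q i" using q0 top by auto
    let ?x0 = "coord Q i q0"
    obtain r where r: "r > 0" "ball ?x0 r \<subseteq> cimg Q i"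
      using chart(2)[OF i(1)] coord_in_cimg[OF i] openE by blast
    have "\<exists>c. \<forall>x\<in>ball ?x0 r. H (inv_into (cdom Q i) (coord Q i) x) = c"
    proof (rule has_derivative_zero_constant[OF convex_ball])
      fix x assume "x \<in> ball ?x0 r"
      with r(2) have "x \<in> cimg Q i" by blast
      from has_derivative_at_withinI[OF assms(2)[OF i(1) this]]
      show "((\<lambda>x. H (inv_into (cdom Q i) (coord Q i) x)) has_derivative (\<lambda>h. 0)) (at x within ball ?x0 r)" .
    qed
    then obtain c where c: "\<And>x. x \<in> ball ?x0 r \<Longrightarrow> H (inv_into (cdom Q i) (coord Q i) x) = c" by blast
    have "H q = c" if "q \<in> cdom Q i" "coord Q i q \<in> ball ?x0 r" for q
      using c[OF that(2)] coord_inv(3)[OF i(1) that(1)] by simp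
    then show ?thesis
      using openin_preimage[OF i(1) open_ball[of ?x0 r]] i r(1)
      by (intro exI[of _ "{q \<in> cdom Q i. coord Q i q \<in> ball ?x0 r}"]) auto
  qed
  have op: "openin (mtop Q) {q \<in> topspace (mtop Q). P (H q)}" for P
    unfolding openin_subopen[of "mtop Q" "{q \<in> topspace (mtop Q). P (H q)}"]
  proof
    fix q0 assume q0: "q0 \<in> {q \<in> topspace (mtop Q). P (H q)}"
    then obtain U where U: "openin (mtop Q) U" "q0 \<in> U" "\<forall>q\<in>U. H q = H q0" using loc by blast
    have "U \<subseteq> {q \<in> topspace (mtop Q). P (H q)}"
    proof
      fix q assume "q \<in> U"
      then have "H q = H q0" "q \<in> topspace (mtop Q)" using U(3) openin_subset[OF U(1)] by blast+
      with q0 show "q \<in> {q \<in> topspace (mtop Q). P (H q)}" by simp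
    qed
    with U show "\<exists>T. openin (mtop Q) T \<and> q0 \<in> T \<and> T \<subseteq> {q \<in> topspace (mtop Q). P (H q)}" by blast
  qed
  show ?thesis
  proof (cases "topspace (mtop Q) = {}")
    case False
    then obtain q0 where q0: "q0 \<in> topspace (mtop Q)" by blast
    have "{q \<in> topspace (mtop Q). H q \<noteq> H q0} = {}"
    proof (rule ccontr)
      assume "{q \<in> topspace (mtop Q). H q \<noteq> H q0} \<noteq> {}"
      moreover have "topspace (mtop Q) \<subseteq> {q \<in> topspace (mtop Q). H q = H q0} \<union> {q \<in> topspace (mtop Q). H q \<noteq> H q0}"
          "{q \<in> topspace (mtop Q). H q = H q0} \<inter> {q \<in> topspace (mtop Q). H q \<noteq> H q0} = {}"
        by auto
      moreover have "{q \<in> topspace (mtop Q). H q = H q0} \<noteq> {}" using q0 by auto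
      ultimately show False
        using assms(1) op[of "\<lambda>h. h = H q0"] op[of "\<lambda>h. h \<noteq> H q0"] unfolding connected_space_def by blast
    qed
    then show ?thesis by blast
  qed simp
qed

end

section \<open>The warped product\<close>

lemma alpha_sasakian_chart:
  assumes "alpha_sasakian \<alpha> Q g \<phi> \<xi>0 \<eta>" "i \<in> charts Q"
  shows "sasakian_chart (cimg Q i) (g i) (\<phi> i) (\<xi>0 i) (\<eta> i) \<alpha>"
proof (intro sasakian_chart.intro sasakian_chart_axioms.intro metric_chart.intro)
  have ac: "almost_contact_riemannian Q g \<phi> \<xi>0 \<eta>" and \<alpha>: "\<alpha> > 0"
    using assms(1) by (auto simp: alpha_sasakian_def)
  have Q: "smooth_manifold Q" "riemannian_metric Q g" "endo_field Q \<phi>" "vector_field Q \<xi>0"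
    using ac by (auto simp: almost_contact_riemannian_def riemannian_manifold_def)
  show "open (cimg Q i)" using Q(1) assms(2) by (simp add: smooth_manifold_def)
  show "\<alpha> > 0" by (fact \<alpha>)
  show "smooth_on (\<lambda>x. g i x u v) (cimg Q i)" for u v using Q(2) assms(2) by (simp add: riemannian_metric_def)
  show "smooth_on (\<lambda>x. \<phi> i x v) (cimg Q i)" for v using Q(3) assms(2) by (simp add: endo_field_def)
  show "smooth_on (\<xi>0 i) (cimg Q i)" using Q(4) assms(2) by (simp add: vector_field_def)
  fix x assume x: "x \<in> cimg Q i"
  show "bilinear (g i x)" using Q(2) assms(2) x by (simp add: riemannian_metric_def)
  show "g i x u v = g i x v u" for u v using Q(2) assms(2) x unfolding riemannian_metric_def by blast
  show "0 < g i x u u" if "u \<noteq> 0" for u using Q(2) assms(2) x that unfolding riemannian_metric_def by blast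
  show "linear (\<phi> i x)" using Q(3) assms(2) x by (simp add: endo_field_def)
  show "\<eta> i x u = g i x (\<xi>0 i x) u" for u using ac assms(2) x by (simp add: almost_contact_riemannian_def)
  show "g i x (\<xi>0 i x) (\<xi>0 i x) = 1" using ac assms(2) x by (simp add: almost_contact_riemannian_def)
  show "\<phi> i x (\<xi>0 i x) = 0" using ac assms(2) x by (simp add: almost_contact_riemannian_def)
  show "\<phi> i x (\<phi> i x u) = - u + \<eta> i x u *\<^sub>R \<xi>0 i x" for u
    using ac assms(2) x unfolding almost_contact_riemannian_def by blast
  show "g i x (\<phi> i x u) (\<phi> i x v) = g i x u v - \<eta> i x u * \<eta> i x v" for u v
    using ac assms(2) x unfolding almost_contact_riemannian_def by blast
  show "cov_deriv (g i) (\<xi>0 i) x u = \<alpha> *\<^sub>R \<phi> i x u" for u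
    using assms x unfolding alpha_sasakian_def by blast
  show "cov_deriv_endo (g i) (\<phi> i) x u v = \<alpha> *\<^sub>R (\<eta> i x v *\<^sub>R u - g i x u v *\<^sub>R \<xi>0 i x)" for u v
    using assms x unfolding alpha_sasakian_def by blast
qed

locale warped_product =
  fixes Q :: "('a, 'i, 'e::euclidean_space) manifold"
    and g :: "('i, 'e) metric" and \<phi> :: "('i, 'e) endo"
    and \<xi>0 :: "('i, 'e) vec_field" and \<eta> :: "('i, 'e) one_form"
    and \<alpha> :: real and I :: "real set" and p :: "real \<Rightarrow> real"
  assumes sasakian: "alpha_sasakian \<alpha> Q g \<phi> \<xi>0 \<eta>"
    and warping: "warping_function \<alpha> I p"
begin

lemma base: "smooth_manifold Q" "riemannian_metric Q g" "endo_field Q \<phi>" "vector_field Q \<xi>0"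
  using sasakian by (auto simp: alpha_sasakian_def almost_contact_riemannian_def riemannian_manifold_def)

sublocale manifold_interval Q I
  using base(1) warping by unfold_locales (auto simp: warping_function_def)

lemma chart_locale:
  "i \<in> charts Q \<Longrightarrow> warped_chart (cimg Q i) (g i) (\<phi> i) (\<xi>0 i) (\<eta> i) \<alpha> I p"
  using alpha_sasakian_chart[OF sasakian] warping by (simp add: warped_chart_def warped_chart_axioms_def)

abbreviation "gN \<equiv> warped_metric \<alpha> p g \<eta>"
abbreviation "JN \<equiv> warped_J \<alpha> p \<phi> \<xi>0 \<eta>"
abbreviation "DN \<equiv> (warped_D \<eta> :: ('i, 'e \<times> real) distribution)"

text \<open>The global fields match on pairs while the chart locale works with projections. Once
  identified, every global claim reduces to chart results.\<close>

lemma local_eq: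
  assumes "i \<in> charts Q"
  shows "gN i = warped_chart.W (g i) (\<eta> i) \<alpha> p" "JN i = warped_chart.J (\<phi> i) (\<xi>0 i) (\<eta> i) \<alpha> p"
    "DN i = warped_chart.D (\<eta> i)"
proof -
  interpret C: warped_chart "cimg Q i" "g i" "\<phi> i" "\<xi>0 i" "\<eta> i" \<alpha> I p by (rule chart_locale[OF assms])
  show "gN i = C.W"
    by (simp add: fun_eq_iff C.W_def warped_metric_def C.h_def C.f_def)
  show "JN i = C.J"
    by (simp add: fun_eq_iff C.J_def warped_J_def C.m_def warped_xi_def warped_xi_tilde_def)
  show "DN i = C.D"
    by (auto simp: fun_eq_iff C.D_def warped_D_def)
qed

lemma g_transition:
  assumes "i \<in> charts Q" "j \<in> charts Q" "x \<in> overlap Q i j"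
  shows "g j (transition Q i j x) (jacobian Q i j x u) (jacobian Q i j x v) = g i x u v"
  using base(2) assms by (simp add: riemannian_metric_def)

lemma \<xi>_transition:
  assumes "i \<in> charts Q" "j \<in> charts Q" "x \<in> overlap Q i j"
  shows "\<xi>0 j (transition Q i j x) = jacobian Q i j x (\<xi>0 i x)"
  using base(4) assms by (simp add: vector_field_def)

lemma \<phi>_transition:
  assumes "i \<in> charts Q" "j \<in> charts Q" "x \<in> overlap Q i j"
  shows "\<phi> j (transition Q i j x) (jacobian Q i j x v) = jacobian Q i j x (\<phi> i x v)"
  using base(3) assms by (simp add: endo_field_def)

lemma \<eta>_transition:
  assumes "i \<in> charts Q" "j \<in> charts Q" "x \<in> overlap Q i j"
  shows "\<eta> j (transition Q i j x) (jacobian Q i j x u) = \<eta> i x u"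
proof -
  have "transition Q i j x \<in> cimg Q j" "x \<in> cimg Q i"
    using transition_in_cimg assms overlap_subset by blast+
  moreover have "\<eta> k y u = g k y (\<xi>0 k y) u" if "k \<in> charts Q" "y \<in> cimg Q k" for k y u
    using sasakian_chart.\<eta>_eq[OF alpha_sasakian_chart[OF sasakian that(1)] that(2)] .
  ultimately show ?thesis using assms by (simp add: \<xi>_transition g_transition)
qed

text \<open>Transition maps preserve g, so their Jacobians are injective, hence surjective by
  dimension.\<close>

lemma jacobian_surj:
  assumes "i \<in> charts Q" "j \<in> charts Q" "x \<in> overlap Q i j"
  shows "surj (jacobian Q i j x)"
proof -
  have "inj (jacobian Q i j x)"
    unfolding linear_injective_0[OF jacobian_linear[OF assms]]
  proof (intro allI impI)
    fix u assume "jacobian Q i j x u = 0"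
    moreover interpret Ci: warped_chart "cimg Q i" "g i" "\<phi> i" "\<xi>0 i" "\<eta> i" \<alpha> I p by (rule chart_locale[OF assms(1)])
    interpret Cj: warped_chart "cimg Q j" "g j" "\<phi> j" "\<xi>0 j" "\<eta> j" \<alpha> I p by (rule chart_locale[OF assms(2)])
    have "x \<in> cimg Q i" "transition Q i j x \<in> cimg Q j" using assms overlap_subset transition_in_cimg by blast+
    ultimately have "g i x u u = 0"
      using g_transition[OF assms, of u u] by (simp add: Cj.G_lin)
    then show "u = 0" using \<open>x \<in> cimg Q i\<close> by (simp add: Ci.G_eq_0_iff)
  qed
  then show ?thesis by (rule linear_injective_imp_surjective[OF jacobian_linear[OF assms]]) simp
qed

lemma riemannian_metric_N: "riemannian_metric N gN"
  unfolding riemannian_metric_def charts_N cimg_N overlap_N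
proof (intro ballI conjI allI impI)
  fix i assume i: "i \<in> charts Q"
  interpret C: warped_chart "cimg Q i" "g i" "\<phi> i" "\<xi>0 i" "\<eta> i" \<alpha> I p by (rule chart_locale[OF i])
  fix y assume y: "y \<in> cimg Q i \<times> I"
  show "bilinear (gN i y)" unfolding local_eq[OF i] using C.W.G_bilinear y by blast
  show "gN i y U V = gN i y V U" for U V unfolding local_eq[OF i] using C.W.G_sym y by blast
  show "gN i y U U > 0" if "U \<noteq> 0" for U unfolding local_eq[OF i] using C.W.G_pos y that by blast
next
  fix i U V assume i: "i \<in> charts Q"
  interpret C: warped_chart "cimg Q i" "g i" "\<phi> i" "\<xi>0 i" "\<eta> i" \<alpha> I p by (rule chart_locale[OF i])
  show "smooth_on (\<lambda>y. gN i y U V) (cimg Q i \<times> I)" unfolding local_eq[OF i] by (rule C.W.G_smooth)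
next
  fix i j y U V assume ij: "i \<in> charts Q" "j \<in> charts Q" and y: "y \<in> overlap Q i j \<times> I"
  obtain x s where [simp]: "y = (x, s)" and x: "x \<in> overlap Q i j" "s \<in> I" using y by auto
  have "x \<in> cimg Q i" using x overlap_subset by blast
  then show "gN i y U V = gN j (transition N i j y) (jacobian N i j y U) (jacobian N i j y V)"
    using ij x by (cases U; cases V)
      (simp add: transition_N jacobian_N warped_metric_def g_transition \<eta>_transition)
qed

lemma endo_field_N: "endo_field N JN"
  unfolding endo_field_def charts_N cimg_N overlap_N
proof (intro ballI conjI allI)
  fix i assume i: "i \<in> charts Q"
  interpret C: warped_chart "cimg Q i" "g i" "\<phi> i" "\<xi>0 i" "\<eta> i" \<alpha> I p by (rule chart_locale[OF i])
  show "linear (JN i y)" if "y \<in> cimg Q i \<times> I" for y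
    unfolding local_eq[OF i] using C.J_linear that by auto
  show "smooth_on (\<lambda>y. JN i y U) (cimg Q i \<times> I)" for U unfolding local_eq[OF i] by (rule C.J_smooth)
next
  fix i j y U assume ij: "i \<in> charts Q" "j \<in> charts Q" and y: "y \<in> overlap Q i j \<times> I"
  obtain x s where [simp]: "y = (x, s)" and x: "x \<in> overlap Q i j" "s \<in> I" using y by auto
  have "x \<in> cimg Q i" using x overlap_subset by blast
  then show "jacobian N i j y (JN i y U) = JN j (transition N i j y) (jacobian N i j y U)"
    using ij x by (cases U)
      (simp add: transition_N jacobian_N warped_J_def warped_xi_def warped_xi_tilde_def \<phi>_transition \<eta>_transition
        \<xi>_transition linear_add[OF jacobian_linear] linear_cmul[OF jacobian_linear])
qed

lemma kaehler_N: "kaehler_manifold N gN JN"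
  unfolding kaehler_manifold_def riemannian_manifold_def charts_N cimg_N
proof (intro conjI ballI allI smooth_manifold_N riemannian_metric_N endo_field_N)
  fix i y U V assume i: "i \<in> charts Q" and y: "y \<in> cimg Q i \<times> I"
  interpret C: warped_chart "cimg Q i" "g i" "\<phi> i" "\<xi>0 i" "\<eta> i" \<alpha> I p by (rule chart_locale[OF i])
  obtain x s where [simp]: "y = (x, s)" and x: "x \<in> cimg Q i" "s \<in> I" using y by auto
  show "JN i y (JN i y U) = - U" by (simp add: local_eq[OF i] C.J_J x)
  show "gN i y (JN i y U) (JN i y V) = gN i y U V" by (simp add: local_eq[OF i] C.W_J_J x)
  show "cov_deriv_endo (gN i) (JN i) y U V = 0" by (simp add: local_eq[OF i] C.J_parallel x)
qed

lemma smooth_distribution_N: "smooth_distribution N (DIM('e \<times> real) - 2) DN"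
  unfolding smooth_distribution_def charts_N cimg_N overlap_N
proof (intro ballI conjI)
  fix i y assume i: "i \<in> charts Q" and y: "y \<in> cimg Q i \<times> I"
  interpret C: warped_chart "cimg Q i" "g i" "\<phi> i" "\<xi>0 i" "\<eta> i" \<alpha> I p by (rule chart_locale[OF i])
  have sub: "subspace (DN i y)" if y: "y \<in> cimg Q i \<times> I" for y
    using y by (auto simp: subspace_def local_eq[OF i] C.D_def C.\<eta>_lin)
  show "subspace (DN i y)" by (rule sub[OF y])
  show "dim (DN i y) = DIM('e \<times> real) - 2"
  proof -
    obtain x s where [simp]: "y = (x, s)" and x: "x \<in> cimg Q i" using y by auto
    have "C.flat x (\<xi>0 i x) \<noteq> 0"
      using C.flat_inner[OF x, of "\<xi>0 i x" "\<xi>0 i x"] C.\<xi>_unit[OF x] by auto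
    moreover have "{u. \<eta> i x u = 0} = {u. C.flat x (\<xi>0 i x) \<bullet> u = 0}"
      by (simp add: C.flat_inner x C.G_\<xi>)
    ultimately have d: "dim {u. \<eta> i x u = 0} = DIM('e) - 1" by (simp add: dim_hyperplane)
    have lin: "linear (\<lambda>u::'e. (u, 0::real))" "inj (\<lambda>u::'e. (u, 0::real))"
      by (auto intro!: linearI injI)
    have "DN i y = (\<lambda>u. (u, 0)) ` {u. \<eta> i x u = 0}"
      by (auto simp: local_eq[OF i] C.D_def)
    then have "dim (DN i y) = dim {u. \<eta> i x u = 0}"
      using dim_image_eq[OF lin(1), of "{u. \<eta> i x u = 0}"] lin(2) inj_on_subset by simp blast
    then show ?thesis using d by simp
  qed
  show "\<exists>U. open U \<and> y \<in> U \<and> U \<subseteq> cimg Q i \<times> I \<and> (\<exists>F. finite F \<and> (\<forall>X\<in>F. smooth_on X U) \<and>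
             (\<forall>y\<in>U. DN i y = span ((\<lambda>X. X y) ` F)))"
  proof (intro exI conjI ballI)
    let ?U = "cimg Q i \<times> I"
    \<comment> \<open>Projections of the standard basis along \<xi> to the kernel of \<eta>. They
      are linearly dependent, but the definition asks for a smooth spanning family, not for a
      frame.\<close>
    let ?X = "\<lambda>b y. (b - \<eta> i (fst y) b *\<^sub>R \<xi>0 i (fst y), 0::real)"
    show "open ?U" by (rule C.open_SI)
    show "y \<in> ?U" by (rule y)
    show "finite (?X ` Basis)" by simp
    show "smooth_on X ?U" if X: "X \<in> ?X ` Basis" for X
    proof -
      obtain b where "X = ?X b" using X by auto
      then show ?thesis
        by (auto intro!: smooth_on_Pair smooth_on_diff smooth_on_scaleR C.open_SI smooth_on_const
            C.smooth_on_fst[OF C.\<eta>_smooth] C.smooth_on_fst[OF C.\<xi>_smooth])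
    qed
    fix z assume z: "z \<in> ?U"
    then have x: "fst z \<in> cimg Q i" by auto
    show "DN i z = span ((\<lambda>X. X z) ` (?X ` Basis))"
    proof
      have "?X b z \<in> DN i z" for b
        by (simp add: local_eq[OF i] C.D_def C.\<eta>_lin C.\<eta>_\<xi> x)
      then show "span ((\<lambda>X. X z) ` (?X ` Basis)) \<subseteq> DN i z"
        by (intro span_minimal sub[OF z]) auto
      show "DN i z \<subseteq> span ((\<lambda>X. X z) ` (?X ` Basis))"
      proof
        fix V assume "V \<in> DN i z"
        then obtain v where v: "V = (v, 0)" "\<eta> i (fst z) v = 0"
          by (cases V) (auto simp: local_eq[OF i] C.D_def)
        have lin: "linear (\<lambda>b. ?X b z)"
          by (rule linearI) (simp_all add: C.\<eta>_lin x algebra_simps)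
        have "V = ?X v z" using v by simp
        also have "\<dots> = (\<Sum>b\<in>Basis. (v \<bullet> b) *\<^sub>R ?X b z)"
          using linear_basis_expansion[OF lin] .
        also have "\<dots> \<in> span ((\<lambda>X. X z) ` (?X ` Basis))"
          by (intro span_sum span_scale span_base) auto
        finally show "V \<in> span ((\<lambda>X. X z) ` (?X ` Basis))" .
      qed
    qed
  qed auto
next
  fix i j y assume ij: "i \<in> charts Q" "j \<in> charts Q" and y: "y \<in> overlap Q i j \<times> I"
  obtain x s where [simp]: "y = (x, s)" and x: "x \<in> overlap Q i j" "s \<in> I" using y by auto
  have xi: "x \<in> cimg Q i" using x overlap_subset by blast
  have tr: "transition N i j y = (transition Q i j x, s)" "transition N i j (x, s) = (transition Q i j x, s)" using ij x xi by (simp_all add: transition_N)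
  show "jacobian N i j y ` DN i y = DN j (transition N i j y)"
  proof
    show "jacobian N i j y ` DN i y \<subseteq> DN j (transition N i j y)"
      using ij x by (auto simp: tr jacobian_N warped_D_def \<eta>_transition)
    show "DN j (transition N i j y) \<subseteq> jacobian N i j y ` DN i y"
    proof
      fix V assume "V \<in> DN j (transition N i j y)"
      then obtain v where v: "V = (v, 0)" "\<eta> j (transition Q i j x) v = 0"
        unfolding tr by (cases V) (auto simp: warped_D_def)
      obtain u where u: "v = jacobian Q i j x u" using jacobian_surj[OF ij x(1)] by (metis surjD)
      have "(u, 0) \<in> DN i y" using v u \<eta>_transition[OF ij x(1)] by (simp add: warped_D_def)
      moreover have "jacobian N i j y (u, 0) = V" using ij x v u by (simp add: jacobian_N)
      ultimately show "V \<in> jacobian N i j y ` DN i y" by blast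
    qed
  qed
qed

lemma J_D: "i \<in> charts Q \<Longrightarrow> y \<in> cimg Q i \<times> I \<Longrightarrow> JN i y ` DN i y \<subseteq> DN i y"
proof -
  assume i: "i \<in> charts Q" and y: "y \<in> cimg Q i \<times> I"
  interpret C: warped_chart "cimg Q i" "g i" "\<phi> i" "\<xi>0 i" "\<eta> i" \<alpha> I p by (rule chart_locale[OF i])
  show ?thesis using y by (auto simp: local_eq[OF i] C.D_def C.J_def C.\<eta>_\<phi>)
qed

abbreviation "hol_curv \<equiv> warped_chart.hol_curv \<alpha> p"

lemma space_form_imp_quasi_constant:
  assumes "alpha_sasakian_space_form \<alpha> Q g \<phi> \<xi>0 \<eta>"
  shows "quasi_constant_hsc N gN JN DN"
proof -
  obtain H where "\<forall>i\<in>charts Q. \<forall>x\<in>cimg Q i. \<forall>u. g i x u u = 1 \<and> g i x u (\<xi>0 i x) = 0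
      \<longrightarrow> curvature4 (g i) x u (\<phi> i x u) (\<phi> i x u) u = H"
    using assms unfolding alpha_sasakian_space_form_def by (elim conjE exE)
  then have H: "curvature4 (g i) x u (\<phi> i x u) (\<phi> i x u) u = H"
    if "i \<in> charts Q" "x \<in> cimg Q i" "g i x u u = 1" "g i x u (\<xi>0 i x) = 0" for i x u
    using that by simp
  \<comment> \<open>Here cos \<theta> plays the role of a. The unit length h \<rho> + a^2 = 1
    determines \<rho>, and r = H \<rho>^2 by homogeneity of the \<phi>-holomorphic
    curvature.\<close>
  define K where "K m \<theta> = (let s = snd m; \<rho> = (1 - (cos \<theta>)\<^sup>2) / warped_chart.h p s in hol_curv s (H * \<rho>\<^sup>2) \<rho> (cos \<theta>))"
    for m :: "'a \<times> real" and \<theta>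
  have "sectional_curvature (gN i) (coord N i m) u v =
      K m (subspace_angle (gN i) (coord N i m) E (orth_complement (gN i) (coord N i m) (DN i (coord N i m))))"
    if i: "i \<in> charts Q" and m: "m \<in> cdom Q i \<times> I" and E: "subspace E" "dim E = 2" "JN i (coord N i m) ` E \<subseteq> E"
      and uv: "E = span {u, v}" for i m E u v
  proof -
    interpret C: warped_chart "cimg Q i" "g i" "\<phi> i" "\<xi>0 i" "\<eta> i" \<alpha> I p by (rule chart_locale[OF i])
    obtain q s where [simp]: "m = (q, s)" and q: "q \<in> cdom Q i" and s: "s \<in> I" using m by auto
    define x where "x = coord Q i q"
    have x: "x \<in> cimg Q i" using coord_in_cimg[OF i q] by (simp add: x_def)
    have c: "coord N i m = (x, s)" by (simp add: coord_N x_def)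
    obtain w a where w: "\<eta> i x w = 0" "a \<ge> 0" "C.W (x, s) (w, a) (w, a) = 1" "E = span {(w, a), C.J (x, s) (w, a)}"
      using C.J_plane_unit[OF x s E(1,2)] E(3) unfolding c local_eq[OF i] by blast
    have unit: "C.h s * g i x w w + a\<^sup>2 = 1" using w(1,3) by (simp add: C.W_horizontal)
    have "C.h s * g i x w w \<ge> 0" using C.h_pos[OF s] C.G_nonneg[OF x] by simp
    then have "a\<^sup>2 \<le> 1" using unit by simp
    then have a1: "a \<le> 1" using power2_le_imp_le[of a 1] by simp
    have ang: "subspace_angle C.W (x, s) E (orth_complement C.W (x, s) (C.D (x, s))) = arccos a"
      unfolding w(4) by (rule C.subspace_angle_J_plane[OF x s w(1,2,3)])
    have cos: "cos (arccos a) = a" using w(2) a1 by simp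
    have \<rho>: "g i x w w = (1 - a\<^sup>2) / C.h s" using unit C.h_pos[OF s] by (simp add: field_simps)
    have "g i x (C.R x w (\<phi> i x w) (\<phi> i x w)) w = H * (g i x w w)\<^sup>2"
      by (rule C.hsc_scale[OF x _ w(1)]) (use H[OF i x] in \<open>simp add: curvature4_def C.G_\<xi> x\<close>)
    moreover have "sectional_curvature C.W (x, s) u v = hol_curv s (g i x (C.R x w (\<phi> i x w) (\<phi> i x w)) w) (g i x w w) a"
      by (rule C.sectional_curvature_J_plane[OF x s w(1,3)]) (use uv w(4) in simp)
    ultimately show ?thesis
      unfolding c local_eq[OF i] ang by (simp add: K_def Let_def cos \<rho>)
  qed
  then show ?thesis
    unfolding quasi_constant_hsc_def Let_def
    using kaehler_N smooth_distribution_N J_D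
    by (intro conjI exI[of _ K]) (auto simp: charts_N cdom_N cimg_N)
qed

lemma quasi_constant_imp_space_form:
  assumes "quasi_constant_hsc N gN JN DN" "connected_space (mtop Q)" "DIM('e) \<ge> 4"
  shows "alpha_sasakian_space_form \<alpha> Q g \<phi> \<xi>0 \<eta>"
proof -
  obtain K where "\<forall>i\<in>charts Q. \<forall>m\<in>cdom Q i \<times> I. \<forall>E u v. subspace E \<and> dim E = 2 \<and>
      JN i (coord N i m) ` E \<subseteq> E \<and> E = span {u, v} \<longrightarrow> sectional_curvature (gN i) (coord N i m) u v =
      K m (subspace_angle (gN i) (coord N i m) E (orth_complement (gN i) (coord N i m) (DN i (coord N i m))))"
    using assms(1) unfolding quasi_constant_hsc_def Let_def charts_N cdom_N by (elim conjE exE)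
  then have K: "sectional_curvature (gN i) (coord N i m) u v =
      K m (subspace_angle (gN i) (coord N i m) E (orth_complement (gN i) (coord N i m) (DN i (coord N i m))))"
    if "i \<in> charts Q" "m \<in> cdom Q i \<times> I" "subspace E" "dim E = 2" "JN i (coord N i m) ` E \<subseteq> E" "E = span {u, v}"
    for i m E u v
    using that by blast
  have I0: "0 \<in> I" using warping by (simp add: warping_function_def)
  have h0: "warped_chart.h p 0 = 1" if "i \<in> charts Q" for i
  proof -
    interpret C: warped_chart "cimg Q i" "g i" "\<phi> i" "\<xi>0 i" "\<eta> i" \<alpha> I p by (rule chart_locale[OF that])
    show ?thesis using warping by (simp add: C.h_def warping_function_def)
  qed
  \<comment> \<open>This inverts the affine dependence of \<open>hol_curv\<close> on r for planes in
    D at s = 0, where a = 0, \<rho> = 1 and the slope is h 0 = p(0)^2 = 1; such planes make the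
    angle arccos 0 with the complement. As K is a function of points of the manifold, H does not
    depend on charts.\<close>
  define H where "H q = K (q, 0) (arccos 0) - hol_curv 0 0 1 0" for q
  have H: "g i x (curvature (g i) x u (\<phi> i x u) (\<phi> i x u)) u = H (inv_into (cdom Q i) (coord Q i) x)"
    if i: "i \<in> charts Q" and x: "x \<in> cimg Q i" and u: "\<eta> i x u = 0" "g i x u u = 1" for i x u
  proof -
    interpret C: warped_chart "cimg Q i" "g i" "\<phi> i" "\<xi>0 i" "\<eta> i" \<alpha> I p by (rule chart_locale[OF i])
    define q where "q = inv_into (cdom Q i) (coord Q i) x"
    have q: "q \<in> cdom Q i" "coord N i (q, 0) = (x, 0)"
      using coord_inv[OF i] x by (simp_all add: q_def coord_N)
    have unit: "C.W (x, 0) (u, 0) (u, 0) = 1" using u h0[OF i] by (simp add: C.W_horizontal)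
    let ?U = "(u, 0::real)"
    let ?E = "span {?U, C.J (x, 0) ?U}"
    have "?U \<noteq> 0" using unit C.W.G_lin(9)[of "(x, 0)" 0] x I0 by auto
    then have dim: "dim ?E = 2" by (rule C.dim_J_plane[OF x I0])
    have "C.J (x, 0) ` ?E = span (C.J (x, 0) ` {?U, C.J (x, 0) ?U})"
      by (rule linear_span_image[OF C.J_linear[OF x], symmetric])
    also have "\<dots> \<subseteq> ?E"
      by (rule span_minimal) (auto simp: C.J_J x I0 span_base span_neg simp del: uminus_Pair)
    finally have inv: "C.J (x, 0) ` ?E \<subseteq> ?E" .
    have "sectional_curvature C.W (x, 0) ?U (C.J (x, 0) ?U) = K (q, 0) (arccos 0)"
      using K[OF i _ subspace_span dim _ refl, of "(q, 0)"] inv q I0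
        C.subspace_angle_J_plane[OF x I0 u(1) _ unit]
      by (simp add: local_eq[OF i])
    moreover have "sectional_curvature C.W (x, 0) ?U (C.J (x, 0) ?U)
        = hol_curv 0 (g i x (C.R x u (\<phi> i x u) (\<phi> i x u)) u) (g i x u u) 0"
      by (rule C.sectional_curvature_J_plane[OF x I0 u(1) unit refl])
    ultimately show ?thesis
      using C.hol_curv_linear[of 0 "g i x (C.R x u (\<phi> i x u) (\<phi> i x u)) u" 1 0]
      by (simp add: H_def q_def u(2) h0[OF i])
  qed
  have "((\<lambda>x. H (inv_into (cdom Q i) (coord Q i) x)) has_derivative (\<lambda>h. 0)) (at x)"
    if i: "i \<in> charts Q" and x: "x \<in> cimg Q i" for i x
  proof -
    interpret C: warped_chart "cimg Q i" "g i" "\<phi> i" "\<xi>0 i" "\<eta> i" \<alpha> I p by (rule chart_locale[OF i])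
    show ?thesis
      by (rule C.schur_has_derivative[OF x assms(3)]) (rule C.hsc_scale[OF _ H[OF i]])
  qed
  \<comment> \<open>Schur's lemma yields constancy only locally; connectedness of Q provides one
    constant for all charts.\<close>
  from locally_constant_imp_constant[OF assms(2) this]
  obtain c where c: "\<And>q. q \<in> topspace (mtop Q) \<Longrightarrow> H q = c" by blast
  have "curvature4 (g i) x u (\<phi> i x u) (\<phi> i x u) u = c"
    if i: "i \<in> charts Q" and x: "x \<in> cimg Q i" and u: "g i x u u = 1" "g i x u (\<xi>0 i x) = 0" for i x u
  proof -
    interpret C: warped_chart "cimg Q i" "g i" "\<phi> i" "\<xi>0 i" "\<eta> i" \<alpha> I p by (rule chart_locale[OF i])
    have "inv_into (cdom Q i) (coord Q i) x \<in> topspace (mtop Q)"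
      using coord_inv(2)[OF i x] openin_subset[OF chart(1)[OF i]] by blast
    moreover have "\<eta> i x u = 0" using u(2) by (simp add: C.G_\<xi> x)
    ultimately show ?thesis
      unfolding curvature4_def using H[OF i x _ u(1)] c by metis
  qed
  then show ?thesis
    unfolding alpha_sasakian_space_form_def
    by (intro conjI sasakian exI[of _ c] ballI allI impI) (elim conjE)
qed

end

theorem proposition3p2:
  fixes Q :: "('a, 'i, 'e::euclidean_space) manifold"
    and g :: "('i, 'e) metric" and \<phi> :: "('i, 'e) endo"
    and \<xi>0 :: "('i, 'e) vec_field" and \<eta> :: "('i, 'e) one_form"
    and \<alpha> :: real and I :: "real set" and p :: "real \<Rightarrow> real" and n :: nat
  assumes "alpha_sasakian \<alpha> Q g \<phi> \<xi>0 \<eta>"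
    and "connected_space (mtop Q)"
    and "DIM('e \<times> real) = 2 * n" and "2 * n \<ge> 6"
    and "warping_function \<alpha> I p"
  shows "quasi_constant_hsc (warped_manifold Q I) (warped_metric \<alpha> p g \<eta>)
           (warped_J \<alpha> p \<phi> \<xi>0 \<eta>) (warped_D \<eta>)
         \<longleftrightarrow> alpha_sasakian_space_form \<alpha> Q g \<phi> \<xi>0 \<eta>"
proof -
  interpret warped_product Q g \<phi> \<xi>0 \<eta> \<alpha> I p
    using assms(1,5) by unfold_locales
  have "DIM('e) \<ge> 4" using assms(3,4) by simp
  then show ?thesis
    using space_form_imp_quasi_constant quasi_constant_imp_space_form assms(2) by blast
qed

end
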